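(* Let $\theta_\infty,\kappa_0\in\mathbb{C}$ and consider the fourth Painlevé equation (P$_{\rm IV}$): $$\frac{dx}{dz}=-x^2+2xy+2xz-2\theta_\infty,\qquad\frac{dy}{dz}=-y^2+2xy-2yz-2\kappa_0 .$$ Define coordinates $(u_3,w_3)$, $(u_6,w_6)$, $(u_9,w_9)$ by $$\begin{aligned}&x=w_3^{-1},\quad y=u_3w_3^2+2\kappa_0w_3; &(a)\\ &x=w_6^{-1},\quad y=w_6^{-1}+u_6w_6^2-2z-2(\kappa_0-\theta_\infty-1)w_6; &(b)\\ &x=u_9w_9^2+2\theta_\infty w_9,\quad y=w_9^{-1}. &(c)\end{aligned}$$ (i) The space of initial conditions $E(z)$ for (P$_{\rm IV}$) is given by $\mathbb{C}^2_{(x,y)}\cup\mathbb{C}^2_{(u_3,w_3)}\cup\mathbb{C}^2_{(u_6,w_6)}\cup\mathbb{C}^2_{(u_9,w_9)}$ glued by (a), (b) and (c). (ii) These transformations are symplectic, i.e. for fixed $z$, $dx\wedge dy=\pm du_i\wedge dw_i$ for $i=3,6,9$. (iii) Consider a Hamiltonian system $dx/dz=f(x,y,z)$, $dy/dz=g(x,y,z)$, where $f$ and $g$ are polynomials in $x$ and $y$ (with coefficients depending on $z$). If it is also expressed as polynomial Hamiltonian systems in the $(u_3,w_3)$-, $(u_6,w_6)$- and $(u_9,w_9)$-coordinates, then it is (P$_{\rm IV}$).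
   Context: A manifold $E(z)$ parameterized by $z\in\mathbb{C}$ is called the space of initial conditions of a polynomial system (with independent variable $z$) if every solution of the system gives a global holomorphic section of the fiber bundle $\mathcal{P}=\{(x,z): x\in E(z),\ z\in\mathbb{C}\}$ over $\mathbb{C}$. The independent variable $z$ is the same in all the charts. The gluings (a), (b) identify $\{x\neq0\}$ with $\{w_3\ne0\}$, $\{w_6\neq0\}$, and (c) identifies $\{y\ne0\}$ with $\{w_9\neq0\}$. Polynomial means polynomial in the two dependent variables of the chart. Hamiltonian is meant with respect to $dx\wedge dy$, resp. $du_i\wedge dw_i$ (up to sign). The parameters $\theta_\infty,\kappa_0$ in (a)–(c) are the same as in (P$_{\rm IV}$). *)

theory Defs
  imports "HOL-Analysis.Analysis"
begin

section \<open>Complex manifolds and holomorphic families\<close>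

text \<open>Holomorphy in several variables: complex Frechet differentiability at each point.\<close>

definition holomorphic_fun_on :: "(complex^'n \<Rightarrow> complex) \<Rightarrow> (complex^'n) set \<Rightarrow> bool" where
  "holomorphic_fun_on f S \<longleftrightarrow>
     (\<forall>p\<in>S. \<exists>a :: complex^'n. (f has_derivative (\<lambda>v. \<Sum>k\<in>UNIV. a $ k * v $ k)) (at p within S))"

definition holomorphic_map_on :: "(complex^'n \<Rightarrow> complex^'m) \<Rightarrow> (complex^'n) set \<Rightarrow> bool" where
  "holomorphic_map_on f S \<longleftrightarrow> (\<forall>k. holomorphic_fun_on (\<lambda>p. f p $ k) S)"

text \<open>An atlas is a set of pairs (domain, coordinate map). A complex manifold of dimension
  \<open>CARD('n)\<close> is a Hausdorff, second countable space with such an atlas.\<close>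

definition complex_manifold :: "'p topology \<Rightarrow> ('p set \<times> ('p \<Rightarrow> complex^'n)) set \<Rightarrow> bool" where
  "complex_manifold X A \<longleftrightarrow>
     Hausdorff_space X \<and> second_countable X \<and>
     (\<Union>(U, \<phi>)\<in>A. U) = topspace X \<and>
     (\<forall>(U, \<phi>)\<in>A. openin X U \<and> open (\<phi> ` U) \<and>
        homeomorphic_map (subtopology X U) (top_of_set (\<phi> ` U)) \<phi>) \<and>
     (\<forall>(U, \<phi>)\<in>A. \<forall>(V, \<psi>)\<in>A. holomorphic_map_on (\<psi> \<circ> inv_into U \<phi>) (\<phi> ` (U \<inter> V)))"

text \<open>A family of complex manifolds \<open>E z\<close> (atlas \<open>A z\<close>), parameterized by \<open>z\<close> in the complex
  plane, whose total space \<open>{(p, z). p \<in> E z}\<close> is a complex manifold \<open>X\<close> (atlas \<open>B\<close>) and a fiber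
  bundle over the plane: each \<open>E z\<close> is embedded holomorphically as the fiber over \<open>z\<close>, the
  projection is holomorphic, and the bundle is locally trivial.\<close>

definition manifold_bundle ::
  "(complex \<Rightarrow> 'p topology) \<Rightarrow> (complex \<Rightarrow> ('p set \<times> ('p \<Rightarrow> complex^'n)) set) \<Rightarrow>
   ('p \<times> complex) topology \<Rightarrow> (('p \<times> complex) set \<times> ('p \<times> complex \<Rightarrow> complex^'m)) set \<Rightarrow> bool" where
  "manifold_bundle E A X B \<longleftrightarrow>
     (\<forall>z. complex_manifold (E z) (A z)) \<and>
     complex_manifold X B \<and>
     topspace X = {(p, z). p \<in> topspace (E z)} \<and>
     (\<forall>z. embedding_map (E z) X (\<lambda>p. (p, z))) \<and>
     (\<forall>z. \<forall>(U, \<phi>)\<in>A z. \<forall>(V, \<psi>)\<in>B.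
        holomorphic_map_on (\<lambda>q. \<psi> (inv_into U \<phi> q, z)) (\<phi> ` {p \<in> U. (p, z) \<in> V})) \<and>
     (\<forall>(V, \<psi>)\<in>B. holomorphic_fun_on (\<lambda>q. snd (inv_into V \<psi> q)) (\<psi> ` V)) \<and>
     (\<forall>z\<^sub>0. \<exists>N h. open N \<and> z\<^sub>0 \<in> N \<and>
        homeomorphic_map (subtopology X {s \<in> topspace X. snd s \<in> N})
                         (prod_topology (top_of_set N) (E z\<^sub>0)) h \<and>
        (\<forall>s\<in>topspace X. snd s \<in> N \<longrightarrow> fst (h s) = snd s))"

definition global_holomorphic_section ::
  "('p \<times> complex) topology \<Rightarrow> (('p \<times> complex) set \<times> ('p \<times> complex \<Rightarrow> complex^'m)) set \<Rightarrow>
   (complex \<Rightarrow> 'p \<times> complex) \<Rightarrow> bool" where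
  "global_holomorphic_section X B s \<longleftrightarrow>
     (\<forall>z. snd (s z) = z) \<and> continuous_map euclidean X s \<and>
     (\<forall>(V, \<psi>)\<in>B. \<forall>k. (\<lambda>z. \<psi> (s z) $ k) holomorphic_on {z. s z \<in> V})"

definition solution_on ::
  "(complex \<Rightarrow> complex^2 \<Rightarrow> complex^2) \<Rightarrow> complex set \<Rightarrow> (complex \<Rightarrow> complex^2) \<Rightarrow> bool" where
  "solution_on G D v \<longleftrightarrow>
     (\<forall>z\<in>D. \<forall>k. ((\<lambda>t. v t $ k) has_field_derivative G z (v z) $ k) (at z))"

text \<open>\<open>\<iota> z\<close> realizes the phase space of the system \<open>G\<close> as a chart of \<open>E z\<close>. Solutions
  are holomorphic functions on an arbitrary nonempty domain \<open>D\<close>.\<close>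

definition space_of_initial_conditions ::
  "(complex \<Rightarrow> complex^2 \<Rightarrow> complex^2) \<Rightarrow> (complex \<Rightarrow> complex^2 \<Rightarrow> 'p) \<Rightarrow>
   (complex \<Rightarrow> 'p topology) \<Rightarrow> (complex \<Rightarrow> ('p set \<times> ('p \<Rightarrow> complex^2)) set) \<Rightarrow>
   ('p \<times> complex) topology \<Rightarrow> (('p \<times> complex) set \<times> ('p \<times> complex \<Rightarrow> complex^3)) set \<Rightarrow> bool" where
  "space_of_initial_conditions G \<iota> E A X B \<longleftrightarrow>
     manifold_bundle E A X B \<and>
     (\<forall>z. inj (\<iota> z) \<and> (range (\<iota> z), inv (\<iota> z)) \<in> A z) \<and>
     (\<forall>D v. open D \<and> connected D \<and> D \<noteq> {} \<and> solution_on G D v \<longrightarrow>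
        (\<exists>s. global_holomorphic_section X B s \<and> (\<forall>z\<in>D. s z = (\<iota> z (v z), z))))"


section \<open>Symplectic maps and Hamiltonian systems in the plane\<close>

text \<open>The two-form \<open>dx \<and> dy\<close> (or \<open>du \<and> dw\<close>) evaluated on a pair of tangent vectors.\<close>

definition area_form :: "complex^2 \<Rightarrow> complex^2 \<Rightarrow> complex" where
  "area_form v w = v $ 1 * w $ 2 - v $ 2 * w $ 1"

definition symplectic_up_to_sign :: "(complex^2) set \<Rightarrow> (complex^2 \<Rightarrow> complex^2) \<Rightarrow> bool" where
  "symplectic_up_to_sign S f \<longleftrightarrow>
     (\<exists>\<epsilon>\<in>{1, -1}. \<forall>p\<in>S. \<exists>L. (f has_derivative L) (at p) \<and>
        (\<forall>v w. area_form (L v) (L w) = \<epsilon> * area_form v w))"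

definition polynomial_field :: "(complex^2 \<Rightarrow> complex^2) \<Rightarrow> bool" where
  "polynomial_field F \<longleftrightarrow>
     (\<forall>k. \<exists>(n::nat) c. \<forall>p. F p $ k = (\<Sum>i\<le>n. \<Sum>j\<le>n. c i j * (p $ 1) ^ i * (p $ 2) ^ j))"

text \<open>\<open>F = (\<partial>H/\<partial>y, - \<partial>H/\<partial>x)\<close>, i.e. \<open>dH\<close> is the contraction of the area form with \<open>F\<close>.
  Reversing the sign of the form only replaces \<open>H\<close> by \<open>- H\<close>.\<close>

definition hamiltonian_field :: "(complex^2 \<Rightarrow> complex^2) \<Rightarrow> bool" where
  "hamiltonian_field F \<longleftrightarrow>
     (\<exists>H :: complex^2 \<Rightarrow> complex. \<forall>p. (H has_derivative area_form (F p)) (at p))"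

text \<open>The system \<open>(u, w)' = F z (u, w)\<close> is the system \<open>(x, y)' = G z (x, y)\<close> expressed in the
  coordinates given by the \<open>z\<close>-dependent substitution \<open>(x, y) = \<phi> z (u, w)\<close>, \<open>(u, w) \<in> W\<close>: the
  chain rule for the derivative of \<open>\<phi> z (u, w)\<close> along \<open>F\<close>, including the contribution of the
  explicit dependence of \<open>\<phi>\<close> on \<open>z\<close>.\<close>

definition expressed_in_coordinates ::
  "complex set \<Rightarrow> (complex^2) set \<Rightarrow> (complex \<Rightarrow> complex^2 \<Rightarrow> complex^2) \<Rightarrow>
   (complex \<Rightarrow> complex^2 \<Rightarrow> complex^2) \<Rightarrow> (complex \<Rightarrow> complex^2 \<Rightarrow> complex^2) \<Rightarrow> bool" where
  "expressed_in_coordinates Z W \<phi> G F \<longleftrightarrow>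
     (\<forall>z\<in>Z. \<forall>p\<in>W. \<exists>L. ((\<lambda>(t, q). \<phi> t q) has_derivative L) (at (z, p)) \<and>
        L (1, F z p) = G z (\<phi> z p))"


section \<open>The fourth Painleve equation and its charts\<close>

text \<open>\<open>\<theta>\<close> and \<open>\<kappa>\<close> stand for \<open>\<theta>\<close> with index infinity and \<open>\<kappa>\<close> with index 0.\<close>

definition PIV :: "complex \<Rightarrow> complex \<Rightarrow> complex \<Rightarrow> complex^2 \<Rightarrow> complex^2" where
  "PIV \<theta> \<kappa> z p = (let x = p $ 1; y = p $ 2 in
     vector [- (x^2) + 2*x*y + 2*x*z - 2*\<theta>, - (y^2) + 2*x*y - 2*y*z - 2*\<kappa>])"

datatype chart = XY | UW3 | UW6 | UW9

text \<open>Points of the chart \<open>XY\<close> are vectors \<open>(x, y)\<close>, points of the other charts are vectors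
  \<open>(u, w)\<close>. For the latter the formulas are meaningful on \<open>w \<noteq> 0\<close> only.\<close>

definition to_xy :: "complex \<Rightarrow> complex \<Rightarrow> chart \<Rightarrow> complex \<Rightarrow> complex^2 \<Rightarrow> complex^2" where
  "to_xy \<theta> \<kappa> c z p = (let u = p $ 1; w = p $ 2 in
     case c of
       XY \<Rightarrow> p
     | UW3 \<Rightarrow> vector [1 / w, u * w^2 + 2*\<kappa>*w]
     | UW6 \<Rightarrow> vector [1 / w, 1 / w + u * w^2 - 2*z - 2*(\<kappa> - \<theta> - 1)*w]
     | UW9 \<Rightarrow> vector [u * w^2 + 2*\<theta>*w, 1 / w])"

definition chart_overlap :: "(complex^2) set" where
  "chart_overlap = {p. p $ 2 \<noteq> 0}"

text \<open>The equivalence relation on the disjoint union of the four charts generated by the gluings.\<close>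

definition glue_rel ::
  "complex \<Rightarrow> complex \<Rightarrow> complex \<Rightarrow> ((chart \<times> (complex^2)) \<times> (chart \<times> (complex^2))) set" where
  "glue_rel \<theta> \<kappa> z =
     (let R = {((c, p), (XY, to_xy \<theta> \<kappa> c z p)) | c p. c \<noteq> XY \<and> p \<in> chart_overlap}
      in (R \<union> R\<inverse>)\<^sup>*)"

definition chart_pt ::
  "complex \<Rightarrow> complex \<Rightarrow> chart \<Rightarrow> complex \<Rightarrow> complex^2 \<Rightarrow> (chart \<times> (complex^2)) set" where
  "chart_pt \<theta> \<kappa> c z p = glue_rel \<theta> \<kappa> z `` {(c, p)}"

text \<open>Total space charts have coordinates \<open>(u, w, z)\<close>, with the same \<open>z\<close> in all charts.\<close>

definition total_pt ::
  "complex \<Rightarrow> complex \<Rightarrow> chart \<Rightarrow> complex^3 \<Rightarrow> (chart \<times> (complex^2)) set \<times> complex" where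
  "total_pt \<theta> \<kappa> c q = (chart_pt \<theta> \<kappa> c (q $ 3) (vector [q $ 1, q $ 2]), q $ 3)"

definition quotient_topology :: "'a topology \<Rightarrow> ('a \<Rightarrow> 'b) \<Rightarrow> 'b topology" where
  "quotient_topology X f =
     topology (\<lambda>U. U \<subseteq> f ` topspace X \<and> openin X {x \<in> topspace X. f x \<in> U})"

lemma openin_quotient_topology:
  "openin (quotient_topology X f) U \<longleftrightarrow>
     U \<subseteq> f ` topspace X \<and> openin X {x \<in> topspace X. f x \<in> U}"
proof -
  have "istopology (\<lambda>U. U \<subseteq> f ` topspace X \<and> openin X {x \<in> topspace X. f x \<in> U})"
    unfolding istopology_def
  proof (intro conjI allI impI)
    fix S T
    assume "S \<subseteq> f ` topspace X \<and> openin X {x \<in> topspace X. f x \<in> S}"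
      and "T \<subseteq> f ` topspace X \<and> openin X {x \<in> topspace X. f x \<in> T}"
    moreover have "{x \<in> topspace X. f x \<in> S \<inter> T} =
        {x \<in> topspace X. f x \<in> S} \<inter> {x \<in> topspace X. f x \<in> T}"
      by blast
    ultimately show "S \<inter> T \<subseteq> f ` topspace X" "openin X {x \<in> topspace X. f x \<in> S \<inter> T}"
      by auto
  next
    fix K
    assume K: "\<forall>S\<in>K. S \<subseteq> f ` topspace X \<and> openin X {x \<in> topspace X. f x \<in> S}"
    then show "\<Union>K \<subseteq> f ` topspace X"
      by blast
    have "{x \<in> topspace X. f x \<in> \<Union>K} = (\<Union>S\<in>K. {x \<in> topspace X. f x \<in> S})"
      by blast
    then show "openin X {x \<in> topspace X. f x \<in> \<Union>K}"
      using K by auto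
  qed
  then show ?thesis
    by (simp add: quotient_topology_def topology_inverse')
qed

lemma topspace_quotient_topology: "topspace (quotient_topology X f) = f ` topspace X"
proof
  show "topspace (quotient_topology X f) \<subseteq> f ` topspace X"
    by (metis openin_quotient_topology openin_topspace)
  have "{x \<in> topspace X. f x \<in> f ` topspace X} = topspace X"
    by blast
  then have "openin (quotient_topology X f) (f ` topspace X)"
    by (simp add: openin_quotient_topology)
  then show "f ` topspace X \<subseteq> topspace (quotient_topology X f)"
    by (rule openin_subset)
qed

lemma quotient_map_quotient_topology: "quotient_map X (quotient_topology X f) f"
  by (auto simp: quotient_map_def openin_quotient_topology topspace_quotient_topology)

definition E_space :: "complex \<Rightarrow> complex \<Rightarrow> complex \<Rightarrow> (chart \<times> (complex^2)) set topology" where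
  "E_space \<theta> \<kappa> z =
     quotient_topology (sum_topology (\<lambda>_. euclidean) UNIV) (\<lambda>(c, p). chart_pt \<theta> \<kappa> c z p)"

definition E_atlas :: "complex \<Rightarrow> complex \<Rightarrow> complex \<Rightarrow>
    ((chart \<times> (complex^2)) set set \<times> ((chart \<times> (complex^2)) set \<Rightarrow> complex^2)) set" where
  "E_atlas \<theta> \<kappa> z = (\<lambda>c. (range (chart_pt \<theta> \<kappa> c z), inv (chart_pt \<theta> \<kappa> c z))) ` UNIV"

definition P_space :: "complex \<Rightarrow> complex \<Rightarrow> ((chart \<times> (complex^2)) set \<times> complex) topology" where
  "P_space \<theta> \<kappa> =
     quotient_topology (sum_topology (\<lambda>_. euclidean) UNIV) (\<lambda>(c, q). total_pt \<theta> \<kappa> c q)"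

definition P_atlas :: "complex \<Rightarrow> complex \<Rightarrow>
    (((chart \<times> (complex^2)) set \<times> complex) set \<times>
     ((chart \<times> (complex^2)) set \<times> complex \<Rightarrow> complex^3)) set" where
  "P_atlas \<theta> \<kappa> = (\<lambda>c. (range (total_pt \<theta> \<kappa> c), inv (total_pt \<theta> \<kappa> c))) ` UNIV"

end

theory Submission
  imports Defs "HOL-Complex_Analysis.Cauchy_Integral_Theorem" "HOL-Computational_Algebra.Polynomial_Factorial"
    "HOL-Computational_Algebra.Field_as_Ring"
begin

text \<open>(i) In every chart the vector field is polynomial, so near a point of a chart solutions exist on a
  disc whose radius depends only on a bound for the coordinates. Let
  \<open>H = x * y * f - 2 * \<theta> * y + 2 * \<kappa> * x\<close>, \<open>f = y - x + 2 * z\<close>, be the Hamiltonian. Along a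
  solution \<open>H\<close> has derivative \<open>2 * x * y\<close>, and \<open>V = H - 2 * x / (1 + f * cnj f)\<close> extends continuously
  to the three curves \<open>w = 0\<close> at infinity. For \<open>z\<close> in a bounded set the derivative of \<open>V\<close> along a
  solution is at most a constant times \<open>1 + norm V\<close>, so \<open>V\<close> stays bounded by Gronwall's argument;
  and every point at which \<open>V\<close> is bounded has bounded coordinates in one of the charts. Hence a
  solution can be continued by a fixed radius until it reaches the boundary of the bounded set.

  (iii) The Hamiltonian is a polynomial in \<open>(x, y)\<close>, so its difference \<open>P\<close> from \<open>H\<close> is a polynomial in
  \<open>x\<close> and the slope \<open>v = y / x\<close>, with coefficients of degree at most \<open>k\<close> at \<open>x ^ k\<close>. It stays polynomial in
  the charts at infinity, since both Hamiltonians receive the same correction from the \<open>z\<close>-dependence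
  of (b). If \<open>n > 0\<close> is the degree of \<open>P\<close> in \<open>x\<close>, then the conditions at the points \<open>v = 0\<close>, \<open>v = 1\<close> and \<open>v = \<infinity>\<close> at
  infinity force \<open>n = 3 * m\<close> and the leading coefficient \<open>C * (v * (v - 1)) ^ m\<close>, which is that of \<open>C * H ^ m\<close>.
  But not \<open>H\<close>, only \<open>H - 2 * x\<close>, is polynomial in the chart of (b): the same three conditions for
  \<open>P - C * H ^ m\<close> and \<open>P - C * (H - 2 * x) ^ m\<close> contradict each other at \<open>x ^ (n - 2)\<close>.\<close>

section \<open>Local solutions of ordinary differential equations\<close>

text \<open>The obstacle in both (i) and (iii) is the term \<open>- 2 * z\<close> of (b): through it
  the Hamiltonian of that chart is \<open>H - 2 * x\<close>, while in (a) and (c) it is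
  \<open>H\<close> up to sign. \<open>H\<close> has a pole along the curve of (b),
  \<open>H - 2 * x\<close> has one along that of (a), so \<open>V\<close> must remove
  \<open>2 * x\<close> at one curve only. On the curve of (b) \<open>f\<close> vanishes, on the
  other two it has a pole; hence \<open>1 / (1 + f * cnj f)\<close> acts as the required switch,
  whereas a holomorphic choice such as \<open>1 / (1 + f^2)\<close> would bring new poles. The price
  is that \<open>V\<close> is only real differentiable, so growth is measured along segments. On the
  curves at infinity only continuity is used, as solutions cross them at isolated times. In (iii)
  the 3 in \<open>n = 3 * m\<close> is an order of contact: along each curve the slope
  \<open>v\<close>, or \<open>1 / v\<close>, is prescribed up to a multiple of \<open>w^3\<close>,
  so a pole of order \<open>n\<close> costs the leading coefficient a zero of order at least
  \<open>n / 3\<close> at each of three points, and its degree leaves room for exactly that. Local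
  trivializations of the bundle need only be homeomorphisms, which permits a construction with a
  cutoff.\<close>

definition lipschitz_coefficient :: "(complex \<Rightarrow> complex^2 \<Rightarrow> complex) \<Rightarrow> bool" where
  "lipschitz_coefficient g \<longleftrightarrow>
     (\<forall>R. \<exists>B\<ge>0. \<forall>z p q. norm z \<le> R \<longrightarrow> norm p \<le> R \<longrightarrow> norm q \<le> R \<longrightarrow>
        norm (g z p) \<le> B \<and> norm (g z p - g z q) \<le> B * norm (p - q)) \<and>
     (\<forall>D v. open D \<longrightarrow> (\<forall>k. (\<lambda>t. v t $ k) holomorphic_on D) \<longrightarrow> (\<lambda>t. g t (v t)) holomorphic_on D)"

lemma lipschitz_coefficientD1:
  assumes "lipschitz_coefficient g"
  obtains B where "B \<ge> 0" "\<And>z p. norm z \<le> R \<Longrightarrow> norm p \<le> R \<Longrightarrow> norm (g z p) \<le> B"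
    "\<And>z p q. norm z \<le> R \<Longrightarrow> norm p \<le> R \<Longrightarrow> norm q \<le> R \<Longrightarrow> norm (g z p - g z q) \<le> B * norm (p - q)"
proof -
  have "\<exists>B\<ge>0. \<forall>z p q. norm z \<le> R \<longrightarrow> norm p \<le> R \<longrightarrow> norm q \<le> R \<longrightarrow>
        norm (g z p) \<le> B \<and> norm (g z p - g z q) \<le> B * norm (p - q)"
    using assms unfolding lipschitz_coefficient_def by blast
  then show thesis using that by blast
qed

lemma lipschitz_coefficientD2:
  assumes "lipschitz_coefficient g" "open D" "\<And>k. (\<lambda>t. v t $ k) holomorphic_on D"
  shows "(\<lambda>t. g t (v t)) holomorphic_on D"
  using assms unfolding lipschitz_coefficient_def by blast

lemma lipschitz_coefficient_time:
  assumes "f holomorphic_on UNIV"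
  shows "lipschitz_coefficient (\<lambda>z p. f z)"
  unfolding lipschitz_coefficient_def
proof (intro conjI allI impI)
  fix R
  have "compact (f ` cball 0 R)"
    by (intro compact_continuous_image holomorphic_on_imp_continuous_on holomorphic_on_subset[OF assms]) auto
  then obtain B where "\<And>x. x \<in> cball 0 R \<Longrightarrow> norm (f x) \<le> B"
    by (meson compact_imp_bounded bounded_iff image_eqI)
  then show "\<exists>B\<ge>0. \<forall>z p q. norm z \<le> R \<longrightarrow> norm p \<le> R \<longrightarrow> norm q \<le> R \<longrightarrow>
     norm (f z) \<le> B \<and> norm (f z - f z) \<le> B * norm (p - q)"
    by (intro exI[of _ "max B 0"]) (auto intro: max.coboundedI1)
qed (rule holomorphic_on_subset[OF assms], simp)

lemma lipschitz_coefficient_nth: "lipschitz_coefficient (\<lambda>z p. p $ k)"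
  unfolding lipschitz_coefficient_def
proof (intro conjI allI impI)
  fix R :: real
  have "norm (p $ k) \<le> max R 1 \<and> norm (p $ k - q $ k) \<le> max R 1 * norm (p - q)"
    if "norm p \<le> R" for p q :: "complex^2"
  proof -
    have "norm (p $ k - q $ k) \<le> 1 * norm (p - q)"
      using Finite_Cartesian_Product.norm_nth_le[of "p - q" k] by simp
    also have "\<dots> \<le> max R 1 * norm (p - q)"
      by (intro mult_right_mono) auto
    finally show ?thesis
      using Finite_Cartesian_Product.norm_nth_le[of p k] that by auto
  qed
  then show "\<exists>B\<ge>0. \<forall>(z::complex) (p::complex^2) q. norm z \<le> R \<longrightarrow> norm p \<le> R \<longrightarrow> norm q \<le> R \<longrightarrow>
     norm (p $ k) \<le> B \<and> norm (p $ k - q $ k) \<le> B * norm (p - q)"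
    by (intro exI[of _ "max R 1"]) (auto intro: max.coboundedI2)
qed auto

lemma lipschitz_coefficient_add:
  assumes "lipschitz_coefficient f" "lipschitz_coefficient g"
  shows "lipschitz_coefficient (\<lambda>z p. f z p + g z p)"
  unfolding lipschitz_coefficient_def
proof (intro conjI allI impI)
  fix R :: real
  obtain A where A: "A \<ge> 0" "\<And>z p. norm z \<le> R \<Longrightarrow> norm p \<le> R \<Longrightarrow> norm (f z p) \<le> A"
    "\<And>z p q. norm z \<le> R \<Longrightarrow> norm p \<le> R \<Longrightarrow> norm q \<le> R \<Longrightarrow> norm (f z p - f z q) \<le> A * norm (p - q)"
    by (rule lipschitz_coefficientD1[OF assms(1)]) blast
  obtain B where B: "B \<ge> 0" "\<And>z p. norm z \<le> R \<Longrightarrow> norm p \<le> R \<Longrightarrow> norm (g z p) \<le> B"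
    "\<And>z p q. norm z \<le> R \<Longrightarrow> norm p \<le> R \<Longrightarrow> norm q \<le> R \<Longrightarrow> norm (g z p - g z q) \<le> B * norm (p - q)"
    by (rule lipschitz_coefficientD1[OF assms(2)]) blast
  have "norm (f z p + g z p) \<le> A + B \<and> norm (f z p + g z p - (f z q + g z q)) \<le> (A + B) * norm (p - q)"
    if "norm z \<le> R" "norm p \<le> R" "norm q \<le> R" for z p q
  proof -
    have "norm (f z p + g z p) \<le> A + B"
      using A(2) B(2) that by (meson norm_add_rule_thm)
    moreover have "norm ((f z p - f z q) + (g z p - g z q)) \<le> A * norm (p - q) + B * norm (p - q)"
      using A(3) B(3) that by (meson norm_add_rule_thm)
    ultimately show ?thesis by (simp add: algebra_simps)
  qed
  then show "\<exists>B\<ge>0. \<forall>z p q. norm z \<le> R \<longrightarrow> norm p \<le> R \<longrightarrow> norm q \<le> R \<longrightarrow>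
     norm (f z p + g z p) \<le> B \<and> norm (f z p + g z p - (f z q + g z q)) \<le> B * norm (p - q)"
    using A(1) B(1) by (intro exI[of _ "A + B"]) auto
next
  fix D :: "complex set" and v :: "complex \<Rightarrow> complex^2"
  assume D: "open D" "\<forall>k. (\<lambda>t. v t $ k) holomorphic_on D"
  show "(\<lambda>t. f t (v t) + g t (v t)) holomorphic_on D"
    using D by (intro holomorphic_on_add[OF lipschitz_coefficientD2[OF assms(1)] lipschitz_coefficientD2[OF assms(2)]]) blast+
qed

lemma lipschitz_coefficient_mult:
  assumes "lipschitz_coefficient f" "lipschitz_coefficient g"
  shows "lipschitz_coefficient (\<lambda>z p. f z p * g z p)"
  unfolding lipschitz_coefficient_def
proof (intro conjI allI impI)
  fix R :: real
  obtain A where A: "A \<ge> 0" "\<And>z p. norm z \<le> R \<Longrightarrow> norm p \<le> R \<Longrightarrow> norm (f z p) \<le> A"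
    "\<And>z p q. norm z \<le> R \<Longrightarrow> norm p \<le> R \<Longrightarrow> norm q \<le> R \<Longrightarrow> norm (f z p - f z q) \<le> A * norm (p - q)"
    by (rule lipschitz_coefficientD1[OF assms(1)]) blast
  obtain B where B: "B \<ge> 0" "\<And>z p. norm z \<le> R \<Longrightarrow> norm p \<le> R \<Longrightarrow> norm (g z p) \<le> B"
    "\<And>z p q. norm z \<le> R \<Longrightarrow> norm p \<le> R \<Longrightarrow> norm q \<le> R \<Longrightarrow> norm (g z p - g z q) \<le> B * norm (p - q)"
    by (rule lipschitz_coefficientD1[OF assms(2)]) blast
  define C where "C = 2 * A * B"
  have "C \<ge> 0" using A(1) B(1) by (simp add: C_def)
  have "norm (f z p * g z p) \<le> C \<and> norm (f z p * g z p - f z q * g z q) \<le> C * norm (p - q)"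
    if "norm z \<le> R" "norm p \<le> R" "norm q \<le> R" for z p q
  proof -
    have AB: "A * B \<le> C" using A(1) B(1) by (simp add: C_def)
    have "norm (f z p * g z p) \<le> A * B"
      unfolding norm_mult using A B that by (intro mult_mono) auto
    with AB have 1: "norm (f z p * g z p) \<le> C" by linarith
    have "f z p * g z p - f z q * g z q = f z p * (g z p - g z q) + (f z p - f z q) * g z q"
      by (simp add: algebra_simps)
    also have "norm \<dots> \<le> norm (f z p) * norm (g z p - g z q) + norm (f z p - f z q) * norm (g z q)"
      by (metis norm_mult norm_triangle_ineq)
    also have "\<dots> \<le> A * (B * norm (p - q)) + (A * norm (p - q)) * B"
      using A B that by (intro add_mono mult_mono) auto
    finally show ?thesis using 1 by (simp add: C_def algebra_simps)
  qed
  then show "\<exists>B\<ge>0. \<forall>z p q. norm z \<le> R \<longrightarrow> norm p \<le> R \<longrightarrow> norm q \<le> R \<longrightarrow>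
     norm (f z p * g z p) \<le> B \<and> norm (f z p * g z p - f z q * g z q) \<le> B * norm (p - q)"
    using \<open>C \<ge> 0\<close> by blast
next
  fix D :: "complex set" and v :: "complex \<Rightarrow> complex^2"
  assume D: "open D" "\<forall>k. (\<lambda>t. v t $ k) holomorphic_on D"
  show "(\<lambda>t. f t (v t) * g t (v t)) holomorphic_on D"
    using D by (intro holomorphic_on_mult[OF lipschitz_coefficientD2[OF assms(1)] lipschitz_coefficientD2[OF assms(2)]]) blast+
qed

lemma lipschitz_coefficient_minus:
  "lipschitz_coefficient f \<Longrightarrow> lipschitz_coefficient (\<lambda>z p. - f z p)"
  using lipschitz_coefficient_mult[OF lipschitz_coefficient_time[of "\<lambda>_. -1"], of f] by simp

lemma lipschitz_coefficient_diff:
  "lipschitz_coefficient f \<Longrightarrow> lipschitz_coefficient g \<Longrightarrow> lipschitz_coefficient (\<lambda>z p. f z p - g z p)"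
  using lipschitz_coefficient_add[of f "\<lambda>z p. - g z p"] lipschitz_coefficient_minus[of g] by simp

lemma lipschitz_coefficient_power:
  "lipschitz_coefficient f \<Longrightarrow> lipschitz_coefficient (\<lambda>z p. f z p ^ n)"
  using lipschitz_coefficient_time[of "\<lambda>_. 1"]
  by (induction n) (simp_all add: lipschitz_coefficient_mult)

lemmas lipschitz_coefficient_intros =
  lipschitz_coefficient_add lipschitz_coefficient_diff lipschitz_coefficient_minus
  lipschitz_coefficient_mult lipschitz_coefficient_power lipschitz_coefficient_nth
  lipschitz_coefficient_time

text \<open>The class is tailored to Picard iteration: on each ball one constant bounds the
  components and their increments, uniformly in bounded time, and substituting a holomorphic curve
  gives a holomorphic function, which has primitives on discs. It is closed under the ring
  operations, so polynomial fields belong to it.\<close>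

definition lipschitz_field :: "(complex \<Rightarrow> complex^2 \<Rightarrow> complex^2) \<Rightarrow> bool" where
  "lipschitz_field G \<longleftrightarrow> (\<forall>k. lipschitz_coefficient (\<lambda>z p. G z p $ k))"

lemma norm_vec2_le: "norm (p :: complex^2) \<le> norm (p $ 1) + norm (p $ 2)"
  by (simp add: norm_vec_def L2_set_def sum_2 sqrt_sum_squares_le_sum)

lemma lipschitz_fieldD:
  assumes "lipschitz_field G"
  obtains B where "B > 0" "\<And>z p k. norm z \<le> R \<Longrightarrow> norm p \<le> R \<Longrightarrow> norm (G z p $ k) \<le> B"
    "\<And>z p q k. norm z \<le> R \<Longrightarrow> norm p \<le> R \<Longrightarrow> norm q \<le> R \<Longrightarrow> norm (G z p $ k - G z q $ k) \<le> B * norm (p - q)"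
proof -
  have "\<forall>k. \<exists>B. B \<ge> 0 \<and> (\<forall>z p. norm z \<le> R \<longrightarrow> norm p \<le> R \<longrightarrow> norm (G z p $ k) \<le> B) \<and>
    (\<forall>z p q. norm z \<le> R \<longrightarrow> norm p \<le> R \<longrightarrow> norm q \<le> R \<longrightarrow> norm (G z p $ k - G z q $ k) \<le> B * norm (p - q))"
    using assms unfolding lipschitz_field_def lipschitz_coefficient_def by meson
  then obtain b where b: "\<And>k. b k \<ge> 0" "\<And>k z p. norm z \<le> R \<Longrightarrow> norm p \<le> R \<Longrightarrow> norm (G z p $ k) \<le> b k"
    "\<And>k z p q. norm z \<le> R \<Longrightarrow> norm p \<le> R \<Longrightarrow> norm q \<le> R \<Longrightarrow> norm (G z p $ k - G z q $ k) \<le> b k * norm (p - q)"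
    by metis
  define B where "B = 1 + b 1 + b 2"
  have bB: "b k \<le> B" for k using b(1)[of 1] b(1)[of 2] exhaust_2[of k] by (auto simp: B_def)
  show ?thesis
  proof
    show "B > 0" using b(1)[of 1] b(1)[of 2] by (simp add: B_def)
    show "norm (G z p $ k) \<le> B" if "norm z \<le> R" "norm p \<le> R" for z p k
      using b(2)[OF that, of k] bB[of k] by linarith
    show "norm (G z p $ k - G z q $ k) \<le> B * norm (p - q)"
      if "norm z \<le> R" "norm p \<le> R" "norm q \<le> R" for z p q k
      using b(3)[OF that, of k] mult_right_mono[OF bB[of k], of "norm (p - q)"] by auto
  qed
qed

lemma lipschitz_fieldD2:
  assumes "lipschitz_field G" "open D" "\<And>k. (\<lambda>t. v t $ k) holomorphic_on D"
  shows "(\<lambda>t. G t (v t) $ k) holomorphic_on D"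
  by (rule lipschitz_coefficientD2[OF _ assms(2,3)]) (use assms(1) in \<open>simp add: lipschitz_field_def\<close>)

lemma norm_diff_le_of_derivative_ball:
  fixes f :: "complex \<Rightarrow> complex"
  assumes "\<And>t. t \<in> ball z \<delta> \<Longrightarrow> (f has_field_derivative f' t) (at t)"
    and "\<And>t. t \<in> ball z \<delta> \<Longrightarrow> norm (f' t) \<le> B" and "t \<in> ball z \<delta>" "0 \<le> B"
  shows "norm (f t - f z) \<le> B * \<delta>"
proof -
  have "\<delta> > 0" using assms(3) by (metis ball_empty empty_iff not_le)
  have "norm (f t - f z) \<le> B * norm (t - z)"
  proof (rule field_differentiable_bound[where S = "ball z \<delta>"])
    show "(f has_field_derivative f' x) (at x within ball z \<delta>)" if "x \<in> ball z \<delta>" for x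
      using assms(1)[OF that] by (rule has_field_derivative_at_within)
  qed (use assms \<open>\<delta> > 0\<close> in auto)
  also have "\<dots> \<le> B * \<delta>"
    using assms(3,4) by (intro mult_left_mono) (auto simp: dist_norm norm_minus_commute)
  finally show ?thesis .
qed

text \<open>Picard iteration in which integrals are replaced by primitives on a disc. What the
  continuation argument needs is the order of the quantifiers: one radius serves all initial times
  and points bounded by \<open>R\<close>.\<close>

lemma solution_exists:
  assumes G: "lipschitz_field G"
  shows "\<exists>\<delta>>0. \<forall>z0 p0. norm z0 \<le> R \<longrightarrow> norm p0 \<le> R \<longrightarrow>
           (\<exists>v. solution_on G (ball z0 \<delta>) v \<and> v z0 = p0)"
proof -
  obtain B where B: "B > 0" "\<And>z p k. norm z \<le> R+1 \<Longrightarrow> norm p \<le> R+1 \<Longrightarrow> norm (G z p $ k) \<le> B"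
    "\<And>z p q k. norm z \<le> R+1 \<Longrightarrow> norm p \<le> R+1 \<Longrightarrow> norm q \<le> R+1 \<Longrightarrow>
       norm (G z p $ k - G z q $ k) \<le> B * norm (p - q)"
    by (rule lipschitz_fieldD[OF G]) blast
  \<comment> \<open>\<open>B * \<delta> \<le> 1/4\<close> lets each of the two components move by at
    most \<open>1/4\<close>: this keeps the iterates within distance 1 of \<open>p0\<close> and,
    through the Lipschitz bound, halves the difference of consecutive iterates.
    \<open>\<delta> \<le> 1\<close> keeps the times below \<open>R + 1\<close>.\<close>
  define \<delta> where "\<delta> = min 1 (1 / (4 * B))"
  have \<delta>: "\<delta> > 0" "\<delta> \<le> 1" "B * \<delta> \<le> 1/4"
    using B(1) by (auto simp: \<delta>_def min_def field_simps)
  have "\<exists>v. solution_on G (ball z0 \<delta>) v \<and> v z0 = p0" if R: "norm z0 \<le> R" "norm p0 \<le> R" for z0 p0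
  proof -
    let ?D = "ball z0 \<delta>"
    define P where "P v \<longleftrightarrow> (\<forall>k. (\<lambda>t. v t $ k) holomorphic_on ?D) \<and> (\<forall>t\<in>?D. norm (v t - p0) \<le> 1) \<and> v z0 = p0"
      for v :: "complex \<Rightarrow> complex^2"
    \<comment> \<open>\<open>Q v v'\<close> makes \<open>v'\<close> a primitive of the field along
      \<open>v\<close>, that is, the next Picard iterate up to the initial value, which
      \<open>P\<close> fixes.\<close>
    define Q where "Q v v' \<longleftrightarrow> (\<forall>t\<in>?D. \<forall>k. ((\<lambda>t. v' t $ k) has_field_derivative G t (v t) $ k) (at t))"
      for v v' :: "complex \<Rightarrow> complex^2"
    have z0D: "z0 \<in> ?D" using \<delta> by simp
    have tR: "norm t \<le> R + 1" if "t \<in> ?D" for t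
    proof -
      have "norm (t - z0) < 1" using that \<delta> by (simp add: dist_norm norm_minus_commute)
      then show ?thesis using R norm_triangle_sub[of t z0] by linarith
    qed
    have vR: "norm (v t) \<le> R + 1" if "P v" "t \<in> ?D" for v t
    proof -
      have "norm (v t - p0) \<le> 1" using that by (simp add: P_def)
      then show ?thesis using R norm_triangle_sub[of "v t" p0] by linarith
    qed
    have step: "\<exists>v'. P v' \<and> Q v v'" if "P v" for v
    proof -
      have hol: "(\<lambda>t. G t (v t) $ k) holomorphic_on ?D" for k
        using that by (intro lipschitz_fieldD2[OF G]) (auto simp: P_def)
      have "\<exists>g. \<forall>t\<in>?D. (g has_field_derivative G t (v t) $ k) (at t)" for k
        using holomorphic_convex_primitive'[OF convex_ball open_ball hol[of k]]
        by (metis at_within_open open_ball)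
      then obtain g where g: "\<And>k t. t \<in> ?D \<Longrightarrow> (g k has_field_derivative G t (v t) $ k) (at t)"
        by metis
      define v' where "v' t = (\<chi> k. p0 $ k + (g k t - g k z0))" for t
      have d: "((\<lambda>t. v' t $ k) has_field_derivative G t (v t) $ k) (at t)" if "t \<in> ?D" for k t
        unfolding v'_def using g[OF that, of k] by (auto intro!: derivative_eq_intros)
      have "norm (v' t - p0) \<le> 1" if t: "t \<in> ?D" for t
      proof -
        have k: "norm (g k t - g k z0) \<le> 1/4" for k
        proof -
          have "norm (g k t - g k z0) \<le> B * \<delta>"
            using t B(1) by (intro norm_diff_le_of_derivative_ball[where f' = "\<lambda>t. G t (v t) $ k"] g B(2) tR vR \<open>P v\<close>) auto
          then show ?thesis using \<delta> by linarith
        qed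
        show ?thesis using norm_vec2_le[of "v' t - p0"] k[of 1] k[of 2] by (simp add: v'_def)
      qed
      then have "P v'"
        unfolding P_def using d by (auto simp: holomorphic_on_open simp del: mem_ball) (simp add: v'_def)
      moreover have "Q v v'" using d by (simp add: Q_def)
      ultimately show ?thesis by blast
    qed
    have "\<exists>f. \<forall>n. P (f n) \<and> Q (f n) (f (Suc n))"
    proof (rule dependent_nat_choice)
      show "\<exists>v. P v" by (rule exI[of _ "\<lambda>_. p0"]) (auto simp: P_def)
    qed (rule step)
    then obtain f where f: "\<And>n. P (f n)" "\<And>n. Q (f n) (f (Suc n))" by blast
    have diff: "norm (f (Suc n) t - f n t) \<le> 2 * (1/2)^n" if "t \<in> ?D" for n t
      using that
    proof (induction n arbitrary: t)
      case 0
      have "norm (f (Suc 0) t - p0) \<le> 1" "norm (f 0 t - p0) \<le> 1" using f(1) 0 by (auto simp: P_def)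
      then show ?case using norm_triangle_ineq4[of "f (Suc 0) t - p0" "f 0 t - p0"] by simp
    next
      case (Suc n)
      define e where "e = B * (2 * (1/2)^n)"
      have e: "e \<ge> 0" using B(1) by (simp add: e_def)
      have k: "norm (f (Suc (Suc n)) t $ k - f (Suc n) t $ k) \<le> 2 * (1/2)^n * (1/4)" for k
      proof -
        have "norm ((f (Suc (Suc n)) t $ k - f (Suc n) t $ k) - (f (Suc (Suc n)) z0 $ k - f (Suc n) z0 $ k)) \<le> e * \<delta>"
        proof (rule norm_diff_le_of_derivative_ball[where f' = "\<lambda>t. G t (f (Suc n) t) $ k - G t (f n t) $ k", OF _ _ Suc.prems e])
          fix s assume s: "s \<in> ?D"
          show "((\<lambda>t. f (Suc (Suc n)) t $ k - f (Suc n) t $ k) has_field_derivative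
              G s (f (Suc n) s) $ k - G s (f n s) $ k) (at s)"
            using f(2)[of n] f(2)[of "Suc n"] s by (intro DERIV_diff) (auto simp: Q_def)
          have "norm (G s (f (Suc n) s) $ k - G s (f n s) $ k) \<le> B * norm (f (Suc n) s - f n s)"
            by (intro B(3) tR vR f s)
          also have "\<dots> \<le> e"
            unfolding e_def using Suc.IH[OF s] B(1) by (intro mult_left_mono) auto
          finally show "norm (G s (f (Suc n) s) $ k - G s (f n s) $ k) \<le> e" .
        qed
        moreover have "e * \<delta> \<le> 2 * (1/2)^n * (1/4)"
          using mult_left_mono[OF \<delta>(3), of "2 * (1/2)^n"] by (simp add: e_def algebra_simps)
        moreover have "f (Suc (Suc n)) z0 = p0" "f (Suc n) z0 = p0" using f(1) by (auto simp: P_def)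
        ultimately show ?thesis by simp
      qed
      show ?case
        using norm_vec2_le[of "f (Suc (Suc n)) t - f (Suc n) t"] k[of 1] k[of 2] by simp
    qed
    have diff2: "norm (f (n + m) t - f n t) \<le> 4 * (1/2)^n - 4 * (1/2)^(n+m)" if "t \<in> ?D" for n m t
    proof (induction m)
      case (Suc m)
      have "norm (f (n + Suc m) t - f n t) \<le> norm (f (Suc (n + m)) t - f (n+m) t) + norm (f (n+m) t - f n t)"
        using norm_triangle_ineq[of "f (Suc (n + m)) t - f (n+m) t" "f (n+m) t - f n t"] by simp
      then show ?case using Suc diff[OF that, of "n+m"] by simp
    qed auto
    have Cau: "Cauchy (\<lambda>n. f n t)" if t: "t \<in> ?D" for t
    proof (rule CauchyI')
      fix e :: real assume "e > 0"
      then obtain N where N: "(1/2 :: real)^N < e/4" using real_arch_pow_inv[of "e/4" "1/2"] by auto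
      show "\<exists>M. \<forall>m\<ge>M. \<forall>n>m. dist (f m t) (f n t) < e"
      proof (intro exI allI impI)
        fix m n assume mn: "m \<ge> N" "m < n"
        have "norm (f (m + (n - m)) t - f m t) \<le> 4 * (1/2)^m - 4 * (1/2)^(m + (n-m))" by (rule diff2[OF t])
        also have "\<dots> \<le> 4 * (1/2)^m" by simp
        also have "\<dots> \<le> 4 * (1/2)^N" using mn by (simp add: power_decreasing)
        finally show "dist (f m t) (f n t) < e" using N mn by (simp add: dist_norm norm_minus_commute)
      qed
    qed
    define v where "v t = lim (\<lambda>n. f n t)" for t
    have lim: "(\<lambda>n. f n t) \<longlonglongrightarrow> v t" if "t \<in> ?D" for t
      using Cau[OF that] unfolding v_def by (simp add: Cauchy_convergent_iff convergent_LIMSEQ_iff)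
    have close: "norm (f n t - v t) \<le> 4 * (1/2)^n" if t: "t \<in> ?D" for t n
    proof (rule Lim_norm_ubound)
      show "(\<lambda>m. f n t - f (n+m) t) \<longlonglongrightarrow> f n t - v t"
        using LIMSEQ_ignore_initial_segment[OF lim[OF t], of n] by (auto intro!: tendsto_diff simp: add.commute)
      have "norm (f n t - f (n+m) t) \<le> 4 * (1/2)^n" for m
      proof -
        have "norm (f n t - f (n+m) t) \<le> 4 * (1/2)^n - 4 * (1/2)^(n+m)"
          using diff2[OF t, of n m] by (simp add: norm_minus_commute)
        also have "\<dots> \<le> 4 * (1/2)^n" by simp
        finally show ?thesis .
      qed
      then show "\<forall>\<^sub>F m in sequentially. norm (f n t - f (n+m) t) \<le> 4 * (1/2)^n" by simp
    qed simp
    have vR': "norm (v t) \<le> R + 1" if t: "t \<in> ?D" for t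
      by (rule Lim_norm_ubound[OF _ lim[OF t]]) (use vR[OF f(1) t] in auto)
    have vd: "((\<lambda>t. v t $ k) has_field_derivative G t (v t) $ k) (at t)" if t: "t \<in> ?D" for t k
    proof -
      \<comment> \<open>By \<open>close\<close> the derivatives of the iterates converge uniformly
        on the disc, so the limit is differentiable and solves the equation.\<close>
      have "\<exists>g. \<forall>x\<in>?D. ((\<lambda>n. f (Suc n) x $ k) \<longlonglongrightarrow> g x) \<and>
                  (g has_field_derivative G x (v x) $ k) (at x within ?D)"
      proof (rule has_complex_derivative_sequence)
        show "((\<lambda>x. f (Suc n) x $ k) has_field_derivative G x (f n x) $ k) (at x within ?D)" if "x \<in> ?D" for n x
          using f(2)[of n] that unfolding Q_def by (blast intro: has_field_derivative_at_within)
        show "\<exists>N. \<forall>n x. N \<le> n \<longrightarrow> x \<in> ?D \<longrightarrow> norm (G x (f n x) $ k - G x (v x) $ k) \<le> e" if "e > 0" for e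
        proof -
          obtain N where N: "(1/2 :: real)^N < e/(4*B)"
            using real_arch_pow_inv[of "e/(4*B)" "1/2"] \<open>e > 0\<close> B(1) by auto
          have "norm (G x (f n x) $ k - G x (v x) $ k) \<le> e" if "n \<ge> N" "x \<in> ?D" for n x
          proof -
            have "norm (G x (f n x) $ k - G x (v x) $ k) \<le> B * norm (f n x - v x)"
              using that by (intro B(3) tR vR vR' f)
            also have "\<dots> \<le> B * (4 * (1/2)^n)"
              using close[OF that(2), of n] B(1) by (intro mult_left_mono) auto
            also have "\<dots> \<le> B * (4 * (1/2)^N)"
              using that B(1) by (intro mult_left_mono) (auto simp: power_decreasing)
            also have "\<dots> \<le> e" using N B(1) by (simp add: field_simps)
            finally show ?thesis .
          qed
          then show ?thesis by blast
        qed
        show "\<exists>x l. x \<in> ?D \<and> (\<lambda>n. f (Suc n) x $ k) \<longlonglongrightarrow> l"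
          using z0D f(1) by (intro exI[of _ z0] exI[of _ "p0 $ k"]) (auto simp: P_def)
      qed auto
      then obtain g where g: "\<And>x. x \<in> ?D \<Longrightarrow> (\<lambda>n. f (Suc n) x $ k) \<longlonglongrightarrow> g x"
        "\<And>x. x \<in> ?D \<Longrightarrow> (g has_field_derivative G x (v x) $ k) (at x within ?D)" by blast
      have "g x = v x $ k" if "x \<in> ?D" for x
        using g(1)[OF that] LIMSEQ_Suc[OF tendsto_vec_nth[OF lim[OF that], of k]] LIMSEQ_unique by blast
      then have "((\<lambda>x. v x $ k) has_field_derivative G t (v t) $ k) (at t within ?D)"
        by (intro has_field_derivative_transform_within[OF g(2)[OF t] zero_less_one t])
      then show ?thesis unfolding at_within_open[OF t open_ball] .
    qed
    have "v z0 = p0"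
    proof -
      have "(\<lambda>n. f n z0) \<longlonglongrightarrow> p0" using f(1) by (simp add: P_def)
      then show ?thesis using lim[OF z0D] LIMSEQ_unique by blast
    qed
    with vd show ?thesis unfolding solution_on_def by blast
  qed
  then show ?thesis using \<delta> by blast
qed

lemma solution_on_subset: "solution_on G D v \<Longrightarrow> D' \<subseteq> D \<Longrightarrow> solution_on G D' v"
  unfolding solution_on_def by blast

lemma solution_on_imp_isCont:
  assumes "solution_on G D v" "z \<in> D"
  shows "isCont v z"
proof -
  have "((\<lambda>t. v t $ k) has_field_derivative G z (v z) $ k) (at z)" for k
    using assms unfolding solution_on_def by blast
  then have "isCont (\<lambda>t. v t $ k) z" for k
    by (rule DERIV_isCont)
  then show ?thesis unfolding isCont_def by (intro vec_tendstoI)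
qed

lemma solution_unique_local:
  assumes G: "lipschitz_field G" and "open D" "z0 \<in> D"
    and v: "solution_on G D v" and v': "solution_on G D v'" and eq: "v z0 = v' z0"
  shows "\<exists>\<epsilon>>0. \<forall>t\<in>ball z0 \<epsilon>. v t = v' t"
proof -
  obtain r where r: "r > 0" "cball z0 r \<subseteq> D" using assms open_contains_cball by blast
  have cont: "continuous_on (cball z0 r) v" "continuous_on (cball z0 r) v'"
    using r solution_on_imp_isCont[OF v] solution_on_imp_isCont[OF v']
    by (auto intro!: continuous_at_imp_continuous_on)
  obtain M where M: "\<And>t. t \<in> cball z0 r \<Longrightarrow> norm (v t) \<le> M" "\<And>t. t \<in> cball z0 r \<Longrightarrow> norm (v' t) \<le> M"
  proof -
    have "bounded (v ` cball z0 r \<union> v' ` cball z0 r)"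
      using cont by (auto intro!: compact_imp_bounded compact_continuous_image)
    then obtain M where "\<forall>x\<in>v ` cball z0 r \<union> v' ` cball z0 r. norm x \<le> M"
      unfolding bounded_iff by blast
    with that[of M] show thesis by blast
  qed
  define R where "R = max M (norm z0 + r)"
  have R: "norm t \<le> R" if "t \<in> cball z0 r" for t
  proof -
    have "norm (t - z0) \<le> r" using that by (simp add: dist_norm norm_minus_commute)
    then show ?thesis using norm_triangle_sub[of t z0] by (simp add: R_def)
  qed
  have RM: "M \<le> R" by (simp add: R_def)
  obtain B where B: "B > 0" "\<And>z p q k. norm z \<le> R \<Longrightarrow> norm p \<le> R \<Longrightarrow> norm q \<le> R \<Longrightarrow>
       norm (G z p $ k - G z q $ k) \<le> B * norm (p - q)"
    by (rule lipschitz_fieldD[OF G]) blast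
  define \<delta> where "\<delta> = min r (1 / (4 * B))"
  have \<delta>: "\<delta> > 0" "\<delta> \<le> r" "B * \<delta> \<le> 1/4"
    using B(1) r(1) by (auto simp: \<delta>_def min_def field_simps)
  \<comment> \<open>On this disc the Picard operator is a contraction, so a bound on the difference of the solutions can be halved.\<close>
  have bound: "norm (v t - v' t) \<le> 2 * R * (1/2)^n" if "t \<in> ball z0 \<delta>" for n t
    using that
  proof (induction n arbitrary: t)
    case 0
    then have "t \<in> cball z0 r" using \<delta> by auto
    then show ?case using M[of t] RM norm_triangle_ineq4[of "v t" "v' t"] by simp
  next
    case (Suc n)
    define e where "e = 2 * R * (1/2)^n"
    have "norm z0 \<le> R" using R r by simp
    then have e: "e \<ge> 0" using norm_ge_zero[of z0] by (simp add: e_def del: norm_ge_zero)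
    have k: "norm (v t $ k - v' t $ k) \<le> e / 4" for k
    proof -
      have "norm ((v t $ k - v' t $ k) - (v z0 $ k - v' z0 $ k)) \<le> (B * e) * \<delta>"
      proof (rule norm_diff_le_of_derivative_ball[where f = "\<lambda>t. v t $ k - v' t $ k" and f' = "\<lambda>t. G t (v t) $ k - G t (v' t) $ k"])
        fix s assume s: "s \<in> ball z0 \<delta>"
        then have s': "s \<in> cball z0 r" "s \<in> D" using \<delta> r by auto
        show "((\<lambda>t. v t $ k - v' t $ k) has_field_derivative G s (v s) $ k - G s (v' s) $ k) (at s)"
          using v v' s'(2) unfolding solution_on_def by (intro DERIV_diff) blast+
        have "norm (G s (v s) $ k - G s (v' s) $ k) \<le> B * norm (v s - v' s)"
          using M[OF s'(1)] R[OF s'(1)] RM by (intro B(2)) linarith+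
        also have "\<dots> \<le> B * e" using Suc.IH[OF s] B(1) by (simp add: e_def)
        finally show "norm (G s (v s) $ k - G s (v' s) $ k) \<le> B * e" .
      next
        show "t \<in> ball z0 \<delta>" by fact
        show "0 \<le> B * e" using B(1) e by simp
      qed
      then show ?thesis using eq mult_right_mono[OF \<delta>(3) e] by (simp add: algebra_simps)
    qed
    show ?case using norm_vec2_le[of "v t - v' t"] k[of 1] k[of 2] by (simp add: e_def)
  qed
  have "norm (v t - v' t) \<le> 0" if "t \<in> ball z0 \<delta>" for t
  proof -
    have "(\<lambda>n. 2 * R * (1/2)^n) \<longlonglongrightarrow> 0"
      by (rule tendsto_mult_right_zero[OF LIMSEQ_power_zero]) simp
    moreover have "\<exists>N. \<forall>n\<ge>N. norm (v t - v' t) \<le> 2 * R * (1/2)^n" using bound[OF that] by blast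
    ultimately show ?thesis by (rule LIMSEQ_le_const)
  qed
  then show ?thesis using \<delta>(1) by (intro exI[of _ \<delta>]) auto
qed

section \<open>Polynomial Hamiltonians regular at infinity\<close>

text \<open>The outer variable is \<open>s\<close>, the inner one \<open>t\<close>. For a
  Hamiltonian these are \<open>x\<close> and the slope \<open>v = y / x\<close>, so
  \<open>coeff P k\<close> is the polynomial in \<open>v\<close> that multiplies
  \<open>x ^ k\<close>; for functions on a chart they are \<open>u\<close> and
  \<open>w\<close>.\<close>

definition poly2 :: "complex poly poly \<Rightarrow> complex \<Rightarrow> complex \<Rightarrow> complex" where
  "poly2 P s t = poly (poly P [:s:]) t"

lemma poly2_simps [simp]:
  "poly2 (P + Q) s t = poly2 P s t + poly2 Q s t"
  "poly2 (P - Q) s t = poly2 P s t - poly2 Q s t"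
  "poly2 (- P) s t = - poly2 P s t"
  "poly2 (P * Q) s t = poly2 P s t * poly2 Q s t"
  "poly2 (P ^ n) s t = poly2 P s t ^ n"
  "poly2 (pCons q P) s t = poly q t + s * poly2 P s t"
  "poly2 0 s t = 0" "poly2 1 s t = 1"
  by (simp_all add: poly2_def poly_power)

lemma poly2_smult [simp]: "poly2 (smult q P) s t = poly q t * poly2 P s t"
  by (simp add: poly2_def)

lemma poly2_sum: "poly2 (\<Sum>i\<in>I. f i) s t = (\<Sum>i\<in>I. poly2 (f i) s t)"
  by (induction I rule: infinite_finite_induct) auto

lemma poly2_monom: "poly2 (monom q k) s t = s ^ k * poly q t"
  by (simp add: poly2_def poly_monom)

lemma poly2_altdef:
  assumes "degree P \<le> n"
  shows "poly2 P s t = (\<Sum>k\<le>n. s ^ k * poly (coeff P k) t)"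
proof -
  have "poly2 P s t = (\<Sum>k\<le>degree P. s ^ k * poly (coeff P k) t)"
    by (simp add: poly2_def poly_altdef[of P] poly_sum poly_power mult.commute)
  also have "\<dots> = (\<Sum>k\<le>n. s ^ k * poly (coeff P k) t)"
    using assms by (intro sum.mono_neutral_left) (auto simp: coeff_eq_0)
  finally show ?thesis .
qed

section \<open>Vanishing conditions on the leading coefficient at the points at infinity\<close>

lemma poly_eqI_cofinite:
  fixes p q :: "complex poly"
  assumes "\<And>v. v \<noteq> c \<Longrightarrow> poly p v = poly q v"
  shows "p = q"
proof (rule ccontr)
  assume "p \<noteq> q"
  then have "finite {v. poly (p - q) v = 0}" by (intro poly_roots_finite) simp
  moreover have "-{c} \<subseteq> {v. poly (p - q) v = 0}" using assms by auto
  ultimately have "finite (-{c})" by (rule finite_subset[rotated])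
  then show False by (simp add: infinite_UNIV_char_0 finite_compl)
qed

text \<open>\<open>pcompose q [:e, 1:]\<close> is the Taylor expansion of \<open>q\<close> about
  \<open>e\<close>. Its coefficients are polynomials in \<open>e\<close>, hence depend continuously
  on a moving base point.\<close>

lemma isCont_coeff_pcompose_shift:
  fixes e :: "complex \<Rightarrow> complex"
  assumes "isCont e x"
  shows "isCont (\<lambda>w. coeff (pcompose q [:e w, 1:]) r) x"
proof (induction q arbitrary: r)
  case (pCons a q)
  have "coeff (pcompose (pCons a q) [:e w, 1:]) r =
     coeff [:a:] r + (e w * coeff (pcompose q [:e w, 1:]) r + (if r = 0 then 0 else coeff (pcompose q [:e w, 1:]) (r - 1)))" for w
    by (cases r) (simp_all add: pcompose_pCons)
  then show ?case using assms pCons.IH by (cases "r = 0") (simp_all add: continuous_intros)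
qed auto

lemma pcompose_power: "pcompose (p ^ n) (q :: 'a :: comm_semiring_1 poly) = pcompose p q ^ n"
  by (induction n) (simp_all add: pcompose_mult pcompose_1)

text \<open>Vanishing Taylor coefficients give divisibility by a power of the variable; undoing the
  shift turns this into a power of the linear factor.\<close>

lemma linear_power_dvd_of_shifted_coeffs:
  fixes q :: "complex poly"
  assumes "\<And>r. r < m \<Longrightarrow> coeff (pcompose q [:a, 1:]) r = 0"
  shows "[:-a, 1:] ^ m dvd q"
proof -
  have "monom 1 m dvd pcompose q [:a, 1:]"
    using assms by (simp add: monom_1_dvd_iff')
  then obtain s where s: "pcompose q [:a, 1:] = monom 1 m * s" by (elim dvdE)
  have "q = pcompose (pcompose q [:a, 1:]) [:-a, 1:]"
    by (simp add: pcompose_assoc[symmetric] pcompose_pCons)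
  also have "\<dots> = [:-a, 1:] ^ m * pcompose s [:-a, 1:]"
    by (simp add: s pcompose_mult monom_altdef pcompose_power pcompose_pCons)
  finally show ?thesis by (metis dvd_triv_left)
qed

lemma leading_coeff_contact:
  assumes P: "degree P \<le> n" and e: "isCont e 0"
    and reg: "\<And>w u. w \<noteq> 0 \<Longrightarrow> e w + u * w^3 \<noteq> 0 \<Longrightarrow> poly2 P (1/w) (e w + u * w^3) = poly2 R u w"
    and r: "3 * r < n"
  shows "coeff (pcompose (coeff P n) [:e 0, 1:]) r = 0"
proof -
  \<comment> \<open>\<open>L w\<close> and \<open>S w\<close> are both
    \<open>w^n * P(1/w, e w + v)\<close> as polynomials in \<open>v\<close>, computed from
    \<open>P\<close> and, with \<open>u = v / w^3\<close>, from \<open>R\<close>.\<close>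
  define L where "L w = (\<Sum>k\<le>n. smult (w^(n-k)) (pcompose (coeff P k) [:e w, 1:]))" for w
  define S where "S w = (\<Sum>j\<le>degree R. monom (w^n / (w^3)^j * poly (coeff R j) w) j)" for w
  have LS: "L w = S w" if w: "w \<noteq> 0" for w
  proof (rule poly_eqI_cofinite[where c = "- e w"])
    fix v assume v: "v \<noteq> - e w"
    have "poly (L w) v = (\<Sum>k\<le>n. w^(n-k) * poly (coeff P k) (e w + v))"
      by (simp add: L_def poly_sum poly_pcompose add.commute)
    also have "\<dots> = (\<Sum>k\<le>n. w^n * ((1/w)^k * poly (coeff P k) (e w + v)))"
      using w by (intro sum.cong) (auto simp: power_diff field_simps)
    also have "\<dots> = w^n * poly2 P (1/w) (e w + v)"
      by (simp add: poly2_altdef[OF P] sum_distrib_left)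
    also have "poly2 P (1/w) (e w + v) = poly2 R (v / w^3) w"
      using reg[OF w, of "v / w^3"] v w by (simp add: eq_neg_iff_add_eq_0 add.commute)
    also have "w^n * \<dots> = poly (S w) v"
      by (simp add: poly2_altdef[OF order_refl] S_def poly_sum poly_monom sum_distrib_left power_divide
          mult_ac)
    finally show "poly (L w) v = poly (S w) v" .
  qed
  have "(\<lambda>w. coeff (L w) r) \<midarrow>0\<rightarrow> (\<Sum>k\<le>n. 0^(n-k) * coeff (pcompose (coeff P k) [:e 0, 1:]) r)"
    unfolding L_def coeff_sum coeff_smult
    by (intro tendsto_intros isContD[OF isCont_coeff_pcompose_shift[OF e]])
  also have "(\<Sum>k\<le>n. 0^(n-k) * coeff (pcompose (coeff P k) [:e 0, 1:]) r) =
      (\<Sum>k\<in>{n}. 0^(n-k) * coeff (pcompose (coeff P k) [:e 0, 1:]) r)"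
    by (intro sum.mono_neutral_right) auto
  finally have lim1: "(\<lambda>w. coeff (L w) r) \<midarrow>0\<rightarrow> coeff (pcompose (coeff P n) [:e 0, 1:]) r" by simp
  define g where "g w = (if r \<le> degree R then w^(n - 3*r) * poly (coeff R r) w else 0)" for w
  have "g \<midarrow>0\<rightarrow> g 0"
    unfolding g_def by (auto intro!: tendsto_intros)
  moreover have "g 0 = 0" using r by (simp add: g_def)
  ultimately have glim: "g \<midarrow>0\<rightarrow> 0" by simp
  have gL: "\<forall>\<^sub>F w in at 0. g w = coeff (L w) r"
    unfolding eventually_at_filter
  proof (rule always_eventually, intro allI impI)
    fix w :: complex assume w: "w \<noteq> 0"
    have "coeff (S w) r = (\<Sum>j\<le>degree R. if j = r then w^n / (w^3)^j * poly (coeff R j) w else 0)"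
      unfolding S_def coeff_sum by (intro sum.cong) auto
    also have "\<dots> = g w" using w r by (auto simp: g_def power_diff power_mult)
    finally show "g w = coeff (L w) r" using LS[OF w] by simp
  qed
  have "(\<lambda>w. coeff (L w) r) \<midarrow>0\<rightarrow> 0"
    by (rule Lim_transform_eventually[OF glim gL])
  with lim1 show ?thesis using LIM_unique by blast
qed

text \<open>The same condition at \<open>v = \<infinity>\<close>. In the coordinates
  \<open>y\<close> and \<open>\<sigma> = x / y\<close> one has
  \<open>x ^ k * v ^ i = y ^ k * \<sigma> ^ (k - i)\<close>, so \<open>P\<close> becomes a
  polynomial \<open>P'\<close> with reversed coefficients, and (c) is a contact at
  \<open>\<sigma> = 0\<close>.\<close>

lemma leading_coeff_contact_infinity:
  assumes P: "degree P \<le> n" and hb: "\<And>k. degree (coeff P k) \<le> k"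
    and reg: "\<And>w u. w \<noteq> 0 \<Longrightarrow> u*w^2 + b*w \<noteq> 0 \<Longrightarrow>
       poly2 P (u*w^2 + b*w) (1 / (u*w^3 + b*w^2)) = poly2 R u w"
    and r: "3 * r < n"
  shows "coeff (coeff P n) (n - r) = 0"
proof -
  \<comment> \<open>The reversal is taken with respect to the formal degree \<open>k\<close>, not
    the actual degree of the coefficient; \<open>hb\<close> makes this possible.\<close>
  define c where "c k = (\<Sum>i\<le>k. monom (coeff (coeff P k) (k - i)) i)" for k
  define P' where "P' = (\<Sum>k\<le>n. monom (c k) k)"
  have coeff_P': "coeff P' k = c k" if "k \<le> n" for k
    using that by (simp add: P'_def coeff_sum)
  have deg: "degree P' \<le> n"
    unfolding P'_def by (intro degree_sum_le) (auto intro: order_trans[OF degree_monom_le])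
  have c: "poly (c k) \<sigma> = \<sigma>^k * poly (coeff P k) (1/\<sigma>)" if "\<sigma> \<noteq> 0" for k \<sigma>
  proof -
    have "poly (coeff P k) (1/\<sigma>) = (\<Sum>i\<le>k. coeff (coeff P k) i * (1/\<sigma>)^i)"
      unfolding poly_altdef using hb[of k]
      by (intro sum.mono_neutral_left) (auto simp: coeff_eq_0)
    then have "\<sigma>^k * poly (coeff P k) (1/\<sigma>) = (\<Sum>i\<le>k. coeff (coeff P k) i * \<sigma>^(k-i))"
      using that by (auto simp: sum_distrib_left power_diff field_simps intro!: sum.cong)
    also have "\<dots> = (\<Sum>i\<le>k. coeff (coeff P k) (k-i) * \<sigma>^i)"
      by (rule sum.reindex_bij_witness[of _ "\<lambda>i. k - i" "\<lambda>i. k - i"]) auto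
    finally show ?thesis by (simp add: c_def poly_sum poly_monom)
  qed
  have "coeff (pcompose (coeff P' n) [:b * 0^2, 1:]) r = 0"
  proof (rule leading_coeff_contact[OF deg _ _ r, where e = "\<lambda>w. b * w^2" and R = R])
    fix w u :: complex assume w: "w \<noteq> 0" and \<sigma>: "b * w^2 + u * w^3 \<noteq> 0"
    define s where "s = b * w^2 + u * w^3"
    have s0: "s \<noteq> 0" using \<sigma> by (simp add: s_def)
    have eq: "s = (u*w^2 + b*w) * w" by (simp add: s_def algebra_simps power2_eq_square power3_eq_cube)
    have "poly2 P' (1/w) s = (\<Sum>k\<le>n. (1/w)^k * (s^k * poly (coeff P k) (1/s)))"
      by (simp add: poly2_altdef[OF deg] coeff_P' c[OF s0])
    also have "\<dots> = (\<Sum>k\<le>n. (s / w)^k * poly (coeff P k) (1/s))"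
      by (intro sum.cong) (auto simp: power_divide)
    also have "\<dots> = poly2 P (s / w) (1/s)" by (simp add: poly2_altdef[OF P])
    also have "s / w = u*w^2 + b*w" using w by (simp add: eq)
    also have "poly2 P (u*w^2 + b*w) (1/s) = poly2 R u w"
    proof -
      have "u*w^2 + b*w \<noteq> 0" using s0 unfolding eq by simp
      moreover have "s = u*w^3 + b*w^2" by (simp add: s_def)
      ultimately show ?thesis using reg[OF w, of u] by simp
    qed
    finally show "poly2 P' (1/w) (b * w^2 + u * w^3) = poly2 R u w" by (simp add: s_def)
  qed auto
  then have "coeff (coeff P' n) r = 0" by (simp add: pcompose_idR)
  moreover have "coeff (c n) r = coeff (coeff P n) (n - r)"
    using r by (simp add: c_def coeff_sum)
  ultimately show ?thesis by (simp add: coeff_P')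
qed

section \<open>The degree count at the three points at infinity\<close>

lemma coprime_two_roots: "coprime ([:0, 1 :: complex:] ^ p) ([:-1, 1:] ^ q)"
proof -
  have "coprime [:0, 1 :: complex:] [:-1, 1:]"
  proof (rule coprimeI)
    fix d :: "complex poly" assume "d dvd [:0, 1:]" "d dvd [:-1, 1:]"
    then have "d dvd [:0, 1:] - [:-1, 1:]" by (rule dvd_diff)
    then show "is_unit d" by (simp add: one_pCons)
  qed
  then show ?thesis by simp
qed

lemma poly_eq_0_of_two_roots:
  fixes A :: "complex poly"
  assumes "[:0, 1:] ^ p dvd A" "[:-1, 1:] ^ q dvd A" "degree A < p + q"
  shows "A = 0"
proof (rule ccontr)
  assume "A \<noteq> 0"
  have "[:0, 1:] ^ p * [:-1, 1:] ^ q dvd A"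
    using assms(1,2) coprime_two_roots by (intro divides_mult) auto
  from dvd_imp_degree_le[OF this \<open>A \<noteq> 0\<close>] show False
    using assms(3) by (simp add: degree_mult_eq degree_power_eq)
qed

text \<open>\<open>n\<close> minus the degree is the order of vanishing at
  \<open>v = \<infinity>\<close> of the leading coefficient, viewed as a form of degree
  \<open>n\<close>. The assumption \<open>3 * m < n + 3\<close> says that \<open>3 * r < n\<close>
  for every \<open>r < m\<close>.\<close>

lemma order_three_contact:
  assumes P: "degree P \<le> n" and hb: "\<And>k. degree (coeff P k) \<le> k" and m: "3 * m < n + 3"
    and inf: "\<And>w u. w \<noteq> 0 \<Longrightarrow> u*w^2 + b*w \<noteq> 0 \<Longrightarrow>
       poly2 P (u*w^2 + b*w) (1 / (u*w^3 + b*w^2)) = poly2 R u w"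
    and A: "coeff P n \<noteq> 0"
  shows "degree (coeff P n) + m \<le> n"
proof -
  let ?d = "degree (coeff P n)"
  have "?d \<le> n" by (rule hb)
  have "\<not> 3 * (n - ?d) < n"
    using leading_coeff_contact_infinity[OF P hb inf, where r = "n - ?d"] \<open>?d \<le> n\<close> A by auto
  then have "m \<le> n - ?d" using m by linarith
  then show ?thesis using \<open>?d \<le> n\<close> by linarith
qed

lemma linear_power_dvd_leading_coeff:
  assumes P: "degree P \<le> n" and m: "3 * m < n + 3" and e: "isCont e 0" 
    and reg: "\<And>w u. w \<noteq> 0 \<Longrightarrow> poly2 P (1/w) (e w + u * w^3) = poly2 R u w"
  shows "[:- e 0, 1:] ^ m dvd coeff P n"
  using leading_coeff_contact[OF P e reg] m by (intro linear_power_dvd_of_shifted_coeffs) auto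

text \<open>The difference of powers is \<open>H - G\<close> times a sum of \<open>m\<close>
  products, all with the same coefficient \<open>lead_coeff H ^ (m - 1)\<close> in degree
  \<open>d * (m - 1)\<close>; these add up, and the factor \<open>[:0, c:]\<close> raises the degree
  by one.\<close>

lemma coeff_power_diff_top:
  fixes H :: "'a :: {idom} poly"
  assumes H: "degree H = d" and G: "degree G = d" "lead_coeff G = lead_coeff H"
    and HG: "H - G = [:0, c:]" and m: "m > 0"
  shows "degree (H ^ m - G ^ m) \<le> d * (m - 1) + 1"
    and "coeff (H ^ m - G ^ m) (d * (m - 1) + 1) = of_nat m * c * lead_coeff H ^ (m - 1)"
proof -
  define S where "S = (\<Sum>i<m. G^(m - Suc i) * H^i)"
  have eq: "H ^ m - G ^ m = pCons 0 (smult c S)"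
    unfolding S_def power_diff_sumr2 HG by simp
  have term_deg: "degree (G^(m - Suc i) * H^i) \<le> d * (m - 1)" if "i < m" for i
  proof -
    have "degree (G^(m - Suc i) * H^i) \<le> degree (G^(m - Suc i)) + degree (H^i)" by (rule degree_mult_le)
    also have "\<dots> \<le> d * (m - Suc i) + d * i"
      using degree_power_le[of G "m - Suc i"] degree_power_le[of H i] H G by (simp add: mult.commute)
    also have "\<dots> = d * (m - 1)" using that by (simp flip: distrib_left)
    finally show ?thesis .
  qed
  have term_coeff: "coeff (G^(m - Suc i) * H^i) (d * (m - 1)) = lead_coeff H ^ (m - 1)" if "i < m" for i
  proof (cases "H = 0")
    case False
    then have "G \<noteq> 0" using G by auto
    have "lead_coeff (G^(m - Suc i) * H^i) = lead_coeff H ^ (m - Suc i) * lead_coeff H ^ i"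
      using G by (simp add: lead_coeff_mult lead_coeff_power)
    also have "\<dots> = lead_coeff H ^ (m - 1)" using that by (simp flip: power_add)
    also have "degree (G^(m - Suc i) * H^i) = (m - Suc i) * d + i * d"
      using False \<open>G \<noteq> 0\<close> H G by (simp add: degree_mult_eq degree_power_eq)
    also have "\<dots> = d * (m - 1)" using that by (simp flip: distrib_right)
    finally show ?thesis .
  next
    case True
    then have "lead_coeff G = 0" using G by simp
    then have "G = 0" by (simp only: leading_coeff_0_iff)
    then show ?thesis using True that H by (cases "m - 1") (auto simp: power_0_left)
  qed
  have S: "degree S \<le> d * (m - 1)"
    unfolding S_def using term_deg by (intro degree_sum_le) auto
  show "degree (H ^ m - G ^ m) \<le> d * (m - 1) + 1"
    using S order_trans[OF degree_smult_le S, of c] unfolding eq by (simp add: degree_pCons_eq_if)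
  show "coeff (H ^ m - G ^ m) (d * (m - 1) + 1) = of_nat m * c * lead_coeff H ^ (m - 1)"
    unfolding eq using term_coeff by (simp add: S_def coeff_sum)
qed

lemma degree_le_decr:
  assumes "degree P \<le> Suc n" "coeff P (Suc n) = 0"
  shows "degree P \<le> n"
  using assms using eq_zero_or_degree_less[OF assms] by auto

lemma degree_coeff_mult_le:
  assumes "\<And>k. degree (coeff P k) \<le> k" "\<And>k. degree (coeff Q k) \<le> k"
  shows "degree (coeff (P * Q) k) \<le> k"
  unfolding coeff_mult
proof (rule degree_sum_le)
  fix i assume "i \<in> {..k}"
  then show "degree (coeff P i * coeff Q (k - i)) \<le> k"
    using degree_mult_le[of "coeff P i" "coeff Q (k - i)"] assms(1)[of i] assms(2)[of "k - i"] by simp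
qed simp

lemma degree_coeff_power_le:
  assumes "\<And>k. degree (coeff P k) \<le> k"
  shows "degree (coeff (P ^ m) k) \<le> k"
proof (induction m arbitrary: k)
  case (Suc m)
  show ?case unfolding power_Suc by (rule degree_coeff_mult_le[OF assms Suc.IH])
qed (auto simp: coeff_1)

text \<open>\<open>H\<close> in the variables \<open>x\<close> and \<open>v = y / x\<close>, with \<open>a = 2 * \<kappa>\<close> and \<open>b = 2 * \<theta>\<close>.\<close>

definition hamiltonian_poly :: "complex \<Rightarrow> complex \<Rightarrow> complex \<Rightarrow> complex poly poly" where
  "hamiltonian_poly a b z = [:0, [:a, -b:], [:0, 2*z:], [:0, -1, 1:]:]"

lemma poly2_hamiltonian_poly:
  "poly2 (hamiltonian_poly a b z) s t = s * (a - b * t) + s^2 * (2 * z * t) + s^3 * (t * (t - 1))"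
  by (simp add: hamiltonian_poly_def algebra_simps power2_eq_square power3_eq_cube)

lemma degree_coeff_hamiltonian_poly: "degree (coeff (hamiltonian_poly a b z) k) \<le> k"
proof -
  consider "k = 0" | "k = Suc 0" | "k = Suc (Suc 0)" | "k = Suc (Suc (Suc 0))" | l where "k = Suc (Suc (Suc (Suc l)))"
    by (metis not0_implies_Suc)
  then show ?thesis
    by cases (simp_all add: hamiltonian_poly_def)
qed

text \<open>Substituting (b) leaves the single pole \<open>(a + c - b) / w\<close>, which by the
  assumption is \<open>2 / w\<close>, the pole of \<open>2 * x\<close>. The substitutions (a) and
  (c) leave none.\<close>

lemma hamiltonian_poly_regular:
  assumes "a + c = b + 2"
  obtains S3 S6 S9 where
    "\<And>w u. w \<noteq> 0 \<Longrightarrow> poly2 (hamiltonian_poly a b z) (1/w) (a*w^2 + u*w^3) = poly2 S3 u w"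
    "\<And>w u. w \<noteq> 0 \<Longrightarrow> poly2 (hamiltonian_poly a b z - [:0, [:2:]:]) (1/w) ((1 - 2*z*w + c*w^2) + u*w^3) = poly2 S6 u w"
    "\<And>w u. w \<noteq> 0 \<Longrightarrow> u*w^2 + b*w \<noteq> 0 \<Longrightarrow>
       poly2 (hamiltonian_poly a b z) (u*w^2 + b*w) (1 / (u*w^3 + b*w^2)) = poly2 S9 u w"
proof -
  let ?H = "hamiltonian_poly a b z"
  define U W K where "U = [:0, 1 :: complex poly:]" and "W = [:[:0, 1 :: complex:]:]"
    and "K k = [:[:k :: complex:]:]" for k
  have UWK [simp]: "poly2 U u w = u" "poly2 W u w = w" "poly2 (K k) u w = k" for u w k
    by (simp_all add: U_def W_def K_def)
  define S3 where "S3 = - U + (K a + U * W)^2 * W - K b * W * (K a + U * W) + K (2*z) * (K a + U * W)"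
  have H3: "poly2 ?H (1/w) (a*w^2 + u*w^3) = poly2 S3 u w" if "w \<noteq> 0" for u w
  proof -
    \<comment> \<open>The inverse becomes a new variable with \<open>i * w = 1\<close>, so that the
      claim is a polynomial identity modulo this relation.\<close>
    define i where "i = 1 / w"
    have "i * w = 1" using that by (simp add: i_def)
    then show ?thesis unfolding poly2_hamiltonian_poly S3_def i_def[symmetric] poly2_simps UWK by algebra
  qed
  define S9 where "S9 = U + (U * W + K b) * (K (2*z) - (U * W + K b) * W) + K a * (U * W + K b) * W"
  have H9: "poly2 ?H (u*w^2 + b*w) (1 / (u*w^3 + b*w^2)) = poly2 S9 u w"
    if "w \<noteq> 0" "u*w^2 + b*w \<noteq> 0" for u w
  proof -
    define i x j where "i = 1 / w" and "x = u*w^2 + b*w" and "j = 1 / (u*w^3 + b*w^2)"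
    have "u*w^3 + b*w^2 = x * w" by (simp add: x_def algebra_simps power2_eq_square power3_eq_cube)
    then have "i * w = 1" "x * j = i" using that by (simp_all add: i_def j_def x_def[symmetric])
    then show ?thesis
      unfolding poly2_hamiltonian_poly S9_def j_def[symmetric] x_def[symmetric] poly2_simps UWK using x_def by algebra
  qed
  define S6 where "S6 = U + (U * W + K c)^2 * W - K (2*z) * (U * W + K c) + K (2*b*z) - K b * W * (U * W + K c)"
  have G6: "poly2 (?H - [:0, [:2:]:]) (1/w) ((1 - 2*z*w + c*w^2) + u*w^3) = poly2 S6 u w" if "w \<noteq> 0" for u w
  proof -
    define i where "i = 1 / w"
    have "i * w = 1" using that by (simp add: i_def)
    then show ?thesis
      using assms unfolding poly2_simps poly_0 poly_pCons poly2_hamiltonian_poly S6_def i_def[symmetric] UWK by algebra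
  qed
  show thesis by (rule that[OF H3 G6 H9])
qed

lemma regular_on_charts_imp_constant:
  fixes a b c z :: complex and P :: "complex poly poly"
  assumes abc: "a + c = b + 2"
    and hb: "\<And>k. degree (coeff P k) \<le> k"
    and reg3: "\<And>w u. w \<noteq> 0 \<Longrightarrow> poly2 P (1/w) (a*w^2 + u*w^3) = poly2 R3 u w"
    and reg6: "\<And>w u. w \<noteq> 0 \<Longrightarrow> poly2 P (1/w) ((1 - 2*z*w + c*w^2) + u*w^3) = poly2 R6 u w"
    and reg9: "\<And>w u. w \<noteq> 0 \<Longrightarrow> u*w^2 + b*w \<noteq> 0 \<Longrightarrow>
       poly2 P (u*w^2 + b*w) (1 / (u*w^3 + b*w^2)) = poly2 R9 u w"
  shows "degree P = 0"
proof (rule ccontr)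
  assume "degree P \<noteq> 0"
  define n where "n = degree P"
  \<comment> \<open>This is \<open>n / 3\<close> rounded up, the order of vanishing forced at each
    of the three points.\<close>
  define m where "m = (n + 2) div 3"
  have m: "3 * m < n + 3" "n \<le> 3 * m" "m > 0" using \<open>degree P \<noteq> 0\<close> by (auto simp: m_def n_def)
  let ?A = "coeff P n"
  have A0: "?A \<noteq> 0" using \<open>degree P \<noteq> 0\<close> by (auto simp: n_def)
  have deg: "degree P \<le> n" by (simp add: n_def)
  have cont: "isCont (\<lambda>w. 1 - 2*z*w + c*w^2) 0" "isCont (\<lambda>w. a*w^2) 0"
    by (auto intro!: continuous_intros)
  have d0: "[:0, 1:] ^ m dvd ?A"
    using linear_power_dvd_leading_coeff[OF deg m(1) cont(2) reg3] by simp
  have d1: "[:-1, 1:] ^ m dvd ?A"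
    using linear_power_dvd_leading_coeff[OF deg m(1) cont(1) reg6] by simp
  have dA: "degree ?A + m \<le> n" by (rule order_three_contact[OF deg hb m(1) reg9 A0])
  \<comment> \<open>Otherwise \<open>n < 3 * m\<close>, and the zeros at 0, 1 and
    \<open>\<infinity>\<close> exceed the degree.\<close>
  have "n = 3 * m"
    using poly_eq_0_of_two_roots[OF d0 d1] A0 dA m(2) by force
  define B :: "complex poly" where "B = [:0, -1, 1:]"
  have B: "B = [:0, 1:] * [:-1, 1:]" by (simp add: B_def)
  have "coprime ([:0, 1 :: complex:]^m) ([:-1, 1:]^m)" by (rule coprime_two_roots)
  then have "B ^ m dvd ?A"
    unfolding B power_mult_distrib using d0 d1 by (intro divides_mult)
  then obtain s where s: "?A = B ^ m * s" by (elim dvdE)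
  have dB: "degree (B ^ k) = 2 * k" for k by (subst degree_power_eq) (auto simp: B_def)
  have "degree s = 0"
    using A0 dA \<open>n = 3 * m\<close> dB[of m] unfolding s by (auto simp: degree_mult_eq)
  then obtain C where C: "s = [:C:]" by (elim degree_eq_zeroE)
  with A0 s have C0: "C \<noteq> 0" by auto
  have A: "?A = smult C (B ^ m)" by (simp add: s C)
  define H where "H = hamiltonian_poly a b z"
  define G where "G = H - [:0, [:2:]:]"
  have dH: "degree H = 3" "lead_coeff H = B" "degree G = 3" "lead_coeff G = B"
    by (auto simp: H_def hamiltonian_poly_def G_def B_def numeral_3_eq_3)
  have hbH: "degree (coeff H k) \<le> k" for k
    unfolding H_def by (rule degree_coeff_hamiltonian_poly)
  obtain m' where m': "m = Suc m'" using m(3) by (metis gr0_conv_Suc)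
  \<comment> \<open>\<open>P1\<close> stays regular in the charts (a) and (c), \<open>P2\<close> in
    the chart (b). Since \<open>H ^ m\<close> and \<open>G ^ m\<close> agree at \<open>x ^ n\<close>
    and \<open>x ^ (n - 1)\<close>, so do \<open>P1\<close> and \<open>P2\<close>.\<close>
  define P1 where "P1 = P - smult [:C:] (H ^ m)"
  define P2 where "P2 = P - smult [:C:] (G ^ m)"
  have hb1: "degree (coeff P1 k) \<le> k" for k
    unfolding P1_def coeff_diff coeff_smult using degree_coeff_power_le[OF hbH, of m k] hb[of k]
    by (intro degree_diff_le) (auto intro: order_trans[OF degree_smult_le])
  have diffP: "P2 = P1 + smult [:C:] (H ^ m - G ^ m)"
    by (simp add: P1_def P2_def smult_diff_right)
  have HG: "H - G = [:0, [:2:]:]" by (simp add: G_def)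
  have dHG: "degree (H ^ m - G ^ m) \<le> 3 * m' + 1"
    and cHG: "coeff (H ^ m - G ^ m) (3 * m' + 1) = smult (2 * of_nat m) (B ^ m')"
    using coeff_power_diff_top[OF dH(1,3) _ HG m(3)] dH by (simp_all add: m' of_nat_poly algebra_simps)
  have dHG': "degree (smult [:C:] (H ^ m - G ^ m)) \<le> 3 * m' + 1"
    using dHG degree_smult_le order_trans by blast
  obtain S3 S6 S9 where
    H3: "\<And>w u. w \<noteq> 0 \<Longrightarrow> poly2 H (1/w) (a*w^2 + u*w^3) = poly2 S3 u w" and
    G6: "\<And>w u. w \<noteq> 0 \<Longrightarrow> poly2 G (1/w) ((1 - 2*z*w + c*w^2) + u*w^3) = poly2 S6 u w" and
    H9: "\<And>w u. w \<noteq> 0 \<Longrightarrow> u*w^2 + b*w \<noteq> 0 \<Longrightarrow>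
       poly2 H (u*w^2 + b*w) (1 / (u*w^3 + b*w^2)) = poly2 S9 u w"
    using hamiltonian_poly_regular[OF abc, of z] unfolding H_def G_def by metis
  obtain R3' where reg3': "\<And>w u. w \<noteq> 0 \<Longrightarrow> poly2 P1 (1/w) (a*w^2 + u*w^3) = poly2 R3' u w"
  proof
    show "poly2 P1 (1/w) (a*w^2 + u*w^3) = poly2 (R3 - [:[:C:]:] * S3 ^ m) u w" if "w \<noteq> 0" for w u
      using reg3[OF that] H3[OF that] by (simp add: P1_def)
  qed
  obtain R9' where reg9': "\<And>w u. w \<noteq> 0 \<Longrightarrow> u*w^2 + b*w \<noteq> 0 \<Longrightarrow>
       poly2 P1 (u*w^2 + b*w) (1 / (u*w^3 + b*w^2)) = poly2 R9' u w"
  proof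
    show "poly2 P1 (u*w^2 + b*w) (1 / (u*w^3 + b*w^2)) = poly2 (R9 - [:[:C:]:] * S9 ^ m) u w"
      if "w \<noteq> 0" "u*w^2 + b*w \<noteq> 0" for w u
      using reg9[OF that] H9[OF that] by (simp add: P1_def)
  qed
  obtain R6' where reg6': "\<And>w u. w \<noteq> 0 \<Longrightarrow> poly2 P2 (1/w) ((1 - 2*z*w + c*w^2) + u*w^3) = poly2 R6' u w"
  proof
    show "poly2 P2 (1/w) ((1 - 2*z*w + c*w^2) + u*w^3) = poly2 (R6 - [:[:C:]:] * S6 ^ m) u w" if "w \<noteq> 0" for w u
      using reg6[OF that] G6[OF that] by (simp add: P2_def)
  qed
  have "degree P1 \<le> Suc (3 * m' + 2)"
    unfolding P1_def using deg \<open>n = 3 * m\<close> degree_power_le[of H m] dH(1)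
    by (intro degree_diff_le) (auto simp: m' intro: order_trans[OF degree_smult_le])
  moreover have "coeff P1 (Suc (3 * m' + 2)) = 0"
  proof -
    have "H \<noteq> 0" using dH by auto
    then have "coeff (H ^ m) (3 * m) = B ^ m"
      using lead_coeff_power[of H m] dH by (simp add: degree_power_eq mult.commute)
    moreover have "Suc (3 * m' + 2) = 3 * m" using m' by simp
    ultimately show ?thesis using A \<open>n = 3 * m\<close> unfolding P1_def coeff_diff coeff_smult by simp
  qed
  ultimately have d1: "degree P1 \<le> Suc (3 * m' + 1)" using degree_le_decr[of P1 "3 * m' + 2"] by simp
  then have d2: "degree P2 \<le> Suc (3 * m' + 1)"
    unfolding diffP using dHG' by (intro degree_add_le) auto
  let ?n = "Suc (3 * m' + 1)"
  have eq12: "coeff P2 ?n = coeff P1 ?n"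
    unfolding diffP coeff_add using coeff_eq_0[of "smult [:C:] (H ^ m - G ^ m)" ?n] dHG' by simp
  \<comment> \<open>Here all three conditions concern one polynomial, and \<open>3 * m\<close> zeros
    are too many for the degree \<open>?n = 3 * m - 1\<close>.\<close>
  have "coeff P1 ?n = 0"
  proof (rule ccontr)
    assume A1: "coeff P1 ?n \<noteq> 0"
    have "degree (coeff P1 ?n) + m \<le> ?n"
      by (rule order_three_contact[OF d1 hb1 _ reg9' A1]) (simp_all add: m')
    moreover have "[:0, 1:] ^ m dvd coeff P1 ?n"
      using linear_power_dvd_leading_coeff[OF d1 _ cont(2) reg3', of m] by (simp add: m')
    moreover have "[:-1, 1:] ^ m dvd coeff P1 ?n"
      using linear_power_dvd_leading_coeff[OF d2 _ cont(1) reg6', of m] eq12 by (simp add: m')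
    ultimately show False using poly_eq_0_of_two_roots[of m "coeff P1 ?n" m] A1 m' by simp
  qed
  then have d1: "degree P1 \<le> 3 * m' + 1" and d2: "degree P2 \<le> 3 * m' + 1"
    using d1 d2 eq12 degree_le_decr[of _ "3 * m' + 1"] by auto
  let ?n = "3 * m' + 1" and ?A = "coeff P1 (3 * m' + 1)" and ?T = "coeff P2 (3 * m' + 1)"
  have T: "?T = ?A + smult (2 * C * of_nat m) (B ^ m')"
    unfolding diffP coeff_add coeff_smult cHG by (simp add: mult_ac)
  have dA: "degree ?A \<le> 2 * m'"
  proof (cases "?A = 0")
    case False
    have "degree ?A + m \<le> ?n"
      by (rule order_three_contact[OF d1 hb1 _ reg9' False]) (simp_all add: m')
    then show ?thesis by (simp add: m')
  qed simp
  have XA: "[:0, 1:] ^ m dvd ?A"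
    using linear_power_dvd_leading_coeff[OF d1 _ cont(2) reg3', of m] by (simp add: m')
  \<comment> \<open>At \<open>x ^ (n - 2)\<close> the coefficients \<open>?A\<close> and
    \<open>?T\<close> differ by a multiple of \<open>B ^ m'\<close>. \<open>?T\<close> has a zero of
    order \<open>m\<close> at 1 and inherits one of order \<open>m'\<close> at 0 from
    \<open>?A\<close> and \<open>B ^ m'\<close>; together these exceed its degree bound
    \<open>2 * m'\<close>.\<close>
  have "?T = 0"
  proof (rule poly_eq_0_of_two_roots)
    show "[:-1, 1:] ^ m dvd ?T"
      using linear_power_dvd_leading_coeff[OF d2 _ cont(1) reg6', of m] by (simp add: m')
    have "[:0, 1:] ^ m' dvd ?A" using XA unfolding m' by (metis dvd_mult_right power_Suc)
    moreover have "[:0, 1:] ^ m' dvd smult (2 * C * of_nat m) (B ^ m')"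
      unfolding B power_mult_distrib by (intro dvd_smult dvd_triv_left)
    ultimately show "[:0, 1:] ^ m' dvd ?T" unfolding T by (rule dvd_add)
    have "degree ?T \<le> 2 * m'"
      unfolding T using dA dB[of m'] by (intro degree_add_le) (auto intro: order_trans[OF degree_smult_le])
    then show "degree ?T < m' + m" by (simp add: m')
  qed
  \<comment> \<open>Now \<open>B ^ m'\<close> would have to vanish at 0 to the order
    \<open>m = m' + 1\<close> of \<open>?A\<close>, but 0 is a simple zero of
    \<open>B\<close>.\<close>
  then have "smult (2 * C * of_nat m) (B ^ m') = - ?A"
    unfolding T by (simp add: eq_neg_iff_add_eq_0 add.commute)
  then have "[:0, 1:] ^ m dvd smult (2 * C * of_nat m) (B ^ m')"
    using XA by simp
  then have "[:0, 1:] ^ m dvd B ^ m'"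
    using C0 m(3) by (simp add: dvd_smult_iff)
  then have "[:0, 1:] ^ m' * [:0, 1 :: complex:] dvd [:0, 1:] ^ m' * [:-1, 1:] ^ m'"
    unfolding B power_mult_distrib m' power_Suc2 .
  then have "[:0, 1 :: complex:] dvd [:-1, 1:] ^ m'"
    unfolding dvd_mult_cancel_left by simp
  then have "poly ([:-1, 1 :: complex:] ^ m') 0 = 0"
    using poly_eq_0_iff_dvd[of "[:-1, 1 :: complex:] ^ m'" 0] by simp
  then show False by (simp add: poly_power)
qed

section \<open>Coordinate changes, the area form and Hamiltonians in the charts\<close>

lemma vec2_eq_iff: "(p :: 'a ^ 2) = q \<longleftrightarrow> p $ 1 = q $ 1 \<and> p $ 2 = q $ 2"
  by (simp add: vec_eq_iff forall_2)

lemma vec2_eta: "vector [p $ 1, p $ 2] = (p :: 'a :: zero ^ 2)"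
  by (simp add: vec2_eq_iff)

lemma bounded_linear_vector2: "bounded_linear (\<lambda>x. vector [fst x, snd x] :: complex^2)"
  by (intro linear_conv_bounded_linear[THEN iffD1] linearI) (simp_all add: vec2_eq_iff)

lemma has_derivative_vector2:
  assumes "(f has_derivative f') (at x within S)" "(g has_derivative g') (at x within S)"
  shows "((\<lambda>x. vector [f x, g x] :: complex^2) has_derivative (\<lambda>x. vector [f' x, g' x])) (at x within S)"
  using bounded_linear.has_derivative[OF bounded_linear_vector2 has_derivative_Pair[OF assms]] by simp

text \<open>The derivative in time and position jointly, with time increment \<open>s\<close>. It
  does not depend on \<open>z\<close>, which enters only through the summand \<open>- 2 * z\<close>
  of (b).\<close>

definition to_xy_deriv :: "complex \<Rightarrow> complex \<Rightarrow> chart \<Rightarrow> complex^2 \<Rightarrow> complex \<times> (complex^2) \<Rightarrow> complex^2" where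
  "to_xy_deriv \<theta> \<kappa> c p h = (let u = p $ 1; w = p $ 2; s = fst h; u' = snd h $ 1; w' = snd h $ 2 in
     case c of
       XY \<Rightarrow> snd h
     | UW3 \<Rightarrow> vector [- w' / w^2, u' * w^2 + 2 * u * w * w' + 2*\<kappa>*w']
     | UW6 \<Rightarrow> vector [- w' / w^2, - w' / w^2 + (u' * w^2 + 2 * u * w * w') - 2 * s - 2*(\<kappa> - \<theta> - 1)*w']
     | UW9 \<Rightarrow> vector [u' * w^2 + 2 * u * w * w' + 2*\<theta>*w', - w' / w^2])"

lemma to_xy_has_derivative:
  assumes "c = XY \<or> p $ 2 \<noteq> 0"
  shows "((\<lambda>(t, q). to_xy \<theta> \<kappa> c t q) has_derivative to_xy_deriv \<theta> \<kappa> c p) (at (z, p))"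
proof -
  have hd: "((\<lambda>x. snd x $ k) has_derivative (\<lambda>h. snd h $ k)) (at (z, p))" for k :: 2
    by (intro bounded_linear.has_derivative[OF bounded_linear_vec_nth] has_derivative_snd has_derivative_ident)
  have hz: "(fst has_derivative fst) (at (z, p))"
    by (intro has_derivative_fst has_derivative_ident)
  have inv: "((\<lambda>x. 1 / (snd x $ 2)) has_derivative (\<lambda>h. - (snd h $ 2) / (p $ 2)^2)) (at (z, p))" if "p $ 2 \<noteq> 0"
    by (rule has_derivative_eq_rhs[OF has_derivative_divide[OF has_derivative_const hd]])
       (use that in \<open>auto simp: fun_eq_iff field_simps power2_eq_square\<close>)
  have sq: "((\<lambda>x. (snd x $ 1) * (snd x $ 2)^2) has_derivative
      (\<lambda>h. snd h $ 1 * (p $ 2)^2 + 2 * p $ 1 * p $ 2 * snd h $ 2)) (at (z, p))"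
    by (rule has_derivative_eq_rhs[OF has_derivative_mult[OF hd has_derivative_power[OF hd]]])
       (auto simp: fun_eq_iff algebra_simps)
  have lin: "((\<lambda>x. k * (snd x $ 2)) has_derivative (\<lambda>h. k * (snd h $ 2))) (at (z, p))" for k
    by (intro has_derivative_mult_right hd)
  have "((\<lambda>x. to_xy \<theta> \<kappa> c (fst x) (snd x)) has_derivative to_xy_deriv \<theta> \<kappa> c p) (at (z, p))"
  proof (cases c)
    case XY
    have "to_xy_deriv \<theta> \<kappa> XY p = snd" by (simp add: fun_eq_iff to_xy_deriv_def)
    then show ?thesis unfolding XY using has_derivative_snd[OF has_derivative_ident]
      by (simp add: to_xy_def)
  next
    case UW3
    show ?thesis unfolding to_xy_def to_xy_deriv_def Let_def UW3 chart.case
      using assms UW3 by (intro has_derivative_vector2 has_derivative_add inv sq lin) auto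
  next
    case UW6
    show ?thesis unfolding to_xy_def to_xy_deriv_def Let_def UW6 chart.case
      using assms UW6 by (intro has_derivative_vector2 has_derivative_add has_derivative_diff inv sq lin
        has_derivative_mult_right hz) auto
  next
    case UW9
    show ?thesis unfolding to_xy_def to_xy_deriv_def Let_def UW9 chart.case
      using assms UW9 by (intro has_derivative_vector2 has_derivative_add inv sq lin) auto
  qed
  then show ?thesis unfolding split_def .
qed

lemma to_xy_has_derivative_fixed_time:
  assumes "c = XY \<or> p $ 2 \<noteq> 0"
  shows "(to_xy \<theta> \<kappa> c z has_derivative (\<lambda>v. to_xy_deriv \<theta> \<kappa> c p (0, v))) (at p)"
proof -
  have "((\<lambda>q. (z, q)) has_derivative (\<lambda>v. (0, v))) (at p)"
    by (intro has_derivative_Pair has_derivative_const has_derivative_ident)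
  from has_derivative_compose[OF this to_xy_has_derivative[OF assms, of \<theta> \<kappa> z]] show ?thesis by simp
qed

text \<open>One coordinate is \<open>1 / w\<close> with differential \<open>- dw / w^2\<close>; of
  the other only the part \<open>w^2 * du\<close> matters, since the rest is a multiple of
  \<open>dw\<close>. In (c) the two coordinates are exchanged, which gives the sign.\<close>

lemma area_form_to_xy_deriv:
  assumes "c \<noteq> XY" "p \<in> chart_overlap"
  shows "area_form (to_xy_deriv \<theta> \<kappa> c p (0, v)) (to_xy_deriv \<theta> \<kappa> c p (0, v')) =
      (if c = UW9 then -1 else 1) * area_form v v'"
proof -
  define j where "j = inverse ((p $ 2)^2)"
  have j: "j * (p $ 2)^2 = 1" using assms(2) by (simp add: j_def chart_overlap_def)
  consider "c = UW3" | "c = UW6" | "c = UW9" using assms(1) by (cases c) auto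
  then show ?thesis
  proof cases
    case 1
    show ?thesis
      by (simp only: 1 to_xy_deriv_def area_form_def divide_inverse j_def[symmetric] Let_def chart.case vector_2
          fst_conv snd_conv chart.distinct if_False refl if_True) (use j in algebra)
  next
    case 2
    show ?thesis
      by (simp only: 2 to_xy_deriv_def area_form_def divide_inverse j_def[symmetric] Let_def chart.case vector_2
          fst_conv snd_conv chart.distinct if_False refl if_True) (use j in algebra)
  next
    case 3
    show ?thesis
      by (simp only: 3 to_xy_deriv_def area_form_def divide_inverse j_def[symmetric] Let_def chart.case vector_2
          fst_conv snd_conv chart.distinct if_False refl if_True) (use j in algebra)
  qed
qed

lemma symplectic_to_xy:
  assumes "c \<noteq> XY"
  shows "symplectic_up_to_sign chart_overlap (to_xy \<theta> \<kappa> c z)"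
proof -
  have "\<forall>p\<in>chart_overlap. \<exists>L. (to_xy \<theta> \<kappa> c z has_derivative L) (at p) \<and>
      (\<forall>v w. area_form (L v) (L w) = (if c = UW9 then -1 else 1) * area_form v w)"
  proof
    fix p assume p: "p \<in> chart_overlap"
    then have "(to_xy \<theta> \<kappa> c z has_derivative (\<lambda>v. to_xy_deriv \<theta> \<kappa> c p (0, v))) (at p)"
      by (intro to_xy_has_derivative_fixed_time) (simp add: chart_overlap_def)
    with area_form_to_xy_deriv[OF assms p] show "\<exists>L. (to_xy \<theta> \<kappa> c z has_derivative L) (at p) \<and>
      (\<forall>v w. area_form (L v) (L w) = (if c = UW9 then -1 else 1) * area_form v w)" by blast
  qed
  then show ?thesis
    unfolding symplectic_up_to_sign_def by (cases "c = UW9") auto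
qed

text \<open>When Hamiltonians are compared, connectedness turns a vanishing derivative on the
  overlap into a constant. It holds because the punctured complex plane is connected.\<close>

lemma connected_chart_overlap: "connected chart_overlap"
proof -
  have eq: "chart_overlap = (\<lambda>x. vector [fst x, snd x] :: complex^2) ` (UNIV \<times> - {0})"
  proof (intro set_eqI iffI)
    fix p :: "complex^2" assume "p \<in> chart_overlap"
    then show "p \<in> (\<lambda>x. vector [fst x, snd x]) ` (UNIV \<times> - {0})"
      by (intro image_eqI[where x = "(p $ 1, p $ 2)"]) (auto simp: chart_overlap_def vec2_eta)
  qed (auto simp: chart_overlap_def)
  have "connected (UNIV \<times> - {0} :: (complex \<times> complex) set)"
    by (intro connected_Times connected_UNIV connected_punctured_universe) simp
  then show ?thesis
    unfolding eq by (rule connected_continuous_image[OF linear_continuous_on[OF bounded_linear_vector2]])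
qed

lemma open_chart_overlap: "open chart_overlap"
proof -
  have "chart_overlap = (\<lambda>p. p $ 2) -` (- {0})" by (auto simp: chart_overlap_def)
  moreover have "open ((\<lambda>p :: complex^2. p $ 2) -` (- {0}))"
    by (intro open_vimage open_Compl closed_singleton continuous_on_component continuous_on_id)
  ultimately show ?thesis by simp
qed

text \<open>The Hamiltonian is recovered by integrating the first component in \<open>y\<close> and,
  along \<open>y = 0\<close>, the second one in \<open>x\<close>. Replacing \<open>y\<close> by
  \<open>x * v\<close> turns \<open>x ^ i * y ^ j\<close> into \<open>x ^ (i + j) * v ^ j\<close>,
  whence the degree bound.\<close>

lemma hamiltonian_is_polynomial:
  assumes F: "polynomial_field F" and H: "\<And>p. (H has_derivative area_form (F p)) (at p)"
  obtains h P where "\<And>x y. H (vector [x, y]) = poly2 h x y"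
    "\<And>x v. poly2 P x v = poly2 h x (x * v)" "\<And>k. degree (coeff P k) \<le> k"
proof -
  have "\<exists>n c. \<forall>p. F p $ 1 = (\<Sum>i\<le>n. \<Sum>j\<le>n. c i j * (p $ 1) ^ i * (p $ 2) ^ j)"
    using F unfolding polynomial_field_def by (rule spec)
  then obtain n c where c: "\<And>p. F p $ 1 = (\<Sum>i\<le>n. \<Sum>j\<le>n. c i j * (p $ 1) ^ i * (p $ 2) ^ j)"
    by blast
  have "\<exists>n c. \<forall>p. F p $ 2 = (\<Sum>i\<le>n. \<Sum>j\<le>n. c i j * (p $ 1) ^ i * (p $ 2) ^ j)"
    using F unfolding polynomial_field_def by (rule spec)
  then obtain m d where d: "\<And>p. F p $ 2 = (\<Sum>i\<le>m. \<Sum>j\<le>m. d i j * (p $ 1) ^ i * (p $ 2) ^ j)"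
    by blast
  have deriv: "((\<lambda>s. H (vector [f s, g s])) has_field_derivative
      F (vector [f s, g s]) $ 1 * g' - F (vector [f s, g s]) $ 2 * f') (at s)"
    if "(f has_field_derivative f') (at s)" "(g has_field_derivative g') (at s)" for f g s f' g'
  proof -
    have "((\<lambda>s. vector [f s, g s] :: complex^2) has_derivative (\<lambda>x. vector [f' * x, g' * x])) (at s)"
      using that unfolding has_field_derivative_def by (intro has_derivative_vector2)
    from has_derivative_compose[OF this H] show ?thesis
      unfolding has_field_derivative_def
      by (rule has_derivative_eq_rhs) (simp add: fun_eq_iff area_form_def algebra_simps)
  qed
  have const: "f x = f 0" if "\<And>x. (f has_field_derivative 0) (at x)" for f :: "complex \<Rightarrow> complex" and x
    using has_field_derivative_zero_constant[of UNIV f] that by auto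
  have y: "H (vector [x, y]) - (\<Sum>i\<le>n. \<Sum>j\<le>n. c i j / of_nat (Suc j) * x ^ i * y ^ Suc j) = H (vector [x, 0])" for x y
  proof -
    let ?f = "\<lambda>y. H (vector [x, y]) - (\<Sum>i\<le>n. \<Sum>j\<le>n. c i j / of_nat (Suc j) * x ^ i * y ^ Suc j)"
    have "(?f has_field_derivative 0) (at y)" for y
    proof -
      have "((\<lambda>y. H (vector [x, y])) has_field_derivative F (vector [x, y]) $ 1 * 1 - F (vector [x, y]) $ 2 * 0) (at y)"
        by (rule deriv) (rule DERIV_const DERIV_ident)+
      moreover have "((\<lambda>y. c i j / of_nat (Suc j) * x ^ i * y ^ Suc j) has_field_derivative
          c i j * x ^ i * y ^ j) (at y)" for i j
        by (rule DERIV_cong[OF DERIV_cmult[OF DERIV_power_Suc[OF DERIV_ident]]]) (simp add: of_nat_Suc[symmetric] del: of_nat_Suc)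
      ultimately have "(?f has_field_derivative (F (vector [x, y]) $ 1 * 1 - F (vector [x, y]) $ 2 * 0) -
          (\<Sum>i\<le>n. \<Sum>j\<le>n. c i j * x ^ i * y ^ j)) (at y)"
        by (intro DERIV_diff DERIV_sum)
      then show ?thesis by (simp add: c)
    qed
    from const[OF this, of y] show ?thesis by simp
  qed
  have x: "H (vector [x, 0]) + (\<Sum>i\<le>m. d i 0 / of_nat (Suc i) * x ^ Suc i) = H (vector [0, 0])" for x
  proof -
    let ?f = "\<lambda>x. H (vector [x, 0]) + (\<Sum>i\<le>m. d i 0 / of_nat (Suc i) * x ^ Suc i)"
    have "(?f has_field_derivative 0) (at x)" for x
    proof -
      have "((\<lambda>x. H (vector [x, 0])) has_field_derivative F (vector [x, 0]) $ 1 * 0 - F (vector [x, 0]) $ 2 * 1) (at x)"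
        by (rule deriv) (rule DERIV_const DERIV_ident)+
      moreover have "((\<lambda>x. d i 0 / of_nat (Suc i) * x ^ Suc i) has_field_derivative d i 0 * x ^ i) (at x)" for i
        by (rule DERIV_cong[OF DERIV_cmult[OF DERIV_power_Suc[OF DERIV_ident]]]) (simp add: of_nat_Suc[symmetric] del: of_nat_Suc)
      ultimately have "(?f has_field_derivative (F (vector [x, 0]) $ 1 * 0 - F (vector [x, 0]) $ 2 * 1) +
          (\<Sum>i\<le>m. d i 0 * x ^ i)) (at x)"
        by (intro DERIV_add DERIV_sum)
      moreover have "F (vector [x, 0]) $ 2 = (\<Sum>i\<le>m. d i 0 * x ^ i)"
        unfolding d by (intro sum.cong refl) (simp add: power_0_left if_distrib[of "\<lambda>t. _ * t"] cong: if_cong)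
      ultimately show ?thesis by simp
    qed
    from const[OF this, of x] show ?thesis by simp
  qed
  \<comment> \<open>\<open>f i j\<close> is the exponent of the outer variable given to the monomial
    \<open>x ^ i * y ^ j\<close>: the choice \<open>i\<close> yields \<open>h\<close>, the choice
    \<open>i + j\<close> yields \<open>P\<close>.\<close>
  define M where "M f = [:[:H (vector [0, 0]):]:] +
    (\<Sum>i\<le>n. \<Sum>j\<le>n. monom (monom (c i j / of_nat (Suc j)) (Suc j)) (f i (Suc j))) -
    (\<Sum>i\<le>m. monom (monom (d i 0 / of_nat (Suc i)) 0) (f (Suc i) 0))" for f :: "nat \<Rightarrow> nat \<Rightarrow> nat"
  show thesis
  proof (rule that[of "M (\<lambda>i j. i)" "M (+)"])
    show "H (vector [x, y]) = poly2 (M (\<lambda>i j. i)) x y" for x y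
      using y[of x y] x[of x]
      by (simp add: M_def poly2_sum poly2_monom poly_monom algebra_simps)
    show "poly2 (M (+)) x v = poly2 (M (\<lambda>i j. i)) x (x * v)" for x v
      by (simp add: M_def poly2_sum poly2_monom poly_monom power_mult_distrib power_add mult_ac)
    show "degree (coeff (M (+)) k) \<le> k" for k
      unfolding M_def coeff_diff coeff_add coeff_sum coeff_monom
      by (intro degree_diff_le degree_add_le degree_sum_le)
         (auto simp: coeff_pCons split: nat.split intro: order_trans[OF degree_monom_le])
  qed
qed


text \<open>The pullback of \<open>H\<close> is compared with a Hamiltonian \<open>K\<close> of
  \<open>F\<close>. The area form is preserved up to sign, so their differentials differ only
  through the velocity \<open>(0, - 2)\<close> of the moving gluing (b), whose contraction with the
  area form is the differential of \<open>2 / w\<close>.\<close>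

lemma hamiltonian_in_chart:
  assumes c: "c \<noteq> XY" and z: "z \<in> Z"
    and H: "\<And>p. (H has_derivative area_form (G z p)) (at p)"
    and F: "polynomial_field (F z)" "hamiltonian_field (F z)"
    and expr: "expressed_in_coordinates Z chart_overlap (to_xy \<theta> \<kappa> c) G F"
  obtains R where "\<And>w u. w \<noteq> 0 \<Longrightarrow>
    H (to_xy \<theta> \<kappa> c z (vector [u, w])) - (if c = UW6 then 2 / w else 0) = poly2 R u w"
proof -
  obtain K where K: "\<And>p. (K has_derivative area_form (F z p)) (at p)"
    using F(2) unfolding hamiltonian_field_def by blast
  obtain h P where h: "\<And>u w. K (vector [u, w]) = poly2 h u w"
    and "\<And>x v. poly2 P x v = poly2 h x (x * v)" "\<And>k. degree (coeff P k) \<le> k"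
    by (rule hamiltonian_is_polynomial[OF F(1) K]) (rule that)
  let ?e = "if c = UW9 then -1 else 1 :: complex"
  define f where "f p = H (to_xy \<theta> \<kappa> c z p) - (if c = UW6 then 2 / p $ 2 else 0) - ?e * K p" for p
  have "(f has_derivative (\<lambda>v. 0)) (at p)" if p: "p \<in> chart_overlap" for p
  proof -
    let ?D = "to_xy_deriv \<theta> \<kappa> c p"
    have w: "p $ 2 \<noteq> 0" using p by (simp add: chart_overlap_def)
    obtain L where L: "((\<lambda>(t, q). to_xy \<theta> \<kappa> c t q) has_derivative L) (at (z, p))"
      "L (1, F z p) = G z (to_xy \<theta> \<kappa> c z p)"
      using expr z p unfolding expressed_in_coordinates_def by blast
    have "L = ?D"
      by (rule has_derivative_unique[OF L(1) to_xy_has_derivative]) (use w in simp)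
    then have G: "G z (to_xy \<theta> \<kappa> c z p) = ?D (1, F z p)" using L(2) by simp
    have split: "?D (1, F z p) = ?D (0, F z p) + (if c = UW6 then vector [0, -2] else 0)"
      using c by (cases c) (simp_all add: to_xy_deriv_def Let_def vec2_eq_iff)
    have a: "area_form (?D (1, F z p)) (?D (0, v)) =
        ?e * area_form (F z p) v + (if c = UW6 then - (2 * v $ 2) / (p $ 2)^2 else 0)" for v
    proof -
      have "area_form (?D (1, F z p)) (?D (0, v)) = area_form (?D (0, F z p)) (?D (0, v)) +
          area_form (if c = UW6 then vector [0, -2] else 0) (?D (0, v))"
        unfolding split by (simp add: area_form_def algebra_simps)
      also have "area_form (if c = UW6 then vector [0, -2] else 0) (?D (0, v)) =
          (if c = UW6 then - (2 * v $ 2) / (p $ 2)^2 else 0)"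
        by (simp add: area_form_def to_xy_deriv_def Let_def)
      finally show ?thesis using area_form_to_xy_deriv[OF c p, of \<theta> \<kappa> "F z p" v] by simp
    qed
    have d1: "((\<lambda>p. H (to_xy \<theta> \<kappa> c z p)) has_derivative (\<lambda>v. area_form (?D (1, F z p)) (?D (0, v)))) (at p)"
      unfolding G[symmetric]
      by (rule has_derivative_compose[OF to_xy_has_derivative_fixed_time H]) (use w in simp)
    have d2: "((\<lambda>p. if c = UW6 then 2 / p $ 2 else 0) has_derivative
        (\<lambda>v. if c = UW6 then - (2 * v $ 2) / (p $ 2)^2 else 0)) (at p)"
    proof (cases "c = UW6")
      case True
      have "((\<lambda>p. 2 / p $ 2) has_derivative (\<lambda>v. - (2 * v $ 2) / (p $ 2)^2)) (at p)"
        by (rule has_derivative_eq_rhs[OF has_derivative_divide[OF has_derivative_const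
              bounded_linear_imp_has_derivative[OF bounded_linear_vec_nth]]])
           (use w in \<open>simp_all add: fun_eq_iff field_simps power2_eq_square\<close>)
      then show ?thesis using True by simp
    qed simp
    show ?thesis
      unfolding f_def
      by (rule has_derivative_eq_rhs[OF has_derivative_diff[OF has_derivative_diff[OF d1 d2]
            has_derivative_mult_right[OF K]]]) (simp add: fun_eq_iff a)
  qed
  then have f: "f p = f (vector [0, 1])" if "p \<in> chart_overlap" for p
    using that by (intro has_derivative_zero_unique_connected[OF open_chart_overlap connected_chart_overlap])
      (auto simp: chart_overlap_def)
  show thesis
  proof (rule that)
    fix w u :: complex assume "w \<noteq> 0"
    then show "H (to_xy \<theta> \<kappa> c z (vector [u, w])) - (if c = UW6 then 2 / w else 0) =
        poly2 ([:[:?e:]:] * h + [:[:f (vector [0, 1]):]:]) u w"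
      using f[of "vector [u, w]"] h[of u w] by (simp add: f_def chart_overlap_def algebra_simps)
  qed
qed

lemma PIV_hamiltonian:
  "((\<lambda>p. p $ 1 * p $ 2 * (p $ 2 - p $ 1 + 2 * z) - 2 * \<theta> * p $ 2 + 2 * \<kappa> * p $ 1)
     has_derivative area_form (PIV \<theta> \<kappa> z p)) (at p)"
proof -
  have hd: "((\<lambda>p. p $ k) has_derivative (\<lambda>v. v $ k)) (at p)" for k :: 2 and p :: "complex^2"
    by (rule bounded_linear_imp_has_derivative[OF bounded_linear_vec_nth])
  show ?thesis
    by (rule has_derivative_eq_rhs, (rule has_derivative_add has_derivative_diff has_derivative_mult hd
        has_derivative_const has_derivative_mult_right)+)
       (simp add: fun_eq_iff area_form_def PIV_def Let_def algebra_simps power2_eq_square)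
qed

lemma area_form_inject: "area_form p = area_form q \<Longrightarrow> p = q"
proof -
  assume a: "area_form p = area_form q"
  have "area_form p (vector [0, 1]) = area_form q (vector [0, 1])"
    "area_form p (vector [1, 0]) = area_form q (vector [1, 0])" by (simp_all add: a)
  then show ?thesis by (simp add: area_form_def vec2_eq_iff)
qed

text \<open>The slope \<open>y / x\<close> describes a Hamiltonian only where
  \<open>x \<noteq> 0\<close>; continuity in \<open>x\<close> fills in the line
  \<open>x = 0\<close>.\<close>

lemma polynomial_field_eqI:
  assumes F: "polynomial_field F" and G: "polynomial_field G" and eq: "\<And>p. p $ 1 \<noteq> 0 \<Longrightarrow> F p = G p"
  shows "F p = G p"
proof -
  have cont: "isCont (\<lambda>x. F (vector [x, y]) $ k) 0" if "polynomial_field F" for F y k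
  proof -
    have "\<exists>n c. \<forall>p. F p $ k = (\<Sum>i\<le>n. \<Sum>j\<le>n. c i j * (p $ 1) ^ i * (p $ 2) ^ j)"
      using that unfolding polynomial_field_def by (rule spec)
    then obtain n c where "\<And>p. F p $ k = (\<Sum>i\<le>n. \<Sum>j\<le>n. c i j * (p $ 1) ^ i * (p $ 2) ^ j)" by blast
    then show ?thesis by (simp add: continuous_intros)
  qed
  have "F (vector [0, y]) $ k = G (vector [0, y]) $ k" for y k
  proof -
    have "(\<lambda>x. F (vector [x, y]) $ k) \<midarrow>0\<rightarrow> F (vector [0, y]) $ k"
      using cont[OF F] by (rule isContD)
    moreover have "(\<lambda>x. F (vector [x, y]) $ k) \<midarrow>0\<rightarrow> G (vector [0, y]) $ k"
      by (rule Lim_transform_eventually[OF isContD[OF cont[OF G]]]) (simp add: eventually_at_filter eq)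
    ultimately show ?thesis by (rule LIM_unique)
  qed
  then have "F (vector [0, y]) = G (vector [0, y])" for y by (simp add: vec_eq_iff)
  from this[of "p $ 2"] show ?thesis using eq[of p] vec2_eta[of p] by (cases "p $ 1 = 0") auto
qed

lemma polynomial_field_PIV: "polynomial_field (PIV \<theta> \<kappa> z)"
  unfolding polynomial_field_def
proof
  fix k :: 2
  have key: "PIV \<theta> \<kappa> z p $ k = (\<Sum>i\<le>2. \<Sum>j\<le>2.
      (if k = 1 then (if (i, j) = (2, 0) then -1 else if (i, j) = (1, 1) then 2 else if (i, j) = (1, 0) then 2 * z
         else if (i, j) = (0, 0) then - 2 * \<theta> else 0)
       else (if (i, j) = (0, 2) then -1 else if (i, j) = (1, 1) then 2 else if (i, j) = (0, 1) then - 2 * z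
         else if (i, j) = (0, 0) then - 2 * \<kappa> else 0)) * (p $ 1) ^ i * (p $ 2) ^ j)" for p
    using exhaust_2[of k]
    by (auto simp: PIV_def Let_def numeral_2_eq_2 algebra_simps)
  show "\<exists>n c. \<forall>p. PIV \<theta> \<kappa> z p $ k = (\<Sum>i\<le>n. \<Sum>j\<le>n. c i j * p $ 1 ^ i * p $ 2 ^ j)"
    by (intro exI allI) (rule key)
qed

lemma hamiltonian_system_unique:
  assumes G: "polynomial_field (G z)" "hamiltonian_field (G z)" and z: "z \<in> Z"
    and charts: "\<And>c. c \<noteq> XY \<Longrightarrow> \<exists>F. polynomial_field (F z) \<and> hamiltonian_field (F z) \<and>
       expressed_in_coordinates Z chart_overlap (to_xy \<theta> \<kappa> c) G F"
  shows "G z p = PIV \<theta> \<kappa> z p"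
proof -
  obtain H where H: "\<And>p. (H has_derivative area_form (G z p)) (at p)"
    using G(2) unfolding hamiltonian_field_def by blast
  obtain h P where h: "\<And>x y. H (vector [x, y]) = poly2 h x y"
    and P: "\<And>x v. poly2 P x v = poly2 h x (x * v)" and hb: "\<And>k. degree (coeff P k) \<le> k"
    by (rule hamiltonian_is_polynomial[OF G(1) H]) (rule that)
  have HP: "poly2 P x v = H (vector [x, x * v])" for x v by (simp add: h P)
  have "\<exists>R. \<forall>w u. w \<noteq> 0 \<longrightarrow> H (to_xy \<theta> \<kappa> c z (vector [u, w])) - (if c = UW6 then 2 / w else 0) = poly2 R u w"
    if c: "c \<noteq> XY" for c
  proof -
    obtain F where "polynomial_field (F z)" "hamiltonian_field (F z)"
       "expressed_in_coordinates Z chart_overlap (to_xy \<theta> \<kappa> c) G F" using charts[OF c] by blast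
    from hamiltonian_in_chart[OF c z H this] show ?thesis by metis
  qed
  then obtain R where R: "\<And>c w u. c \<noteq> XY \<Longrightarrow> w \<noteq> 0 \<Longrightarrow>
      H (to_xy \<theta> \<kappa> c z (vector [u, w])) - (if c = UW6 then 2 / w else 0) = poly2 (R c) u w"
    by metis
  define a b c where "a = 2 * \<kappa>" and "b = 2 * \<theta>" and "c = 2 * (\<theta> + 1 - \<kappa>)"
  have abc: "a + c = b + 2" by (simp add: a_def b_def c_def)
  let ?H0 = "hamiltonian_poly a b z"
  obtain S3 S6 S9 where
    S3: "\<And>w u. w \<noteq> 0 \<Longrightarrow> poly2 ?H0 (1/w) (a*w^2 + u*w^3) = poly2 S3 u w" and
    S6: "\<And>w u. w \<noteq> 0 \<Longrightarrow> poly2 (?H0 - [:0, [:2:]:]) (1/w) ((1 - 2*z*w + c*w^2) + u*w^3) = poly2 S6 u w" and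
    S9: "\<And>w u. w \<noteq> 0 \<Longrightarrow> u*w^2 + b*w \<noteq> 0 \<Longrightarrow>
       poly2 ?H0 (u*w^2 + b*w) (1 / (u*w^3 + b*w^2)) = poly2 S9 u w"
    using hamiltonian_poly_regular[OF abc, of z] by metis
  have "degree (P - ?H0) = 0"
  proof (rule regular_on_charts_imp_constant[OF abc])
    show "degree (coeff (P - ?H0) k) \<le> k" for k
      unfolding coeff_diff by (intro degree_diff_le hb degree_coeff_hamiltonian_poly)
    fix w u :: complex assume w: "w \<noteq> 0"
    have "poly2 P (1/w) (a*w^2 + u*w^3) = poly2 (R UW3) u w"
      using R[of UW3 w u] w unfolding HP to_xy_def
      by (simp add: a_def algebra_simps power2_eq_square power3_eq_cube)
    then show "poly2 (P - ?H0) (1/w) (a*w^2 + u*w^3) = poly2 (R UW3 - S3) u w"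
      using S3[OF w] by simp
    have "poly2 P (1/w) ((1 - 2*z*w + c*w^2) + u*w^3) - 2 / w = poly2 (R UW6) u w"
    proof -
      have "1 / w * ((1 - 2*z*w + c*w^2) + u*w^3) = 1 / w + u * w^2 - 2 * z - 2 * (\<kappa> - \<theta> - 1) * w"
        using w by (simp add: c_def field_simps power2_eq_square power3_eq_cube)
      then show ?thesis using R[of UW6 w u] w unfolding HP to_xy_def by simp
    qed
    moreover have "poly2 ?H0 (1/w) ((1 - 2*z*w + c*w^2) + u*w^3) - 2 / w = poly2 S6 u w"
      using S6[OF w, of u] by simp
    moreover have "A - k = r \<Longrightarrow> B - k = s \<Longrightarrow> A - B = r - s" for A B k r s :: complex by auto
    ultimately show "poly2 (P - ?H0) (1/w) ((1 - 2*z*w + c*w^2) + u*w^3) = poly2 (R UW6 - S6) u w"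
      unfolding poly2_simps(2) by metis
    assume x: "u*w^2 + b*w \<noteq> 0"
    have "poly2 P (u*w^2 + b*w) (1 / (u*w^3 + b*w^2)) = poly2 (R UW9) u w"
    proof -
      have "u*w^3 + b*w^2 = (u*w^2 + b*w) * w" by (simp add: algebra_simps power2_eq_square power3_eq_cube)
      then have "(u*w^2 + b*w) * (1 / (u*w^3 + b*w^2)) = 1 / w" using x by simp
      then show ?thesis using R[of UW9 w u] w unfolding HP to_xy_def by (simp add: b_def)
    qed
    then show "poly2 (P - ?H0) (u*w^2 + b*w) (1 / (u*w^3 + b*w^2)) = poly2 (R UW9 - S9) u w"
      using S9[OF w x] by simp
  qed
  \<comment> \<open>Degree 0 in \<open>x\<close> still allows a polynomial \<open>q\<close> in the
    slope; the degree bound on the coefficient of \<open>x ^ 0\<close> makes it constant.\<close>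
  then obtain q where q: "P - ?H0 = [:q:]" by (elim degree_eq_zeroE)
  have "degree q \<le> 0"
    using degree_diff_le[OF hb[of 0] degree_coeff_hamiltonian_poly[of a b z 0]]
    by (metis coeff_diff coeff_pCons_0 q)
  then obtain k where k: "q = [:k:]" using degree_eq_zeroE by blast
  let ?N = "\<lambda>p. p $ 1 * p $ 2 * (p $ 2 - p $ 1 + 2 * z) - 2 * \<theta> * p $ 2 + 2 * \<kappa> * p $ 1"
  have Hk: "H p = ?N p + k" if "p $ 1 \<noteq> 0" for p
  proof -
    have "H p = poly2 P (p $ 1) (p $ 2 / p $ 1)"
      using that by (simp add: HP vec2_eta)
    also have "P = ?H0 + [:[:k:]:]" using q k by (metis diff_add_cancel add.commute)
    also have "poly2 \<dots> (p $ 1) (p $ 2 / p $ 1) = ?N p + k"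
      using that by (simp add: poly2_hamiltonian_poly a_def b_def field_simps power2_eq_square power3_eq_cube)
    finally show ?thesis .
  qed
  have "G z p = PIV \<theta> \<kappa> z p" if p: "p $ 1 \<noteq> 0" for p
  proof -
    have op: "open {p :: complex^2. p $ 1 \<noteq> 0}"
      by (intro open_Collect_neq continuous_on_component continuous_on_id continuous_on_const)
    have "((\<lambda>p. ?N p + k) has_derivative area_form (PIV \<theta> \<kappa> z p)) (at p)"
      using has_derivative_add[OF PIV_hamiltonian has_derivative_const[of k]] by simp
    then have "(H has_derivative area_form (PIV \<theta> \<kappa> z p)) (at p)"
      by (rule has_derivative_transform_within_open[OF _ op]) (use p Hk in auto)
    then show ?thesis using has_derivative_unique[OF H] by (metis area_form_inject)
  qed
  then show ?thesis by (rule polynomial_field_eqI[OF G(1) polynomial_field_PIV])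
qed

section \<open>Manifolds glued from charts\<close>

lemma holomorphic_fun_on_const: "holomorphic_fun_on (\<lambda>p. c) S"
  unfolding holomorphic_fun_on_def by (intro ballI exI[of _ 0]) simp

lemma holomorphic_fun_on_nth: "holomorphic_fun_on (\<lambda>p :: complex^'n. p $ k) S"
  unfolding holomorphic_fun_on_def
proof (intro ballI exI)
  fix p :: "complex^'n"
  have "(\<lambda>v. \<Sum>i\<in>UNIV. axis k 1 $ i * v $ i) = (\<lambda>v :: complex^'n. v $ k)"
    by (simp add: fun_eq_iff axis_def if_distrib[of "\<lambda>t. t * _"] cong: if_cong)
  then show "((\<lambda>p. p $ k) has_derivative (\<lambda>v. \<Sum>i\<in>UNIV. axis k 1 $ i * v $ i)) (at p within S)"
    using bounded_linear_imp_has_derivative[OF bounded_linear_vec_nth] by simp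
qed

lemma holomorphic_fun_on_add:
  assumes "holomorphic_fun_on f S" "holomorphic_fun_on g S"
  shows "holomorphic_fun_on (\<lambda>p. f p + g p) S"
  unfolding holomorphic_fun_on_def
proof
  fix p assume "p \<in> S"
  then obtain a b where "(f has_derivative (\<lambda>v. \<Sum>k\<in>UNIV. a $ k * v $ k)) (at p within S)"
      "(g has_derivative (\<lambda>v. \<Sum>k\<in>UNIV. b $ k * v $ k)) (at p within S)"
    using assms unfolding holomorphic_fun_on_def by blast
  from has_derivative_add[OF this]
  show "\<exists>a. ((\<lambda>p. f p + g p) has_derivative (\<lambda>v. \<Sum>k\<in>UNIV. a $ k * v $ k)) (at p within S)"
    by (intro exI[of _ "a + b"]) (simp add: sum.distrib distrib_right)
qed

lemma holomorphic_fun_on_mult: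
  assumes "holomorphic_fun_on f S" "holomorphic_fun_on g S"
  shows "holomorphic_fun_on (\<lambda>p. f p * g p) S"
  unfolding holomorphic_fun_on_def
proof
  fix p assume "p \<in> S"
  then obtain a b where "(f has_derivative (\<lambda>v. \<Sum>k\<in>UNIV. a $ k * v $ k)) (at p within S)"
      "(g has_derivative (\<lambda>v. \<Sum>k\<in>UNIV. b $ k * v $ k)) (at p within S)"
    using assms unfolding holomorphic_fun_on_def by blast
  from has_derivative_mult[OF this]
  have "((\<lambda>p. f p * g p) has_derivative (\<lambda>v. \<Sum>k\<in>UNIV. (\<chi> k. f p * b $ k + a $ k * g p) $ k * v $ k)) (at p within S)"
    by (rule has_derivative_eq_rhs)
       (simp add: fun_eq_iff sum.distrib sum_distrib_left sum_distrib_right algebra_simps)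
  then show "\<exists>a. ((\<lambda>p. f p * g p) has_derivative (\<lambda>v. \<Sum>k\<in>UNIV. a $ k * v $ k)) (at p within S)" by blast
qed

lemma holomorphic_fun_on_minus: "holomorphic_fun_on f S \<Longrightarrow> holomorphic_fun_on (\<lambda>p. - f p) S"
  using holomorphic_fun_on_mult[OF holomorphic_fun_on_const[of "-1"], of f S] by simp

lemma holomorphic_fun_on_diff:
  "holomorphic_fun_on f S \<Longrightarrow> holomorphic_fun_on g S \<Longrightarrow> holomorphic_fun_on (\<lambda>p. f p - g p) S"
  using holomorphic_fun_on_add[of f S "\<lambda>p. - g p"] holomorphic_fun_on_minus[of g S] by simp

lemma holomorphic_fun_on_power: "holomorphic_fun_on f S \<Longrightarrow> holomorphic_fun_on (\<lambda>p. f p ^ n) S"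
  using holomorphic_fun_on_const[of 1 S]
  by (induction n) (simp_all add: holomorphic_fun_on_mult)

lemma holomorphic_fun_on_inverse:
  assumes "holomorphic_fun_on f S" and nz: "\<And>p. p \<in> S \<Longrightarrow> f p \<noteq> 0"
  shows "holomorphic_fun_on (\<lambda>p. 1 / f p) S"
  unfolding holomorphic_fun_on_def
proof
  fix p assume p: "p \<in> S"
  then obtain a where "(f has_derivative (\<lambda>v. \<Sum>k\<in>UNIV. a $ k * v $ k)) (at p within S)"
    using assms unfolding holomorphic_fun_on_def by blast
  from Deriv.has_derivative_inverse[OF nz[OF p] this]
  have "((\<lambda>p. 1 / f p) has_derivative (\<lambda>v. \<Sum>k\<in>UNIV. (\<chi> k. - (inverse (f p) * a $ k * inverse (f p))) $ k * v $ k)) (at p within S)"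
    unfolding inverse_eq_divide[symmetric]
    by (rule has_derivative_eq_rhs)
       (simp add: fun_eq_iff sum_distrib_left sum_distrib_right sum_negf algebra_simps)
  then show "\<exists>a. ((\<lambda>p. 1 / f p) has_derivative (\<lambda>v. \<Sum>k\<in>UNIV. a $ k * v $ k)) (at p within S)" by blast
qed

lemma holomorphic_fun_on_subset: "holomorphic_fun_on f S \<Longrightarrow> T \<subseteq> S \<Longrightarrow> holomorphic_fun_on f T"
  unfolding holomorphic_fun_on_def by (meson has_derivative_subset subset_iff)

lemma holomorphic_fun_on_cong: "(\<And>p. p \<in> S \<Longrightarrow> f p = g p) \<Longrightarrow> holomorphic_fun_on f S \<Longrightarrow> holomorphic_fun_on g S"
  unfolding holomorphic_fun_on_def
proof
  fix p assume p: "p \<in> S" and eq: "\<And>p. p \<in> S \<Longrightarrow> f p = g p"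
    and f: "\<forall>p\<in>S. \<exists>a. (f has_derivative (\<lambda>v. \<Sum>k\<in>UNIV. a $ k * v $ k)) (at p within S)"
  obtain a where "(f has_derivative (\<lambda>v. \<Sum>k\<in>UNIV. a $ k * v $ k)) (at p within S)" using f p by blast
  then have "(g has_derivative (\<lambda>v. \<Sum>k\<in>UNIV. a $ k * v $ k)) (at p within S)"
    by (rule has_derivative_transform[where f = f, OF p, rotated]) (simp add: eq)
  then show "\<exists>a. (g has_derivative (\<lambda>v. \<Sum>k\<in>UNIV. a $ k * v $ k)) (at p within S)" by blast
qed

lemmas holomorphic_fun_on_intros = holomorphic_fun_on_add holomorphic_fun_on_diff
  holomorphic_fun_on_minus holomorphic_fun_on_mult holomorphic_fun_on_power
  holomorphic_fun_on_inverse holomorphic_fun_on_nth holomorphic_fun_on_const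

lemma holomorphic_fun_on_imp_continuous_on: "holomorphic_fun_on f S \<Longrightarrow> continuous_on S f"
  unfolding holomorphic_fun_on_def continuous_on_eq_continuous_within
  using has_derivative_continuous by blast

lemma holomorphic_map_on_imp_continuous_on: "holomorphic_map_on f S \<Longrightarrow> continuous_on S f"
  unfolding holomorphic_map_on_def continuous_on_def
  by (intro ballI vec_tendstoI) (use holomorphic_fun_on_imp_continuous_on in \<open>auto simp: continuous_on_def\<close>)

lemma holomorphic_map_on_cong: "(\<And>p. p \<in> S \<Longrightarrow> f p = g p) \<Longrightarrow> holomorphic_map_on f S \<Longrightarrow> holomorphic_map_on g S"
  unfolding holomorphic_map_on_def using holomorphic_fun_on_cong by (metis (no_types, lifting))

text \<open>One setting for the fibers and for the total space. \<open>dmn c d\<close> is the part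
  of chart \<open>c\<close> that lies in chart \<open>d\<close>. \<open>separated\<close> is the
  Hausdorff property in coordinates; it must be checked for the actual charts, because gluing along
  open sets can destroy it.\<close>

locale glued_charts =
  fixes f :: "'c::finite \<Rightarrow> complex^'n \<Rightarrow> 'p"
    and dmn :: "'c \<Rightarrow> 'c \<Rightarrow> (complex^'n) set"
    and tr :: "'c \<Rightarrow> 'c \<Rightarrow> complex^'n \<Rightarrow> complex^'n"
  assumes inj_chart: "inj (f c)"
    and open_dmn: "open (dmn c d)"
    and hol_tr: "holomorphic_map_on (tr c d) (dmn c d)"
    and range_iff: "f c q \<in> range (f d) \<longleftrightarrow> q \<in> dmn c d"
    and tr_eq: "q \<in> dmn c d \<Longrightarrow> f d (tr c d q) = f c q"
    and separated: "f c p \<noteq> f d q \<Longrightarrow> \<exists>U V. open U \<and> open V \<and> p \<in> U \<and> q \<in> V \<and> f c ` U \<inter> f d ` V = {}"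
begin

definition glued_space :: "'p topology" where
  "glued_space = quotient_topology (sum_topology (\<lambda>_. euclidean) UNIV) (\<lambda>(c, q). f c q)"

definition glued_atlas :: "('p set \<times> ('p \<Rightarrow> complex^'n)) set" where
  "glued_atlas = (\<lambda>c. (range (f c), inv (f c))) ` UNIV"

lemma topspace_glued_space: "topspace glued_space = (\<Union>c. range (f c))"
  unfolding glued_space_def topspace_quotient_topology by (auto simp: image_iff)

lemma openin_glued_space:
  "openin glued_space U \<longleftrightarrow> U \<subseteq> (\<Union>c. range (f c)) \<and> (\<forall>c. open (f c -` U))"
proof -
  have "(\<lambda>(c, q). f c q) ` topspace (sum_topology (\<lambda>_. euclidean) UNIV) = (\<Union>c. range (f c))"
    by (auto simp: image_iff)
  then show ?thesis
    unfolding glued_space_def openin_quotient_topology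
    by (auto simp: openin_sum_topology vimage_def)
qed

lemma tr_inv: "q \<in> dmn c d \<Longrightarrow> inv (f d) (f c q) = tr c d q"
  by (metis inj_chart inv_f_f tr_eq)

text \<open>Seen in another chart \<open>d\<close>, the image is the preimage of \<open>W\<close>
  under a transition map with open domain.\<close>

lemma open_chart_image:
  assumes "open W"
  shows "openin glued_space (f c ` W)"
  unfolding openin_glued_space
proof (intro conjI allI)
  fix d
  have "f d -` (f c ` W) = dmn d c \<inter> tr d c -` W"
  proof (intro set_eqI iffI)
    fix q assume "q \<in> f d -` (f c ` W)"
    then obtain w where w: "w \<in> W" "f d q = f c w" by auto
    then have q: "q \<in> dmn d c" using range_iff[of d q c] by auto
    then have "tr d c q = w" using tr_inv[OF q] w(2) inv_f_f[OF inj_chart] by simp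
    then show "q \<in> dmn d c \<inter> tr d c -` W" using q w by simp
  next
    fix q assume "q \<in> dmn d c \<inter> tr d c -` W"
    then show "q \<in> f d -` (f c ` W)" using tr_eq[of q d c] by (auto intro!: image_eqI[where x = "tr d c q"])
  qed
  then show "open (f d -` (f c ` W))"
    using continuous_open_preimage[OF holomorphic_map_on_imp_continuous_on[OF hol_tr] open_dmn assms] by metis
qed auto

lemma openin_range_chart: "openin glued_space (range (f c))"
  using open_chart_image[OF open_UNIV] .

lemma continuous_map_chart: "continuous_map euclidean glued_space (f c)"
  unfolding continuous_map_def openin_glued_space by (auto simp: topspace_glued_space vimage_def)

lemma embedding_map_chart: "embedding_map euclidean glued_space (f c)"
  by (rule injective_open_imp_embedding_map[OF continuous_map_chart])
     (use open_chart_image inj_chart in \<open>auto simp: open_map_def\<close>)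

lemma homeomorphic_map_inv_chart:
  "homeomorphic_map (subtopology glued_space (range (f c))) euclidean (inv (f c))"
proof -
  have "homeomorphic_map euclidean (subtopology glued_space (range (f c))) (f c)"
    using embedding_map_chart[of c] by (simp add: embedding_map_def)
  then obtain g where g: "homeomorphic_maps euclidean (subtopology glued_space (range (f c))) (f c) g"
    using homeomorphic_map_maps by blast
  then have "homeomorphic_map (subtopology glued_space (range (f c))) euclidean g"
    using homeomorphic_maps_map by blast
  moreover have "g x = inv (f c) x" if "x \<in> topspace (subtopology glued_space (range (f c)))" for x
    using g that unfolding homeomorphic_maps_def by (metis UNIV_I inj_chart inv_f_f f_inv_into_f IntD2 topspace_subtopology topspace_euclidean)
  ultimately show ?thesis using homeomorphic_map_eq by blast
qed

lemma Hausdorff_glued_space: "Hausdorff_space glued_space"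
  unfolding Hausdorff_space_def
proof (intro allI impI)
  fix x y assume xy: "x \<in> topspace glued_space \<and> y \<in> topspace glued_space \<and> x \<noteq> y"
  then obtain c p d q where "x = f c p" "y = f d q" by (auto simp: topspace_glued_space)
  with xy separated obtain U V where "open U" "open V" "p \<in> U" "q \<in> V" "f c ` U \<inter> f d ` V = {}" by metis
  then show "\<exists>U V. openin glued_space U \<and> openin glued_space V \<and> x \<in> U \<and> y \<in> V \<and> disjnt U V"
    using \<open>x = f c p\<close> \<open>y = f d q\<close>
    by (intro exI[of _ "f c ` U"] exI[of _ "f d ` V"]) (simp add: open_chart_image disjnt_def)
qed

lemma second_countable_glued_space: "second_countable glued_space"
proof -
  obtain B :: "(complex^'n) set set" where B: "countable B" "\<And>b. b \<in> B \<Longrightarrow> open b"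
    "\<And>S x. open S \<Longrightarrow> x \<in> S \<Longrightarrow> \<exists>b\<in>B. x \<in> b \<and> b \<subseteq> S"
  proof -
    obtain B :: "(complex^'n) set set" where B: "countable B" "topological_basis B"
      using ex_countable_basis by blast
    show thesis
      by (rule that[OF B(1) topological_basis_open[OF B(2)]]) (use topological_basisE[OF B(2)] in metis)+
  qed
  show ?thesis
    unfolding second_countable_def
  proof (intro exI conjI ballI allI impI)
    show "countable (\<Union>c. (image (f c)) ` B)"
      by (rule countable_UN[OF countable_finite[OF finite]], rule countable_image[OF B(1)])
    show "openin glued_space V" if "V \<in> (\<Union>c. (image (f c)) ` B)" for V
      using that B(2) open_chart_image by auto
    fix U x assume U: "openin glued_space U \<and> x \<in> U"
    then obtain c p where x: "x = f c p" using openin_subset topspace_glued_space by blast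
    have "open (f c -` U)" "p \<in> f c -` U" using U x openin_glued_space by auto
    from B(3)[OF this] obtain b where "b \<in> B" "p \<in> b" "b \<subseteq> f c -` U" by blast
    then show "\<exists>V\<in>\<Union>c. (image (f c)) ` B. x \<in> V \<and> V \<subseteq> U"
      using x by (intro bexI[of _ "f c ` b"]) auto
  qed
qed

lemma inv_chart_image: "inv (f c) ` (range (f c) \<inter> range (f d)) = dmn c d"
proof -
  have "q \<in> inv (f c) ` (range (f c) \<inter> range (f d))" if "q \<in> dmn c d" for q
    using that range_iff[of c q d] inv_f_f[OF inj_chart, of c q] by (intro image_eqI[where x = "f c q"]) auto
  moreover have "x \<in> dmn c d" if x: "x \<in> inv (f c) ` (range (f c) \<inter> range (f d))" for x
  proof -
    obtain q where "x = inv (f c) (f c q)" "f c q \<in> range (f d)" using x by blast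
    then show ?thesis using range_iff[of c q d] inv_f_f[OF inj_chart] by simp
  qed
  ultimately show ?thesis by blast
qed

lemma inv_into_inv_chart: "inv_into (range (f c)) (inv (f c)) q = f c q"
proof -
  have "inj_on (inv (f c)) (range (f c))" by (simp add: inj_on_inv_into)
  then have "inv_into (range (f c)) (inv (f c)) (inv (f c) (f c q)) = f c q"
    by (rule inv_into_f_f) simp
  then show ?thesis by (simp add: inv_f_f[OF inj_chart])
qed

lemma complex_manifold_glued: "complex_manifold glued_space glued_atlas"
  unfolding complex_manifold_def
proof (intro conjI)
  have im: "inv (f c) ` range (f c) = UNIV" for c
    using inv_f_f[OF inj_chart, of c] by (metis image_inv_f_f image_image inj_chart)
  show "(\<Union>(U, \<phi>)\<in>glued_atlas. U) = topspace glued_space"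
    by (simp add: glued_atlas_def topspace_glued_space)
  show "\<forall>(U, \<phi>)\<in>glued_atlas. openin glued_space U \<and> open (\<phi> ` U) \<and>
        homeomorphic_map (subtopology glued_space U) (top_of_set (\<phi> ` U)) \<phi>"
    by (simp add: glued_atlas_def openin_range_chart im homeomorphic_map_inv_chart)
  have "holomorphic_map_on (inv (f d) \<circ> inv_into (range (f c)) (inv (f c))) (inv (f c) ` (range (f c) \<inter> range (f d)))" for c d
    unfolding inv_chart_image
    by (rule holomorphic_map_on_cong[OF _ hol_tr]) (simp add: inv_into_inv_chart tr_inv)
  then show "\<forall>(U, \<phi>)\<in>glued_atlas. \<forall>(V, \<psi>)\<in>glued_atlas. holomorphic_map_on (\<psi> \<circ> inv_into U \<phi>) (\<phi> ` (U \<inter> V))"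
    by (simp add: glued_atlas_def)
qed (rule Hausdorff_glued_space second_countable_glued_space)+

end

section \<open>Transition maps between the four charts\<close>

instance chart :: finite
proof
  have "UNIV = {XY, UW3, UW6, UW9}" using chart.exhaust by blast
  then show "finite (UNIV :: chart set)" by (metis finite.simps)
qed

definition proj2 :: "complex^3 \<Rightarrow> complex^2" where
  "proj2 q = vector [q $ 1, q $ 2]"

text \<open>The fiber over \<open>z\<close> as a slice of a total chart. Statements about fibers are
  deduced from those about the total space by restriction to it.\<close>

definition emb3 :: "complex \<Rightarrow> complex^2 \<Rightarrow> complex^3" where
  "emb3 z p = vector [p $ 1, p $ 2, z]"

lemma vec3_eq_iff: "(p :: 'a ^ 3) = q \<longleftrightarrow> p $ 1 = q $ 1 \<and> p $ 2 = q $ 2 \<and> p $ 3 = q $ 3"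
  by (simp add: vec_eq_iff forall_3)

lemma proj2_emb3 [simp]: "proj2 (emb3 z p) = p" "emb3 z p $ 1 = p $ 1" "emb3 z p $ 2 = p $ 2" "emb3 z p $ 3 = z"
  "emb3 (q $ 3) (proj2 q) = q" "proj2 q $ 1 = q $ 1" "proj2 q $ 2 = q $ 2"
  by (simp_all add: proj2_def emb3_def vec2_eq_iff vec3_eq_iff)

lemma emb3_eq_iff: "emb3 z p = emb3 z' p' \<longleftrightarrow> z = z' \<and> p = p'"
  by (metis proj2_emb3(1,4))

lemma emb3_has_derivative: "(emb3 z has_derivative (\<lambda>v. emb3 0 v)) (at p within S)"
proof -
  have "bounded_linear (\<lambda>v. emb3 0 v)"
    by (intro linear_conv_bounded_linear[THEN iffD1] linearI) (simp_all add: emb3_def vec3_eq_iff)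
  then have "((\<lambda>p. emb3 0 p) has_derivative (\<lambda>v. emb3 0 v)) (at p within S)"
    by (rule bounded_linear_imp_has_derivative)
  from has_derivative_add[OF this has_derivative_const[of "vector [0, 0, z]"]]
  have "((\<lambda>p. emb3 0 p + vector [0, 0, z]) has_derivative (\<lambda>v. emb3 0 v)) (at p within S)"
    by simp
  moreover have "(\<lambda>p. emb3 0 p + vector [0, 0, z]) = emb3 z" by (simp add: fun_eq_iff emb3_def vec3_eq_iff)
  ultimately show ?thesis by simp
qed

lemma continuous_on_emb3: "continuous_on S (emb3 z)"
  by (rule has_derivative_continuous_on[OF emb3_has_derivative])

lemma holomorphic_fun_on_emb3:
  assumes "holomorphic_fun_on f S"
  shows "holomorphic_fun_on (\<lambda>p. f (emb3 z p)) (emb3 z -` S)"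
  unfolding holomorphic_fun_on_def
proof
  fix p assume p: "p \<in> emb3 z -` S"
  then obtain a where "(f has_derivative (\<lambda>v. \<Sum>k\<in>UNIV. a $ k * v $ k)) (at (emb3 z p) within S)"
    using assms unfolding holomorphic_fun_on_def by blast
  then have "(f has_derivative (\<lambda>v. \<Sum>k\<in>UNIV. a $ k * v $ k)) (at (emb3 z p) within (emb3 z ` (emb3 z -` S)))"
    by (rule has_derivative_subset) auto
  from has_derivative_in_compose[OF emb3_has_derivative this]
  show "\<exists>a. ((\<lambda>p. f (emb3 z p)) has_derivative (\<lambda>v. \<Sum>k\<in>UNIV. a $ k * v $ k)) (at p within emb3 z -` S)"
    by (intro exI[of _ "vector [a $ 1, a $ 2]"]) (simp add: sum_2 sum_3)
qed

text \<open>The whole chart \<open>XY\<close> is included, so that \<open>to_xy\<close> maps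
  \<open>chart_dom c\<close> bijectively onto \<open>xy_image c\<close> in all four cases.\<close>

definition chart_dom :: "chart \<Rightarrow> (complex^2) set" where
  "chart_dom c = {p. c = XY \<or> p $ 2 \<noteq> 0}"

definition xy_image :: "chart \<Rightarrow> (complex^2) set" where
  "xy_image c = {p. case c of XY \<Rightarrow> True | UW3 \<Rightarrow> p $ 1 \<noteq> 0 | UW6 \<Rightarrow> p $ 1 \<noteq> 0 | UW9 \<Rightarrow> p $ 2 \<noteq> 0}"

text \<open>\<open>near_divisor c\<close> is a neighbourhood of the curve at infinity (\<open>w = 0\<close>) of the chart \<open>c\<close>, minus the
  curve itself; the three regions are pairwise disjoint.\<close>

definition near_divisor :: "chart \<Rightarrow> (complex^2) set" where
  "near_divisor c = {p. case c of XY \<Rightarrow> False | UW3 \<Rightarrow> 2 * norm (p $ 2) < norm (p $ 1)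
     | UW6 \<Rightarrow> 2 * norm (p $ 2 - p $ 1) < norm (p $ 1) | UW9 \<Rightarrow> 2 * norm (p $ 1) < norm (p $ 2)}"

lemma near_divisor_disjoint:
  assumes "c \<noteq> d"
  shows "near_divisor c \<inter> near_divisor d = {}"
proof -
  have False if p: "p \<in> near_divisor c" "p \<in> near_divisor d" for p
  proof -
    have "norm (p $ 1) \<le> norm (p $ 2) + norm (p $ 2 - p $ 1)" "norm (p $ 2) \<le> norm (p $ 1) + norm (p $ 2 - p $ 1)"
      using norm_triangle_sub[of "p $ 1" "p $ 2"] norm_triangle_sub[of "p $ 2" "p $ 1"]
      by (simp_all add: norm_minus_commute)
    moreover have "norm (p $ 1) \<ge> 0" "norm (p $ 2) \<ge> 0" by simp_all
    ultimately show False
      using p assms unfolding near_divisor_def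
      by (cases c; cases d; simp only: mem_Collect_eq chart.case simp_thms; linarith)
  qed
  then show ?thesis by blast
qed

context
  fixes \<theta> \<kappa> :: complex
begin

definition from_xy :: "chart \<Rightarrow> complex \<Rightarrow> complex^2 \<Rightarrow> complex^2" where
  "from_xy c z p = (let x = p $ 1; y = p $ 2 in
     case c of
       XY \<Rightarrow> p
     | UW3 \<Rightarrow> vector [x^2 * y - 2*\<kappa>*x, 1 / x]
     | UW6 \<Rightarrow> vector [x^2 * (y - x + 2*z) + 2*(\<kappa> - \<theta> - 1)*x, 1 / x]
     | UW9 \<Rightarrow> vector [y^2 * x - 2*\<theta>*y, 1 / y])"

lemma to_xy_XY [simp]: "to_xy \<theta> \<kappa> XY z p = p"
  by (simp add: to_xy_def)

lemma from_xy_to_xy: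
  assumes "p \<in> chart_dom c"
  shows "to_xy \<theta> \<kappa> c z p \<in> xy_image c" "from_xy c z (to_xy \<theta> \<kappa> c z p) = p"
proof -
  have *: "(1 / w)^2 * (u * w^2 + k * w) - k * (1 / w) = u" if "w \<noteq> 0" for u w k :: complex
  proof -
    have "(1 / w) * w = 1" using that by simp
    then show ?thesis by algebra
  qed
  show "to_xy \<theta> \<kappa> c z p \<in> xy_image c"
    using assms by (cases c) (simp_all add: chart_dom_def xy_image_def to_xy_def Let_def)
  show "from_xy c z (to_xy \<theta> \<kappa> c z p) = p"
  proof (cases c)
    case UW3
    then have "p $ 2 \<noteq> 0" using assms by (simp add: chart_dom_def)
    then show ?thesis
      unfolding UW3 vec2_eq_iff from_xy_def to_xy_def Let_def chart.case vector_2
      by (intro conjI *) simp_all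
  next
    case UW6
    then have w: "p $ 2 \<noteq> 0" using assms by (simp add: chart_dom_def)
    have 6: "(1/w)^2 * (1/w + u*w^2 - 2*z - 2*(\<kappa> - \<theta> - 1)*w - 1/w + 2*z) + 2*(\<kappa> - \<theta> - 1)*(1/w) =
      (1/w)^2 * (u*w^2 + (- 2*(\<kappa> - \<theta> - 1))*w) - (- 2*(\<kappa> - \<theta> - 1))*(1/w)" for u w
      by (simp add: algebra_simps)
    show ?thesis
      unfolding UW6 vec2_eq_iff from_xy_def to_xy_def Let_def chart.case vector_2 6
      using w by (intro conjI *) simp_all
  next
    case UW9
    then have "p $ 2 \<noteq> 0" using assms by (simp add: chart_dom_def)
    then show ?thesis
      unfolding UW9 vec2_eq_iff from_xy_def to_xy_def Let_def chart.case vector_2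
      by (intro conjI *) simp_all
  qed (simp add: from_xy_def)
qed

lemma to_xy_from_xy:
  assumes "p \<in> xy_image c"
  shows "from_xy c z p \<in> chart_dom c" "to_xy \<theta> \<kappa> c z (from_xy c z p) = p"
proof -
  have *: "(x^2 * y - k * x) * (1 / x)^2 + k * (1 / x) = y" if "x \<noteq> 0" for x y k :: complex
  proof -
    have "(1 / x) * x = 1" using that by simp
    then show ?thesis by algebra
  qed
  show "from_xy c z p \<in> chart_dom c"
    using assms by (cases c) (simp_all add: chart_dom_def xy_image_def from_xy_def Let_def)
  show "to_xy \<theta> \<kappa> c z (from_xy c z p) = p"
  proof (cases c)
    case UW3
    then have "p $ 1 \<noteq> 0" using assms by (simp add: xy_image_def)
    then show ?thesis
      unfolding UW3 vec2_eq_iff from_xy_def to_xy_def Let_def chart.case vector_2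
      by (intro conjI *) simp_all
  next
    case UW6
    then have x: "p $ 1 \<noteq> 0" using assms by (simp add: xy_image_def)
    have "1 / (1 / x) + (x^2 * (y - x + 2*z) + 2*(\<kappa> - \<theta> - 1)*x) * (1 / x)^2 - 2*z - 2*(\<kappa> - \<theta> - 1)*(1 / x) = y"
      if "x \<noteq> 0" for x y
    proof -
      have "(1 / x) * x = 1" "1 / (1 / x) = x" using that by simp_all
      then show ?thesis by algebra
    qed
    then show ?thesis
      unfolding UW6 vec2_eq_iff from_xy_def to_xy_def Let_def chart.case vector_2
      using x by (intro conjI) simp_all
  next
    case UW9
    then have "p $ 2 \<noteq> 0" using assms by (simp add: xy_image_def)
    then show ?thesis
      unfolding UW9 vec2_eq_iff from_xy_def to_xy_def Let_def chart.case vector_2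
      by (intro conjI *) simp_all
  qed (simp add: from_xy_def)
qed

text \<open>Every generating pair leads to the chart \<open>XY\<close> and preserves the value of
  \<open>to_xy\<close>, so the right-hand side is already transitive. Conversely, two points with
  the same value are joined by two steps through \<open>XY\<close>.\<close>

lemma glue_rel_iff:
  "((c, p), (d, q)) \<in> glue_rel \<theta> \<kappa> z \<longleftrightarrow>
     (c = d \<and> p = q) \<or> (p \<in> chart_dom c \<and> q \<in> chart_dom d \<and> to_xy \<theta> \<kappa> c z p = to_xy \<theta> \<kappa> d z q)"
    (is "?L (c, p) (d, q) \<longleftrightarrow> ?R (c, p) (d, q)")
proof -
  define R where "R = {((c, p), (XY, to_xy \<theta> \<kappa> c z p)) | c p. c \<noteq> XY \<and> p \<in> chart_overlap}"
  define S where "S = (\<lambda>(c, p) (d, q). (c = d \<and> p = q) \<or>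
     (p \<in> chart_dom c \<and> q \<in> chart_dom d \<and> to_xy \<theta> \<kappa> c z p = to_xy \<theta> \<kappa> d z q))"
  have g: "glue_rel \<theta> \<kappa> z = (R \<union> R\<inverse>)\<^sup>*" by (simp add: glue_rel_def R_def Let_def)
  have S_trans: "S a c" if "S a b" "S b c" for a b c
    using that by (auto simp: S_def split: prod.splits)
  have RS: "S a b" if "(a, b) \<in> R \<union> R\<inverse>" for a b
    using that by (auto simp: S_def R_def chart_dom_def chart_overlap_def)
  have "S a b" if "(a, b) \<in> (R \<union> R\<inverse>)\<^sup>*" for a b
    using that
  proof (induction rule: rtrancl_induct)
    case base
    then show ?case by (simp add: S_def split: prod.splits)
  next
    case (step b c)
    then show ?case using S_trans RS by blast
  qed
  moreover have "(a, b) \<in> (R \<union> R\<inverse>)\<^sup>*" if "S a b" for a b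
  proof -
    obtain c p d q where ab: "a = (c, p)" "b = (d, q)" by (metis surj_pair)
    show ?thesis
    proof (cases "a = b")
      case False
      then have *: "p \<in> chart_dom c" "q \<in> chart_dom d" "to_xy \<theta> \<kappa> c z p = to_xy \<theta> \<kappa> d z q"
        using that by (auto simp: S_def ab)
      have r: "((c, p), (XY, to_xy \<theta> \<kappa> c z p)) \<in> R\<^sup>=" if "p \<in> chart_dom c" for c p
        using that by (cases "c = XY") (auto simp: R_def chart_dom_def chart_overlap_def)
      have "((c, p), (XY, to_xy \<theta> \<kappa> c z p)) \<in> (R \<union> R\<inverse>)\<^sup>*"
        using r[OF *(1)] by auto
      moreover have "((XY, to_xy \<theta> \<kappa> c z p), (d, q)) \<in> (R \<union> R\<inverse>)\<^sup>*"
        using r[OF *(2)] *(3) by auto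
      ultimately show ?thesis unfolding ab by (rule rtrancl_trans)
    qed simp
  qed
  ultimately have "(a, b) \<in> glue_rel \<theta> \<kappa> z \<longleftrightarrow> S a b" for a b using g by blast
  then show ?thesis by (simp add: S_def)
qed

lemma chart_pt_eq_iff:
  "chart_pt \<theta> \<kappa> c z p = chart_pt \<theta> \<kappa> d z q \<longleftrightarrow>
     (c = d \<and> p = q) \<or> (p \<in> chart_dom c \<and> q \<in> chart_dom d \<and> to_xy \<theta> \<kappa> c z p = to_xy \<theta> \<kappa> d z q)"
proof
  assume "chart_pt \<theta> \<kappa> c z p = chart_pt \<theta> \<kappa> d z q"
  moreover have "(d, q) \<in> chart_pt \<theta> \<kappa> d z q" by (simp add: chart_pt_def glue_rel_iff)
  ultimately have "(d, q) \<in> chart_pt \<theta> \<kappa> c z p" by simp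
  then show "(c = d \<and> p = q) \<or> (p \<in> chart_dom c \<and> q \<in> chart_dom d \<and> to_xy \<theta> \<kappa> c z p = to_xy \<theta> \<kappa> d z q)"
    by (simp add: chart_pt_def glue_rel_iff)
next
  assume "(c = d \<and> p = q) \<or> (p \<in> chart_dom c \<and> q \<in> chart_dom d \<and> to_xy \<theta> \<kappa> c z p = to_xy \<theta> \<kappa> d z q)"
  then show "chart_pt \<theta> \<kappa> c z p = chart_pt \<theta> \<kappa> d z q"
    by (auto simp: chart_pt_def glue_rel_iff)
qed

lemma total_pt_eq_iff:
  "total_pt \<theta> \<kappa> c p = total_pt \<theta> \<kappa> d q \<longleftrightarrow> p $ 3 = q $ 3 \<and>
     chart_pt \<theta> \<kappa> c (p $ 3) (proj2 p) = chart_pt \<theta> \<kappa> d (q $ 3) (proj2 q)"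
  by (auto simp: total_pt_def proj2_def)

lemma total_pt_emb3 [simp]: "total_pt \<theta> \<kappa> c (emb3 z p) = (chart_pt \<theta> \<kappa> c z p, z)"
  by (simp add: total_pt_def emb3_def vec2_eta)

text \<open>A chart meets itself everywhere, also at \<open>w = 0\<close>, where
  \<open>to_xy\<close> has no meaning; hence the separate case \<open>c = d\<close>.\<close>

definition total_dom :: "chart \<Rightarrow> chart \<Rightarrow> (complex^3) set" where
  "total_dom c d = {q. c \<noteq> d \<longrightarrow> proj2 q \<in> chart_dom c \<and> to_xy \<theta> \<kappa> c (q $ 3) (proj2 q) \<in> xy_image d}"

definition total_tr :: "chart \<Rightarrow> chart \<Rightarrow> complex^3 \<Rightarrow> complex^3" where
  "total_tr c d q = (if c = d then q
     else emb3 (q $ 3) (from_xy d (q $ 3) (to_xy \<theta> \<kappa> c (q $ 3) (proj2 q))))"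

lemma total_pt_in_range_iff: "total_pt \<theta> \<kappa> c q \<in> range (total_pt \<theta> \<kappa> d) \<longleftrightarrow> q \<in> total_dom c d"
proof
  assume "total_pt \<theta> \<kappa> c q \<in> range (total_pt \<theta> \<kappa> d)"
  then obtain p where "total_pt \<theta> \<kappa> c q = total_pt \<theta> \<kappa> d p" by blast
  then show "q \<in> total_dom c d"
    using from_xy_to_xy(1)[of "proj2 p" d "q $ 3"] by (auto simp: total_pt_eq_iff chart_pt_eq_iff total_dom_def)
next
  assume q: "q \<in> total_dom c d"
  show "total_pt \<theta> \<kappa> c q \<in> range (total_pt \<theta> \<kappa> d)"
  proof (cases "c = d")
    case False
    then have "total_pt \<theta> \<kappa> c q = total_pt \<theta> \<kappa> d (total_tr c d q)"
      using q to_xy_from_xy[of "to_xy \<theta> \<kappa> c (q $ 3) (proj2 q)" d "q $ 3"]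
      by (simp add: total_pt_eq_iff chart_pt_eq_iff total_dom_def total_tr_def del: total_pt_emb3)
    then show ?thesis by simp
  qed simp
qed

lemma total_pt_total_tr: "q \<in> total_dom c d \<Longrightarrow> total_pt \<theta> \<kappa> d (total_tr c d q) = total_pt \<theta> \<kappa> c q"
  using to_xy_from_xy[of "to_xy \<theta> \<kappa> c (q $ 3) (proj2 q)" d "q $ 3"]
  by (auto simp: total_pt_eq_iff chart_pt_eq_iff total_dom_def total_tr_def simp del: total_pt_emb3)

lemma total_tr_3 [simp]: "total_tr c d q $ 3 = q $ 3"
  by (simp add: total_tr_def)

lemma inj_total_pt: "inj (total_pt \<theta> \<kappa> c)"
proof (rule injI)
  fix p q assume "total_pt \<theta> \<kappa> c p = total_pt \<theta> \<kappa> c q"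
  then have pq: "p $ 3 = q $ 3 \<and> chart_pt \<theta> \<kappa> c (p $ 3) (proj2 p) = chart_pt \<theta> \<kappa> c (q $ 3) (proj2 q)"
    unfolding total_pt_eq_iff .
  from pq have z: "p $ 3 = q $ 3" by (rule conjunct1)
  have "chart_pt \<theta> \<kappa> c (p $ 3) (proj2 p) = chart_pt \<theta> \<kappa> c (p $ 3) (proj2 q)"
    using conjunct2[OF pq] unfolding z .
  then have "proj2 p = proj2 q"
    unfolding chart_pt_eq_iff by (metis from_xy_to_xy(2))
  with z have "p $ 3 = q $ 3" "proj2 p = proj2 q" by auto
  then show "p = q" by (metis proj2_emb3(5))
qed

lemma holomorphic_to_xy:
  "holomorphic_fun_on (\<lambda>q. to_xy \<theta> \<kappa> c (q $ 3) (proj2 q) $ k) {q. proj2 q \<in> chart_dom c}"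
proof -
  consider "k = 1" | "k = 2" using exhaust_2[of k] by blast
  then show ?thesis
    by cases (cases c; simp only: to_xy_def Let_def chart.case vector_2 proj2_emb3;
        intro holomorphic_fun_on_intros; simp add: chart_dom_def)+
qed

lemma holomorphic_from_xy:
  assumes "holomorphic_fun_on (\<lambda>q. h q $ 1) S" "holomorphic_fun_on (\<lambda>q. h q $ 2) S"
    and "\<And>q. q \<in> S \<Longrightarrow> h q \<in> xy_image d"
  shows "holomorphic_fun_on (\<lambda>q. from_xy d (q $ 3) (h q) $ k) S"
proof -
  consider "k = 1" | "k = 2" using exhaust_2[of k] by blast
  then show ?thesis
    by cases (cases d; simp only: from_xy_def Let_def chart.case vector_2;
        intro holomorphic_fun_on_intros assms(1,2); use assms(3) in \<open>simp add: xy_image_def\<close>)+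
qed

lemma holomorphic_total_tr: "holomorphic_map_on (total_tr c d) (total_dom c d)"
proof (cases "c = d")
  case True
  then show ?thesis by (auto simp: holomorphic_map_on_def total_tr_def holomorphic_fun_on_nth)
next
  case False
  let ?X = "\<lambda>q. to_xy \<theta> \<kappa> c (q $ 3) (proj2 q)"
  have sub: "total_dom c d \<subseteq> {q. proj2 q \<in> chart_dom c}" using False by (auto simp: total_dom_def)
  have h: "holomorphic_fun_on (\<lambda>q. ?X q $ k) (total_dom c d)" for k
    by (rule holomorphic_fun_on_subset[OF holomorphic_to_xy sub])
  have f: "holomorphic_fun_on (\<lambda>q. from_xy d (q $ 3) (?X q) $ k) (total_dom c d)" for k
    using False by (intro holomorphic_from_xy h) (simp add: total_dom_def)
  have "holomorphic_fun_on (\<lambda>q. total_tr c d q $ k) (total_dom c d)" for k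
    using exhaust_3[of k] f[of 1] f[of 2] holomorphic_fun_on_nth[of 3 "total_dom c d"] False
    by (auto simp: total_tr_def)
  then show ?thesis by (simp add: holomorphic_map_on_def)
qed

lemma open_Collect_holomorphic_nonzero:
  assumes "open D" "holomorphic_fun_on g D"
  shows "open {q \<in> D. g q \<noteq> 0}"
proof -
  have "open (D \<inter> g -` (- {0}))"
    by (intro continuous_open_preimage holomorphic_fun_on_imp_continuous_on assms) auto
  also have "D \<inter> g -` (- {0}) = {q \<in> D. g q \<noteq> 0}" by auto
  finally show ?thesis .
qed

lemma open_total_dom: "open (total_dom c d)"
proof (cases "c = d")
  case False
  have D: "open {q. proj2 q \<in> chart_dom c}"
  proof (cases "c = XY")
    case False
    have "open {q \<in> UNIV. (q :: complex^3) $ 2 \<noteq> 0}"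
      by (intro open_Collect_holomorphic_nonzero holomorphic_fun_on_nth) simp
    then show ?thesis using False by (simp add: chart_dom_def)
  qed (simp add: chart_dom_def)
  have "open {q \<in> {q. proj2 q \<in> chart_dom c}. to_xy \<theta> \<kappa> c (q $ 3) (proj2 q) $ k \<noteq> 0}" for k
    by (rule open_Collect_holomorphic_nonzero[OF D holomorphic_to_xy])
  from this[of 1] this[of 2] show ?thesis
    using D False by (cases d) (simp_all add: total_dom_def xy_image_def)
qed (simp add: total_dom_def)

end

text \<open>These are \<open>y / x\<close>, \<open>(y - x) / x\<close> and \<open>x / y\<close> in
  the coordinates of the chart, where they are polynomial and vanish at \<open>w = 0\<close>.
  Modulus below \<open>1 / 2\<close> is the condition defining \<open>near_divisor\<close>.\<close>

definition divisor_fun :: "complex \<Rightarrow> complex \<Rightarrow> chart \<Rightarrow> complex^3 \<Rightarrow> complex" where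
  "divisor_fun \<theta> \<kappa> c q = (let u = q $ 1; w = q $ 2; z = q $ 3 in case c of
      XY \<Rightarrow> 0
    | UW3 \<Rightarrow> w * (u * w^2 + 2*\<kappa>*w)
    | UW6 \<Rightarrow> w * (u * w^2 - 2*z - 2*(\<kappa> - \<theta> - 1)*w)
    | UW9 \<Rightarrow> w * (u * w^2 + 2*\<theta>*w))"

lemma holomorphic_divisor_fun: "holomorphic_fun_on (divisor_fun \<theta> \<kappa> c) S"
  by (cases c; simp only: divisor_fun_def[abs_def] Let_def chart.case; intro holomorphic_fun_on_intros)

lemma open_near_divisor: "open {q. norm (divisor_fun \<theta> \<kappa> c q) < 1 / 2}"
  by (intro open_Collect_less continuous_intros holomorphic_fun_on_imp_continuous_on holomorphic_divisor_fun)

lemma to_xy_near_divisor: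
  assumes "c \<noteq> XY" "q $ 2 \<noteq> 0" and d: "norm (divisor_fun \<theta> \<kappa> c q) < 1 / 2"
  shows "to_xy \<theta> \<kappa> c (q $ 3) (proj2 q) \<in> near_divisor c"
proof -
  have *: "2 * norm y < norm (1 / w)" if "norm (w * y) < 1 / 2" "w \<noteq> 0" for w y :: complex
    using that by (simp add: norm_mult norm_divide field_simps)
  have **: "(1 / w + y - 2 * z - k) - 1 / w = y - 2 * z - k" for w y z k :: complex by simp
  show ?thesis
    using assms(1) d *[OF _ assms(2)]
    by (cases c) (simp_all only: divisor_fun_def near_divisor_def to_xy_def Let_def chart.case vector_2 proj2_emb3
       mem_Collect_eq ** simp_thms)
qed

lemma separated_by_preimages:
  assumes c: "continuous_on A f" "open A" "p \<in> A" and d: "continuous_on B g" "open B" "q \<in> B"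
    and ne: "f p \<noteq> (g q :: 'a :: t2_space)"
  obtains U V where "open U" "open V" "p \<in> U" "q \<in> V" "U \<subseteq> A" "V \<subseteq> B" "\<And>p' q'. p' \<in> U \<Longrightarrow> q' \<in> V \<Longrightarrow> f p' \<noteq> g q'"
proof -
  obtain S T where ST: "open S" "open T" "f p \<in> S" "g q \<in> T" "S \<inter> T = {}"
    using hausdorff[OF ne] by blast
  show thesis
  proof (rule that)
    show "open (A \<inter> f -` S)" "open (B \<inter> g -` T)"
      using c d ST by (auto intro: continuous_open_preimage)
  qed (use c d ST in auto)
qed

text \<open>If \<open>q\<close> has finite coordinates \<open>(x, y)\<close>, they are bounded near
  \<open>q\<close>, while near \<open>p\<close> one of them is \<open>1 / w\<close> and large. If
  \<open>q\<close> lies on another curve at infinity, the disjoint regions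
  \<open>near_divisor\<close> separate the two points.\<close>

lemma divisor_separated:
  assumes c: "c \<noteq> XY" "p $ 2 = 0" and q: "q \<notin> total_dom \<theta> \<kappa> d c"
  shows "\<exists>U V. open U \<and> open V \<and> p \<in> U \<and> q \<in> V \<and> total_pt \<theta> \<kappa> c ` U \<inter> total_pt \<theta> \<kappa> d ` V = {}"
proof -
  have cd: "d \<noteq> c" using q by (auto simp: total_dom_def)
  have eq: "p' \<in> total_dom \<theta> \<kappa> c XY \<and> q' \<in> total_dom \<theta> \<kappa> d XY \<and>
       to_xy \<theta> \<kappa> c (p' $ 3) (proj2 p') = to_xy \<theta> \<kappa> d (q' $ 3) (proj2 q')"
    if "total_pt \<theta> \<kappa> c p' = total_pt \<theta> \<kappa> d q'" for p' q'
    using that cd by (auto simp: total_pt_eq_iff chart_pt_eq_iff total_dom_def xy_image_def)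
  have c_dom: "p' $ 2 \<noteq> 0" if "p' \<in> total_dom \<theta> \<kappa> c XY" for p'
    using that c by (simp add: total_dom_def chart_dom_def)
  show ?thesis
  proof (cases "q \<in> total_dom \<theta> \<kappa> d XY")
    case True
    let ?X = "\<lambda>q'. to_xy \<theta> \<kappa> d (q' $ 3) (proj2 q')"
    define M where "M = norm (?X q) + 1"
    have "M > 0" by (simp add: M_def add_nonneg_pos)
    let ?U = "{p' :: complex^3. norm (p' $ 2) < 1 / M}"
    let ?V = "{q' \<in> total_dom \<theta> \<kappa> d XY. norm (?X q' $ 1) < M \<and> norm (?X q' $ 2) < M}"
    have "open ?U" by (intro open_Collect_less continuous_intros)
    moreover have "open ?V"
    proof -
      have "continuous_on (total_dom \<theta> \<kappa> d XY) (\<lambda>q'. ?X q' $ k)" for k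
        by (rule holomorphic_fun_on_imp_continuous_on[OF holomorphic_fun_on_subset[OF holomorphic_to_xy]])
           (auto simp: total_dom_def chart_dom_def)
      then have "open (total_dom \<theta> \<kappa> d XY \<inter> (\<lambda>q'. ?X q' $ k) -` ball 0 M)" for k
        by (intro continuous_open_preimage open_total_dom open_ball)
      then have "open ((total_dom \<theta> \<kappa> d XY \<inter> (\<lambda>q'. ?X q' $ 1) -` ball 0 M) \<inter> (total_dom \<theta> \<kappa> d XY \<inter> (\<lambda>q'. ?X q' $ 2) -` ball 0 M))"
        by blast
      moreover have "(total_dom \<theta> \<kappa> d XY \<inter> (\<lambda>q'. ?X q' $ 1) -` ball 0 M) \<inter> (total_dom \<theta> \<kappa> d XY \<inter> (\<lambda>q'. ?X q' $ 2) -` ball 0 M) = ?V"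
        by auto
      ultimately show ?thesis by simp
    qed
    moreover have "p \<in> ?U" using c \<open>M > 0\<close> by simp
    moreover have "q \<in> ?V"
      using True Finite_Cartesian_Product.norm_nth_le[of "?X q" 1] Finite_Cartesian_Product.norm_nth_le[of "?X q" 2]
      by (simp add: M_def)
    moreover have "total_pt \<theta> \<kappa> c ` ?U \<inter> total_pt \<theta> \<kappa> d ` ?V = {}"
    proof (rule ccontr)
      assume "total_pt \<theta> \<kappa> c ` ?U \<inter> total_pt \<theta> \<kappa> d ` ?V \<noteq> {}"
      then obtain p' q' where pq: "p' \<in> ?U" "q' \<in> ?V" "total_pt \<theta> \<kappa> c p' = total_pt \<theta> \<kappa> d q'" by blast
      have w: "p' $ 2 \<noteq> 0" and X: "to_xy \<theta> \<kappa> c (p' $ 3) (proj2 p') = ?X q'" using eq[OF pq(3)] c_dom by auto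
      have "norm (p' $ 2) < 1 / M" using pq(1) by simp
      then have "norm (1 / p' $ 2) > M" using w \<open>M > 0\<close> by (simp add: norm_divide field_simps)
      moreover have "?X q' $ 1 = 1 / p' $ 2 \<or> ?X q' $ 2 = 1 / p' $ 2"
        unfolding X[symmetric] using c by (cases c) (simp_all add: to_xy_def Let_def)
      ultimately show False using pq(2) by auto
    qed
    ultimately show ?thesis by blast
  next
    case False
    then have d: "d \<noteq> XY" "q $ 2 = 0" by (auto simp: total_dom_def chart_dom_def xy_image_def)
    let ?U = "\<lambda>c. {q. norm (divisor_fun \<theta> \<kappa> c q) < 1 / 2}"
    have mem: "p \<in> ?U c" if "p $ 2 = 0" for p c
      using that by (cases c) (simp_all add: divisor_fun_def)
    have disj: "total_pt \<theta> \<kappa> c ` ?U c \<inter> total_pt \<theta> \<kappa> d ` ?U d = {}"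
    proof (rule ccontr)
      assume "total_pt \<theta> \<kappa> c ` ?U c \<inter> total_pt \<theta> \<kappa> d ` ?U d \<noteq> {}"
      then obtain p' q' where pq: "p' \<in> ?U c" "q' \<in> ?U d" "total_pt \<theta> \<kappa> c p' = total_pt \<theta> \<kappa> d q'" by blast
      have pd: "p' \<in> total_dom \<theta> \<kappa> c XY" and qd: "q' \<in> total_dom \<theta> \<kappa> d XY" using eq[OF pq(3)] by blast+
      have "p' $ 2 \<noteq> 0" by (rule c_dom[OF pd])
      moreover have "q' $ 2 \<noteq> 0" using qd d(1) by (simp add: total_dom_def chart_dom_def)
      ultimately have "to_xy \<theta> \<kappa> c (p' $ 3) (proj2 p') \<in> near_divisor c" "to_xy \<theta> \<kappa> d (q' $ 3) (proj2 q') \<in> near_divisor d"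
        using pq c d by (simp_all add: to_xy_near_divisor)
      then show False using eq[OF pq(3)] near_divisor_disjoint[OF cd] by auto
    qed
    show ?thesis
      by (rule exI[of _ "?U c"], rule exI[of _ "?U d"])
         (intro conjI open_near_divisor mem[OF c(2)] mem[OF d(2)] disj)
  qed
qed

text \<open>Two points in a common chart are separated in its coordinates; otherwise one of them
  lies on a curve at infinity and the other one outside the chart of that curve.\<close>

lemma total_pt_separated:
  assumes "total_pt \<theta> \<kappa> c p \<noteq> total_pt \<theta> \<kappa> d q"
  shows "\<exists>U V. open U \<and> open V \<and> p \<in> U \<and> q \<in> V \<and> total_pt \<theta> \<kappa> c ` U \<inter> total_pt \<theta> \<kappa> d ` V = {}"
proof -
  have common: ?thesis if e: "p \<in> total_dom \<theta> \<kappa> c e" "q \<in> total_dom \<theta> \<kappa> d e" for e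
  proof -
    have "total_tr \<theta> \<kappa> c e p \<noteq> total_tr \<theta> \<kappa> d e q"
      using assms total_pt_total_tr e by metis
    then obtain U V where UV: "open U" "open V" "p \<in> U" "q \<in> V" "U \<subseteq> total_dom \<theta> \<kappa> c e" "V \<subseteq> total_dom \<theta> \<kappa> d e"
      "\<And>p' q'. p' \<in> U \<Longrightarrow> q' \<in> V \<Longrightarrow> total_tr \<theta> \<kappa> c e p' \<noteq> total_tr \<theta> \<kappa> d e q'"
      by (rule separated_by_preimages[OF holomorphic_map_on_imp_continuous_on[OF holomorphic_total_tr] open_total_dom e(1)
          holomorphic_map_on_imp_continuous_on[OF holomorphic_total_tr] open_total_dom e(2)]) (rule that)
    have ne: "total_pt \<theta> \<kappa> c p' \<noteq> total_pt \<theta> \<kappa> d q'" if "p' \<in> U" "q' \<in> V" for p' q'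
    proof
      assume "total_pt \<theta> \<kappa> c p' = total_pt \<theta> \<kappa> d q'"
      then have "total_pt \<theta> \<kappa> e (total_tr \<theta> \<kappa> c e p') = total_pt \<theta> \<kappa> e (total_tr \<theta> \<kappa> d e q')"
        using UV(5,6) that total_pt_total_tr by (metis subsetD)
      then have "total_tr \<theta> \<kappa> c e p' = total_tr \<theta> \<kappa> d e q'" using inj_total_pt by (metis injD)
      then show False using UV(7)[OF that] by blast
    qed
    have "total_pt \<theta> \<kappa> c ` U \<inter> total_pt \<theta> \<kappa> d ` V = {}" using ne by blast
    then show ?thesis using UV(1-4) by blast
  qed
  show ?thesis
  proof (cases "q \<in> total_dom \<theta> \<kappa> d c \<or> p \<in> total_dom \<theta> \<kappa> c d")
    case True
    moreover have "p \<in> total_dom \<theta> \<kappa> c c" "q \<in> total_dom \<theta> \<kappa> d d" by (simp_all add: total_dom_def)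
    ultimately show ?thesis using common[of c] common[of d] by blast
  next
    case False
    then have nq: "q \<notin> total_dom \<theta> \<kappa> d c" and np: "p \<notin> total_dom \<theta> \<kappa> c d" by blast+
    show ?thesis
    proof (cases "p \<in> total_dom \<theta> \<kappa> c XY \<and> q \<in> total_dom \<theta> \<kappa> d XY")
      case True
      then show ?thesis using common[of XY] by blast
    next
      case nXY: False
      show ?thesis
      proof (cases "p \<in> total_dom \<theta> \<kappa> c XY")
        case False
        then have "c \<noteq> XY" "p $ 2 = 0" by (auto simp: total_dom_def chart_dom_def xy_image_def)
        then show ?thesis using nq by (rule divisor_separated)
      next
        case True
        then have "d \<noteq> XY" "q $ 2 = 0" using nXY by (auto simp: total_dom_def chart_dom_def xy_image_def)
        then have "\<exists>U V. open U \<and> open V \<and> q \<in> U \<and> p \<in> V \<and> total_pt \<theta> \<kappa> d ` U \<inter> total_pt \<theta> \<kappa> c ` V = {}"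
          using np by (rule divisor_separated)
        then show ?thesis by (metis Int_commute)
      qed
    qed
  qed
qed

lemma total_glued_charts: "glued_charts (total_pt \<theta> \<kappa>) (total_dom \<theta> \<kappa>) (total_tr \<theta> \<kappa>)"
proof
  fix c d p q
  show "inj (total_pt \<theta> \<kappa> c)" by (rule inj_total_pt)
  show "open (total_dom \<theta> \<kappa> c d)" by (rule open_total_dom)
  show "holomorphic_map_on (total_tr \<theta> \<kappa> c d) (total_dom \<theta> \<kappa> c d)" by (rule holomorphic_total_tr)
  show "total_pt \<theta> \<kappa> c q \<in> range (total_pt \<theta> \<kappa> d) \<longleftrightarrow> q \<in> total_dom \<theta> \<kappa> c d" by (rule total_pt_in_range_iff)
  show "total_pt \<theta> \<kappa> d (total_tr \<theta> \<kappa> c d q) = total_pt \<theta> \<kappa> c q" if "q \<in> total_dom \<theta> \<kappa> c d"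
    using that by (rule total_pt_total_tr)
  show "\<exists>U V. open U \<and> open V \<and> p \<in> U \<and> q \<in> V \<and> total_pt \<theta> \<kappa> c ` U \<inter> total_pt \<theta> \<kappa> d ` V = {}"
    if "total_pt \<theta> \<kappa> c p \<noteq> total_pt \<theta> \<kappa> d q"
    using that by (rule total_pt_separated)
qed

definition fiber_dom :: "complex \<Rightarrow> complex \<Rightarrow> complex \<Rightarrow> chart \<Rightarrow> chart \<Rightarrow> (complex^2) set" where
  "fiber_dom \<theta> \<kappa> z c d = emb3 z -` total_dom \<theta> \<kappa> c d"

definition fiber_tr :: "complex \<Rightarrow> complex \<Rightarrow> complex \<Rightarrow> chart \<Rightarrow> chart \<Rightarrow> complex^2 \<Rightarrow> complex^2" where
  "fiber_tr \<theta> \<kappa> z c d p = proj2 (total_tr \<theta> \<kappa> c d (emb3 z p))"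

lemma total_tr_emb3: "total_tr \<theta> \<kappa> c d (emb3 z p) = emb3 z (fiber_tr \<theta> \<kappa> z c d p)"
  unfolding fiber_tr_def by (metis proj2_emb3(4,5) total_tr_3)

lemma fiber_glued_charts: "glued_charts (\<lambda>c. chart_pt \<theta> \<kappa> c z) (fiber_dom \<theta> \<kappa> z) (fiber_tr \<theta> \<kappa> z)"
proof
  fix c d p q
  show "inj (chart_pt \<theta> \<kappa> c z)"
  proof (rule injI)
    fix p q assume "chart_pt \<theta> \<kappa> c z p = chart_pt \<theta> \<kappa> c z q"
    then have "total_pt \<theta> \<kappa> c (emb3 z p) = total_pt \<theta> \<kappa> c (emb3 z q)" by simp
    then have "emb3 z p = emb3 z q" by (rule injD[OF inj_total_pt])
    then show "p = q" by (simp add: emb3_eq_iff)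
  qed
  show "open (fiber_dom \<theta> \<kappa> z c d)"
    unfolding fiber_dom_def by (intro open_vimage open_total_dom continuous_on_emb3)
  show "holomorphic_map_on (fiber_tr \<theta> \<kappa> z c d) (fiber_dom \<theta> \<kappa> z c d)"
    unfolding holomorphic_map_on_def
  proof
    fix k :: 2
    have h: "holomorphic_fun_on (\<lambda>p. total_tr \<theta> \<kappa> c d (emb3 z p) $ j) (fiber_dom \<theta> \<kappa> z c d)" for j
      unfolding fiber_dom_def using holomorphic_total_tr[of \<theta> \<kappa> c d]
      by (intro holomorphic_fun_on_emb3) (simp add: holomorphic_map_on_def)
    show "holomorphic_fun_on (\<lambda>p. fiber_tr \<theta> \<kappa> z c d p $ k) (fiber_dom \<theta> \<kappa> z c d)"
      using exhaust_2[of k] h[of 1] h[of 2] unfolding fiber_tr_def by (elim disjE) simp_all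
  qed
  show "(chart_pt \<theta> \<kappa> c z q \<in> range (chart_pt \<theta> \<kappa> d z)) = (q \<in> fiber_dom \<theta> \<kappa> z c d)"
  proof -
    have "chart_pt \<theta> \<kappa> c z q \<in> range (chart_pt \<theta> \<kappa> d z) \<longleftrightarrow>
        total_pt \<theta> \<kappa> c (emb3 z q) \<in> range (total_pt \<theta> \<kappa> d)"
    proof
      assume "chart_pt \<theta> \<kappa> c z q \<in> range (chart_pt \<theta> \<kappa> d z)"
      then obtain p where "chart_pt \<theta> \<kappa> c z q = chart_pt \<theta> \<kappa> d z p" by blast
      then have "total_pt \<theta> \<kappa> c (emb3 z q) = total_pt \<theta> \<kappa> d (emb3 z p)" by simp
      then show "total_pt \<theta> \<kappa> c (emb3 z q) \<in> range (total_pt \<theta> \<kappa> d)" by (metis rangeI)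
    next
      assume "total_pt \<theta> \<kappa> c (emb3 z q) \<in> range (total_pt \<theta> \<kappa> d)"
      then obtain p where p: "total_pt \<theta> \<kappa> c (emb3 z q) = total_pt \<theta> \<kappa> d p" by blast
      have "p = emb3 (p $ 3) (proj2 p)" by simp
      then have "chart_pt \<theta> \<kappa> c z q = chart_pt \<theta> \<kappa> d z (proj2 p)"
        using p by (metis total_pt_emb3 prod.inject)
      then show "chart_pt \<theta> \<kappa> c z q \<in> range (chart_pt \<theta> \<kappa> d z)" by simp
    qed
    then show ?thesis unfolding total_pt_in_range_iff fiber_dom_def by simp
  qed
  show "chart_pt \<theta> \<kappa> d z (fiber_tr \<theta> \<kappa> z c d q) = chart_pt \<theta> \<kappa> c z q" if "q \<in> fiber_dom \<theta> \<kappa> z c d"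
    using total_pt_total_tr[of "emb3 z q" \<theta> \<kappa> c d] that by (simp add: fiber_dom_def total_tr_emb3)
  show "\<exists>U V. open U \<and> open V \<and> p \<in> U \<and> q \<in> V \<and> chart_pt \<theta> \<kappa> c z ` U \<inter> chart_pt \<theta> \<kappa> d z ` V = {}"
    if "chart_pt \<theta> \<kappa> c z p \<noteq> chart_pt \<theta> \<kappa> d z q"
  proof -
    have ne: "total_pt \<theta> \<kappa> c (emb3 z p) \<noteq> total_pt \<theta> \<kappa> d (emb3 z q)" using that by simp
    obtain U V where UV: "open U" "open V" "emb3 z p \<in> U" "emb3 z q \<in> V" "total_pt \<theta> \<kappa> c ` U \<inter> total_pt \<theta> \<kappa> d ` V = {}"
      using total_pt_separated[OF ne] by blast
    have "chart_pt \<theta> \<kappa> c z ` (emb3 z -` U) \<inter> chart_pt \<theta> \<kappa> d z ` (emb3 z -` V) = {}"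
    proof (rule ccontr)
      assume "chart_pt \<theta> \<kappa> c z ` (emb3 z -` U) \<inter> chart_pt \<theta> \<kappa> d z ` (emb3 z -` V) \<noteq> {}"
      then obtain p' q' where "emb3 z p' \<in> U" "emb3 z q' \<in> V" "chart_pt \<theta> \<kappa> c z p' = chart_pt \<theta> \<kappa> d z q'" by blast
      then have "total_pt \<theta> \<kappa> c (emb3 z p') = total_pt \<theta> \<kappa> d (emb3 z q')" by simp
      then show False using UV(5) \<open>emb3 z p' \<in> U\<close> \<open>emb3 z q' \<in> V\<close> by blast
    qed
    moreover have "open (emb3 z -` U)" "open (emb3 z -` V)"
      using UV by (auto intro!: open_vimage continuous_on_emb3)
    ultimately show ?thesis using UV by (intro exI[of _ "emb3 z -` U"] exI[of _ "emb3 z -` V"]) simp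
  qed
qed

lemma complex_manifold_P: "complex_manifold (P_space \<theta> \<kappa>) (P_atlas \<theta> \<kappa>)"
proof -
  interpret glued_charts "total_pt \<theta> \<kappa>" "total_dom \<theta> \<kappa>" "total_tr \<theta> \<kappa>" by (rule total_glued_charts)
  show ?thesis using complex_manifold_glued unfolding glued_space_def glued_atlas_def P_space_def P_atlas_def .
qed

lemma complex_manifold_E: "complex_manifold (E_space \<theta> \<kappa> z) (E_atlas \<theta> \<kappa> z)"
proof -
  interpret glued_charts "\<lambda>c. chart_pt \<theta> \<kappa> c z" "fiber_dom \<theta> \<kappa> z" "fiber_tr \<theta> \<kappa> z" by (rule fiber_glued_charts)
  show ?thesis using complex_manifold_glued unfolding glued_space_def glued_atlas_def E_space_def E_atlas_def .
qed

section \<open>Fibers embedded in the total space\<close>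

lemma P_space_eq: "P_space \<theta> \<kappa> = glued_charts.glued_space (total_pt \<theta> \<kappa>)"
  using glued_charts.glued_space_def[OF total_glued_charts] by (simp add: P_space_def)

lemma E_space_eq: "E_space \<theta> \<kappa> z = glued_charts.glued_space (\<lambda>c. chart_pt \<theta> \<kappa> c z)"
  using glued_charts.glued_space_def[OF fiber_glued_charts] by (simp add: E_space_def)

lemmas topspace_P_space = glued_charts.topspace_glued_space[OF total_glued_charts, folded P_space_eq]
lemmas topspace_E_space = glued_charts.topspace_glued_space[OF fiber_glued_charts, folded E_space_eq]
lemmas openin_P_space = glued_charts.openin_glued_space[OF total_glued_charts, folded P_space_eq]
lemmas openin_E_space = glued_charts.openin_glued_space[OF fiber_glued_charts, folded E_space_eq]

lemma range_total_pt: "range (total_pt \<theta> \<kappa> c) = {(p, z). p \<in> range (chart_pt \<theta> \<kappa> c z)}"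
proof (intro set_eqI iffI)
  fix s assume "s \<in> range (total_pt \<theta> \<kappa> c)"
  then obtain q where "s = total_pt \<theta> \<kappa> c (emb3 (q $ 3) (proj2 q))" by auto
  then show "s \<in> {(p, z). p \<in> range (chart_pt \<theta> \<kappa> c z)}" unfolding total_pt_emb3 by auto
next
  fix s assume "s \<in> {(p, z). p \<in> range (chart_pt \<theta> \<kappa> c z)}"
  then obtain p z where "s = total_pt \<theta> \<kappa> c (emb3 z p)" unfolding total_pt_emb3 by auto
  then show "s \<in> range (total_pt \<theta> \<kappa> c)" by blast
qed

lemma embedding_fiber: "embedding_map (E_space \<theta> \<kappa> z) (P_space \<theta> \<kappa>) (\<lambda>p. (p, z))"
  unfolding embedding_map_def
proof (rule bijective_open_imp_homeomorphic_map)
  have sub: "(\<lambda>p. (p, z)) ` topspace (E_space \<theta> \<kappa> z) \<subseteq> topspace (P_space \<theta> \<kappa>)"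
    unfolding topspace_P_space topspace_E_space range_total_pt by auto
  show "continuous_map (E_space \<theta> \<kappa> z) (subtopology (P_space \<theta> \<kappa>) ((\<lambda>p. (p, z)) ` topspace (E_space \<theta> \<kappa> z))) (\<lambda>p. (p, z))"
    unfolding continuous_map_in_subtopology
  proof (intro conjI)
    show "continuous_map (E_space \<theta> \<kappa> z) (P_space \<theta> \<kappa>) (\<lambda>p. (p, z))"
      unfolding continuous_map_def
    proof (intro conjI allI impI)
      show "(\<lambda>p. (p, z)) \<in> topspace (E_space \<theta> \<kappa> z) \<rightarrow> topspace (P_space \<theta> \<kappa>)" using sub by auto
      fix U assume U: "openin (P_space \<theta> \<kappa>) U"
      have "chart_pt \<theta> \<kappa> c z -` {p \<in> topspace (E_space \<theta> \<kappa> z). (p, z) \<in> U} = emb3 z -` (total_pt \<theta> \<kappa> c -` U)" for c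
        unfolding topspace_E_space by auto
      moreover have "open (emb3 z -` (total_pt \<theta> \<kappa> c -` U))" for c
        using U by (intro open_vimage continuous_on_emb3) (simp add: openin_P_space)
      ultimately show "openin (E_space \<theta> \<kappa> z) {p \<in> topspace (E_space \<theta> \<kappa> z). (p, z) \<in> U}"
        unfolding openin_E_space by (auto simp: topspace_E_space)
    qed
  qed auto
  show "open_map (E_space \<theta> \<kappa> z) (subtopology (P_space \<theta> \<kappa>) ((\<lambda>p. (p, z)) ` topspace (E_space \<theta> \<kappa> z))) (\<lambda>p. (p, z))"
    unfolding open_map_def openin_subtopology
  proof (intro allI impI)
    fix W assume W: "openin (E_space \<theta> \<kappa> z) W"
    \<comment> \<open>\<open>W\<close> is thickened by keeping its chart coordinates and letting the
      time vary, separately in each chart. Only the slice at \<open>z\<close> matters, and there the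
      union is \<open>W\<close> again.\<close>
    define U where "U = (\<Union>c. total_pt \<theta> \<kappa> c ` {q. proj2 q \<in> chart_pt \<theta> \<kappa> c z -` W})"
    have "open {q. proj2 q \<in> chart_pt \<theta> \<kappa> c z -` W}" for c
    proof -
      have "continuous_on UNIV proj2"
        unfolding proj2_def[abs_def]
        by (rule has_derivative_continuous_on[where f' = "\<lambda>_ v. vector [v $ 1, v $ 2]"])
           (intro has_derivative_vector2 bounded_linear_imp_has_derivative bounded_linear_vec_nth)
      moreover have "open (chart_pt \<theta> \<kappa> c z -` W)" using W by (simp add: openin_E_space)
      ultimately have "open (proj2 -` (chart_pt \<theta> \<kappa> c z -` W))" by (intro open_vimage)
      then show ?thesis by (simp add: vimage_def)
    qed
    then have "openin (P_space \<theta> \<kappa>) U"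
      unfolding U_def P_space_eq
      by (intro openin_clauses(3)) (auto intro: glued_charts.open_chart_image[OF total_glued_charts])
    moreover have "(\<lambda>p. (p, z)) ` W = U \<inter> (\<lambda>p. (p, z)) ` topspace (E_space \<theta> \<kappa> z)"
    proof (intro set_eqI iffI)
      fix s assume "s \<in> (\<lambda>p. (p, z)) ` W"
      then obtain p where p: "p \<in> W" "s = (p, z)" by blast
      then have "p \<in> topspace (E_space \<theta> \<kappa> z)" using openin_subset[OF W] by blast
      moreover from this obtain c v where "p = chart_pt \<theta> \<kappa> c z v" unfolding topspace_E_space by blast
      then have "s = total_pt \<theta> \<kappa> c (emb3 z v)" "proj2 (emb3 z v) \<in> chart_pt \<theta> \<kappa> c z -` W" using p by auto
      then have "s \<in> U" unfolding U_def by blast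
      ultimately show "s \<in> U \<inter> (\<lambda>p. (p, z)) ` topspace (E_space \<theta> \<kappa> z)" using p by blast
    next
      fix s assume "s \<in> U \<inter> (\<lambda>p. (p, z)) ` topspace (E_space \<theta> \<kappa> z)"
      then obtain c q p where q: "s = total_pt \<theta> \<kappa> c q" "chart_pt \<theta> \<kappa> c z (proj2 q) \<in> W" "s = (p, z)"
        unfolding U_def by auto
      have "s = (chart_pt \<theta> \<kappa> c (q $ 3) (proj2 q), q $ 3)" using q(1) total_pt_emb3[of \<theta> \<kappa> c "q $ 3" "proj2 q"] by simp
      then show "s \<in> (\<lambda>p. (p, z)) ` W" using q by auto
    qed
    ultimately show "\<exists>T. openin (P_space \<theta> \<kappa>) T \<and> (\<lambda>p. (p, z)) ` W = T \<inter> (\<lambda>p. (p, z)) ` topspace (E_space \<theta> \<kappa> z)"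
      by blast
  qed
  show "(\<lambda>p. (p, z)) ` topspace (E_space \<theta> \<kappa> z) =
      topspace (subtopology (P_space \<theta> \<kappa>) ((\<lambda>p. (p, z)) ` topspace (E_space \<theta> \<kappa> z)))"
    using sub by auto
qed (simp add: inj_on_def)

section \<open>Local triviality of the bundle\<close>

definition shear_cutoff :: "complex \<Rightarrow> complex \<Rightarrow> complex" where
  "shear_cutoff x y = of_real (max 0 (min 1 (norm x - 2 * norm (y - x) - 1)))"

text \<open>Only the gluing (b) depends on \<open>z\<close>. The shear by \<open>2 * (z - z0)\<close> is applied in full near the
  curve at infinity of that chart and not at all near the other two.\<close>

definition shear :: "complex \<Rightarrow> complex^2 \<Rightarrow> complex^2" where
  "shear \<tau> p = vector [p $ 1, p $ 2 + \<tau> * shear_cutoff (p $ 1) (p $ 2)]"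

text \<open>Clamping does not increase distances, and the clamped quantity has slope at most 2 in
  \<open>y\<close>. The cutoff is 1 where \<open>norm x \<ge> 2 * norm (y - x) + 2\<close> and 0
  where \<open>norm x \<le> 2 * norm (y - x) + 1\<close>.\<close>

lemma shear_cutoff_lipschitz: "norm (shear_cutoff x y - shear_cutoff x y') \<le> 2 * norm (y - y')"
proof -
  have "\<bar>max 0 (min 1 s) - max 0 (min 1 t)\<bar> \<le> \<bar>s - t\<bar>" for s t :: real by linarith
  then have "\<bar>max 0 (min 1 (norm x - 2 * norm (y - x) - 1)) - max 0 (min 1 (norm x - 2 * norm (y' - x) - 1))\<bar>
      \<le> \<bar>(norm x - 2 * norm (y - x) - 1) - (norm x - 2 * norm (y' - x) - 1)\<bar>" .
  also have "\<dots> \<le> 2 * norm (y - y')"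
    using norm_triangle_ineq3[of "y - x" "y' - x"] by simp
  finally show ?thesis unfolding shear_cutoff_def by (simp flip: of_real_diff)
qed

text \<open>Solving for \<open>y\<close> is a fixed-point problem with contraction constant
  \<open>1/4 * 2 = 1/2\<close>. The bound \<open>1/4\<close> explains the discs of radius
  \<open>1/8\<close> below: the shear parameter there is \<open>2 * (z - z0)\<close>.\<close>

lemma shear_bijective:
  assumes "norm \<tau> \<le> 1 / 4"
  shows "\<exists>!p. shear \<tau> p = q"
proof -
  have "\<exists>!y. q $ 2 - \<tau> * shear_cutoff (q $ 1) y = y"
  proof (rule banach_fix_type[of "1/2"])
    show "\<forall>y y'. dist (q $ 2 - \<tau> * shear_cutoff (q $ 1) y) (q $ 2 - \<tau> * shear_cutoff (q $ 1) y') \<le> 1/2 * dist y y'"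
    proof (intro allI)
      fix y y'
      have "(q $ 2 - \<tau> * shear_cutoff (q $ 1) y) - (q $ 2 - \<tau> * shear_cutoff (q $ 1) y') =
          \<tau> * (shear_cutoff (q $ 1) y' - shear_cutoff (q $ 1) y)" by (simp add: algebra_simps)
      then have "dist (q $ 2 - \<tau> * shear_cutoff (q $ 1) y) (q $ 2 - \<tau> * shear_cutoff (q $ 1) y') =
          norm \<tau> * norm (shear_cutoff (q $ 1) y' - shear_cutoff (q $ 1) y)"
        by (simp add: dist_norm norm_mult)
      also have "\<dots> \<le> (1 / 4) * (2 * norm (y' - y))"
        using assms shear_cutoff_lipschitz by (intro mult_mono) auto
      finally show "dist (q $ 2 - \<tau> * shear_cutoff (q $ 1) y) (q $ 2 - \<tau> * shear_cutoff (q $ 1) y') \<le> 1/2 * dist y y'"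
        by (simp add: dist_norm norm_minus_commute)
    qed
  qed auto
  then obtain y where y: "q $ 2 - \<tau> * shear_cutoff (q $ 1) y = y"
    "\<And>y'. q $ 2 - \<tau> * shear_cutoff (q $ 1) y' = y' \<Longrightarrow> y' = y" by blast
  show ?thesis
  proof (rule ex1I[of _ "vector [q $ 1, y]"])
    show "shear \<tau> (vector [q $ 1, y]) = q"
      using y(1) by (simp add: shear_def vec2_eq_iff algebra_simps)
    fix p assume "shear \<tau> p = q"
    then have p1: "p $ 1 = q $ 1" and "p $ 2 + \<tau> * shear_cutoff (q $ 1) (p $ 2) = q $ 2"
      by (auto simp: shear_def vec2_eq_iff)
    then have "q $ 2 - \<tau> * shear_cutoff (q $ 1) (p $ 2) = p $ 2" by (metis add_diff_cancel_right')
    then show "p = vector [q $ 1, y]" using y(2) p1 by (simp add: vec2_eq_iff)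
  qed
qed

lemma shear_near_divisor:
  assumes "p \<in> near_divisor c" "c \<noteq> UW6"
  shows "shear \<tau> p = p"
proof -
  have "norm (p $ 1) \<le> norm (p $ 2) + norm (p $ 2 - p $ 1)" "norm (p $ 2) \<le> norm (p $ 1) + norm (p $ 2 - p $ 1)"
    using norm_triangle_sub[of "p $ 1" "p $ 2"] norm_triangle_sub[of "p $ 2" "p $ 1"]
    by (simp_all add: norm_minus_commute)
  moreover have "norm (p $ 1) \<ge> 0" "norm (p $ 2) \<ge> 0" by simp_all
  ultimately have "norm (p $ 1) - 2 * norm (p $ 2 - p $ 1) - 1 \<le> 0"
    using assms unfolding near_divisor_def
    by (cases c; simp only: mem_Collect_eq chart.case simp_thms; linarith)
  then have "shear_cutoff (p $ 1) (p $ 2) = 0" by (simp add: shear_cutoff_def)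
  then show ?thesis by (simp add: shear_def vec2_eta)
qed

text \<open>Changing \<open>z\<close> to \<open>z0\<close> at fixed \<open>(u, w)\<close> moves
  \<open>y\<close> by \<open>2 * (z - z0)\<close>, and the smallness assumption places the point
  where the cutoff is 1.\<close>

lemma shear_to_xy_UW6:
  assumes "p $ 2 \<noteq> 0" and small: "norm (p $ 2) * (2 * norm (p $ 1 * (p $ 2)^2 - 2 * z - 2 * (\<kappa> - \<theta> - 1) * p $ 2) + 2) < 1"
  shows "shear (2 * (z - z0)) (to_xy \<theta> \<kappa> UW6 z p) = to_xy \<theta> \<kappa> UW6 z0 p"
proof -
  let ?s = "p $ 1 * (p $ 2)^2 - 2 * z - 2 * (\<kappa> - \<theta> - 1) * p $ 2"
  have "2 * norm ?s + 2 \<le> norm (1 / p $ 2)"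
    using small assms(1) by (simp add: norm_divide field_simps)
  then have "shear_cutoff (1 / p $ 2) (1 / p $ 2 + ?s) = 1" by (simp add: shear_cutoff_def)
  moreover have "1 / p $ 2 + ?s = 1 / p $ 2 + p $ 1 * (p $ 2)^2 - 2 * z - 2 * (\<kappa> - \<theta> - 1) * p $ 2" by simp
  ultimately have cut: "shear_cutoff (1 / p $ 2) (1 / p $ 2 + p $ 1 * (p $ 2)^2 - 2 * z - 2 * (\<kappa> - \<theta> - 1) * p $ 2) = 1"
    by metis
  show ?thesis
    unfolding shear_def to_xy_def Let_def chart.case vector_2 cut by (simp add: vec2_eq_iff)
qed

lemma continuous_on_vec:
  assumes "\<And>k. continuous_on S (\<lambda>q. f q $ k)"
  shows "continuous_on S f"
  using assms unfolding continuous_on_def by (blast intro: vec_tendstoI)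

text \<open>Finite points are carried to the fiber over \<open>z0\<close> by the shear in
  \<open>(x, y)\<close>, points at infinity by keeping \<open>(u, w)\<close>. Near a curve at
  infinity the two rules agree, since the shear there makes up exactly for the change of the
  gluing.\<close>

definition triv_point :: "complex \<Rightarrow> complex \<Rightarrow> complex \<Rightarrow> chart \<Rightarrow> complex^3 \<Rightarrow> complex \<times> (chart \<times> (complex^2)) set" where
  "triv_point \<theta> \<kappa> z0 c q = (q $ 3, if proj2 q \<in> chart_dom c
     then chart_pt \<theta> \<kappa> XY z0 (shear (2 * (q $ 3 - z0)) (to_xy \<theta> \<kappa> c (q $ 3) (proj2 q)))
     else chart_pt \<theta> \<kappa> c z0 (proj2 q))"

text \<open>In suitable charts the trivialization is an injective continuous map between open subsets of
  \<open>complex^3\<close>, hence open by invariance of domain.\<close>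

lemma triv_point_local:
  assumes "q0 $ 3 \<in> ball z0 (1/8)"
  shows "\<exists>A d \<psi>. open A \<and> q0 \<in> A \<and> A \<subseteq> {q. q $ 3 \<in> ball z0 (1/8)} \<and> continuous_on A \<psi> \<and> inj_on \<psi> A \<and>
    (\<forall>q\<in>A. \<psi> q $ 3 = q $ 3 \<and> triv_point \<theta> \<kappa> z0 c q = (q $ 3, chart_pt \<theta> \<kappa> d z0 (proj2 (\<psi> q))))"
proof (cases "proj2 q0 \<in> chart_dom c")
  case True
  define A where "A = {q. proj2 q \<in> chart_dom c} \<inter> {q :: complex^3. q $ 3 \<in> ball z0 (1/8)}"
  define \<psi> where "\<psi> q = emb3 (q $ 3) (shear (2 * (q $ 3 - z0)) (to_xy \<theta> \<kappa> c (q $ 3) (proj2 q)))" for q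
  have oN: "open {q :: complex^3. q $ 3 \<in> ball z0 (1/8)}"
    using open_vimage[of "ball z0 (1/8)" "\<lambda>q :: complex^3. q $ 3"]
    by (simp add: vimage_def continuous_on_component)
  have "{q. proj2 q \<in> chart_dom c} = total_dom \<theta> \<kappa> c XY"
    by (auto simp: total_dom_def xy_image_def chart_dom_def)
  then have oA: "open A" unfolding A_def using open_total_dom[of \<theta> \<kappa> c XY] oN by auto
  have c: "continuous_on A (\<lambda>q. to_xy \<theta> \<kappa> c (q $ 3) (proj2 q) $ k)" for k
    by (rule holomorphic_fun_on_imp_continuous_on[OF holomorphic_fun_on_subset[OF holomorphic_to_xy]]) (auto simp: A_def)
  have cont: "continuous_on A \<psi>"
  proof (rule continuous_on_vec)
    fix k :: 3
    consider "k = 1" | "k = 2" | "k = 3" using exhaust_3[of k] by blast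
    then show "continuous_on A (\<lambda>q. \<psi> q $ k)"
    proof cases
      case 1
      then show ?thesis using c[of 1] by (simp add: \<psi>_def shear_def)
    next
      case 2
      show ?thesis unfolding 2 \<psi>_def shear_def shear_cutoff_def proj2_emb3 vector_2
        by (intro continuous_intros c)
    next
      case 3
      then show ?thesis by (simp add: \<psi>_def continuous_intros)
    qed
  qed
  have inj: "inj_on \<psi> A"
  proof (rule inj_onI)
    fix p q assume pq: "p \<in> A" "q \<in> A" "\<psi> p = \<psi> q"
    then have z: "p $ 3 = q $ 3" and s: "shear (2 * (q $ 3 - z0)) (to_xy \<theta> \<kappa> c (q $ 3) (proj2 p)) =
        shear (2 * (q $ 3 - z0)) (to_xy \<theta> \<kappa> c (q $ 3) (proj2 q))"
      by (auto simp: \<psi>_def emb3_eq_iff)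
    have "norm (q $ 3 - z0) \<le> 1 / 8" using pq(2) by (auto simp: A_def dist_norm norm_minus_commute)
    moreover have "norm (2 * (q $ 3 - z0)) = 2 * norm (q $ 3 - z0)" unfolding norm_mult by simp
    ultimately have "norm (2 * (q $ 3 - z0)) \<le> 1 / 4" by simp
    then have "to_xy \<theta> \<kappa> c (q $ 3) (proj2 p) = to_xy \<theta> \<kappa> c (q $ 3) (proj2 q)"
      using shear_bijective s by metis
    moreover have "proj2 p \<in> chart_dom c" "proj2 q \<in> chart_dom c" using pq by (auto simp: A_def)
    ultimately have "proj2 p = proj2 q" using from_xy_to_xy(2) by metis
    with z show "p = q" by (metis proj2_emb3(5))
  qed
  have "\<forall>q\<in>A. \<psi> q $ 3 = q $ 3 \<and> triv_point \<theta> \<kappa> z0 c q = (q $ 3, chart_pt \<theta> \<kappa> XY z0 (proj2 (\<psi> q)))"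
    by (simp add: A_def triv_point_def \<psi>_def)
  moreover have "q0 \<in> A" using True assms by (simp add: A_def)
  moreover have "A \<subseteq> {q. q $ 3 \<in> ball z0 (1/8)}" by (auto simp: A_def)
  ultimately show ?thesis using oA cont inj by blast
next
  case False
  then have c: "c \<noteq> XY" "q0 $ 2 = 0" by (auto simp: chart_dom_def)
  \<comment> \<open>On this neighbourhood of a point at infinity the shear is trivial for (a) and
    (c) and complete for (b), so in the chart \<open>c\<close> the trivialization keeps
    \<open>(u, w)\<close>.\<close>
  define A where "A = {q. norm (divisor_fun \<theta> \<kappa> c q) < 1 / 2} \<inter> {q :: complex^3. q $ 3 \<in> ball z0 (1/8)} \<inter>
    {q. norm (q $ 2) * (2 * norm (q $ 1 * (q $ 2)^2 - 2 * q $ 3 - 2 * (\<kappa> - \<theta> - 1) * q $ 2) + 2) < 1}"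
  have oN: "open {q :: complex^3. q $ 3 \<in> ball z0 (1/8)}"
    using open_vimage[of "ball z0 (1/8)" "\<lambda>q :: complex^3. q $ 3"]
    by (simp add: vimage_def continuous_on_component)
  have "open {q :: complex^3. norm (q $ 2) * (2 * norm (q $ 1 * (q $ 2)^2 - 2 * q $ 3 - 2 * (\<kappa> - \<theta> - 1) * q $ 2) + 2) < 1}"
    by (intro open_Collect_less continuous_intros)
  then have oA: "open A" unfolding A_def by (intro open_Int open_near_divisor oN)
  have "triv_point \<theta> \<kappa> z0 c q = (q $ 3, chart_pt \<theta> \<kappa> c z0 (proj2 q))" if q: "q \<in> A" for q
  proof (cases "proj2 q \<in> chart_dom c")
    case True
    then have w: "q $ 2 \<noteq> 0" using c by (simp add: chart_dom_def)
    have "shear (2 * (q $ 3 - z0)) (to_xy \<theta> \<kappa> c (q $ 3) (proj2 q)) = to_xy \<theta> \<kappa> c z0 (proj2 q)"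
    proof (cases "c = UW6")
      case True
      then show ?thesis using shear_to_xy_UW6[of "proj2 q" "q $ 3" \<kappa> \<theta> z0] w q by (simp add: A_def)
    next
      case n6: False
      then have "to_xy \<theta> \<kappa> c z0 (proj2 q) = to_xy \<theta> \<kappa> c (q $ 3) (proj2 q)"
        using c by (cases c) (simp_all add: to_xy_def)
      then show ?thesis using shear_near_divisor[OF to_xy_near_divisor n6] c w q by (simp add: A_def)
    qed
    then show ?thesis using True by (simp add: triv_point_def chart_pt_eq_iff chart_dom_def)
  qed (simp add: triv_point_def)
  moreover have "q0 \<in> A" using c assms by (cases c) (simp_all add: A_def divisor_fun_def)
  moreover have "A \<subseteq> {q. q $ 3 \<in> ball z0 (1/8)}" by (auto simp: A_def)
  ultimately show ?thesis using oA by (intro exI[of _ A] exI[of _ c] exI[of _ "\<lambda>q. q"]) auto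
qed

lemma continuous_triv_target:
  "continuous_map euclidean (prod_topology euclidean (E_space \<theta> \<kappa> z0)) (\<lambda>q. (q $ 3, chart_pt \<theta> \<kappa> d z0 (proj2 q)))"
proof (rule continuous_map_pairedI)
  show "continuous_map euclidean euclidean (\<lambda>q :: complex^3. q $ 3)" by (simp add: continuous_intros)
  have "continuous_on UNIV proj2"
    unfolding proj2_def[abs_def]
    by (rule has_derivative_continuous_on[where f' = "\<lambda>_ v. vector [v $ 1, v $ 2]"])
       (intro has_derivative_vector2 bounded_linear_imp_has_derivative bounded_linear_vec_nth)
  then have "continuous_map euclidean euclidean proj2" by simp
  from continuous_map_compose[OF this glued_charts.continuous_map_chart[OF fiber_glued_charts]]
  show "continuous_map euclidean (E_space \<theta> \<kappa> z0) (\<lambda>q. chart_pt \<theta> \<kappa> d z0 (proj2 q))"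
    unfolding E_space_eq by (simp add: o_def)
qed

lemma open_triv_target:
  assumes "open B"
  shows "openin (prod_topology euclidean (E_space \<theta> \<kappa> z0)) ((\<lambda>q. (q $ 3, chart_pt \<theta> \<kappa> d z0 (proj2 q))) ` B)"
  unfolding openin_prod_topology_alt
proof (intro allI impI)
  fix z a assume "(z, a) \<in> (\<lambda>q. (q $ 3, chart_pt \<theta> \<kappa> d z0 (proj2 q))) ` B"
  then obtain q where q: "q \<in> B" "z = q $ 3" "a = chart_pt \<theta> \<kappa> d z0 (proj2 q)" by blast
  have "continuous_on UNIV (\<lambda>x. emb3 (fst x) (snd x))"
  proof (rule continuous_on_vec)
    fix k :: 3
    consider "k = 1" | "k = 2" | "k = 3" using exhaust_3[of k] by blast
    then show "continuous_on UNIV (\<lambda>x. emb3 (fst x) (snd x) $ k)"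
      by cases (simp_all add: continuous_intros)
  qed
  then have "open ((\<lambda>x. emb3 (fst x) (snd x)) -` B)" using assms by (intro open_vimage)
  moreover have "(z, proj2 q) \<in> (\<lambda>x. emb3 (fst x) (snd x)) -` B" using q by simp
  ultimately obtain U V where UV: "open U" "open V" "(z, proj2 q) \<in> U \<times> V" "U \<times> V \<subseteq> (\<lambda>x. emb3 (fst x) (snd x)) -` B"
    by (rule open_prod_elim)
  have "openin (E_space \<theta> \<kappa> z0) (chart_pt \<theta> \<kappa> d z0 ` V)"
    unfolding E_space_eq by (rule glued_charts.open_chart_image[OF fiber_glued_charts UV(2)])
  moreover have "U \<times> chart_pt \<theta> \<kappa> d z0 ` V \<subseteq> (\<lambda>q. (q $ 3, chart_pt \<theta> \<kappa> d z0 (proj2 q))) ` B"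
  proof
    fix s assume "s \<in> U \<times> chart_pt \<theta> \<kappa> d z0 ` V"
    then obtain t v where "s = (t, chart_pt \<theta> \<kappa> d z0 v)" "t \<in> U" "v \<in> V" by blast
    then show "s \<in> (\<lambda>q. (q $ 3, chart_pt \<theta> \<kappa> d z0 (proj2 q))) ` B"
      using UV(4) by (intro image_eqI[where x = "emb3 t v"]) auto
  qed
  ultimately show "\<exists>U V. openin euclidean U \<and> openin (E_space \<theta> \<kappa> z0) V \<and> z \<in> U \<and> a \<in> V \<and>
      U \<times> V \<subseteq> (\<lambda>q. (q $ 3, chart_pt \<theta> \<kappa> d z0 (proj2 q))) ` B"
    using UV(1,3) q(3) by (intro exI[of _ U] exI[of _ "chart_pt \<theta> \<kappa> d z0 ` V"]) auto
qed

text \<open>One direction makes the trivialization well defined on the glued space, the other makes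
  it injective.\<close>

lemma triv_point_eq_iff:
  assumes "p $ 3 \<in> ball z0 (1/8)"
  shows "triv_point \<theta> \<kappa> z0 c p = triv_point \<theta> \<kappa> z0 d q \<longleftrightarrow> total_pt \<theta> \<kappa> c p = total_pt \<theta> \<kappa> d q"
proof (cases "p $ 3 = q $ 3")
  case z: True
  have "norm (p $ 3 - z0) < 1 / 8" using assms by (simp add: dist_norm norm_minus_commute)
  moreover have "norm (2 * (p $ 3 - z0)) = 2 * norm (p $ 3 - z0)" unfolding norm_mult by simp
  ultimately have \<tau>: "norm (2 * (p $ 3 - z0)) \<le> 1 / 4" by simp
  have s: "shear (2 * (p $ 3 - z0)) a = shear (2 * (p $ 3 - z0)) b \<longleftrightarrow> a = b" for a b
    using shear_bijective[OF \<tau>] by metis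
  have XY: "v \<in> chart_dom XY" for v by (simp add: chart_dom_def)
  show ?thesis
    unfolding triv_point_def total_pt_eq_iff chart_pt_eq_iff prod.inject z[symmetric]
  proof (cases "proj2 p \<in> chart_dom c"; cases "proj2 q \<in> chart_dom d")
    assume "proj2 p \<in> chart_dom c" "proj2 q \<in> chart_dom d"
    then show "(p $ 3 = p $ 3 \<and>
     (if proj2 p \<in> chart_dom c then chart_pt \<theta> \<kappa> XY z0 (shear (2 * (p $ 3 - z0)) (to_xy \<theta> \<kappa> c (p $ 3) (proj2 p)))
      else chart_pt \<theta> \<kappa> c z0 (proj2 p)) =
     (if proj2 q \<in> chart_dom d then chart_pt \<theta> \<kappa> XY z0 (shear (2 * (p $ 3 - z0)) (to_xy \<theta> \<kappa> d (p $ 3) (proj2 q)))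
      else chart_pt \<theta> \<kappa> d z0 (proj2 q))) =
    (p $ 3 = p $ 3 \<and>
     (c = d \<and> proj2 p = proj2 q \<or>
      proj2 p \<in> chart_dom c \<and> proj2 q \<in> chart_dom d \<and>
      to_xy \<theta> \<kappa> c (p $ 3) (proj2 p) = to_xy \<theta> \<kappa> d (p $ 3) (proj2 q)))"
      using XY s by (auto simp: chart_pt_eq_iff)
  qed (use XY in \<open>auto simp: chart_pt_eq_iff\<close>)
qed (auto simp: triv_point_def total_pt_eq_iff)

definition trivialization ::
    "complex \<Rightarrow> complex \<Rightarrow> complex \<Rightarrow> (chart \<times> (complex^2)) set \<times> complex \<Rightarrow> complex \<times> (chart \<times> (complex^2)) set" where
  "trivialization \<theta> \<kappa> z0 s =
     (let r = SOME r. total_pt \<theta> \<kappa> (fst r) (snd r) = s in triv_point \<theta> \<kappa> z0 (fst r) (snd r))"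

lemma trivialization_total_pt:
  assumes "q $ 3 \<in> ball z0 (1/8)"
  shows "trivialization \<theta> \<kappa> z0 (total_pt \<theta> \<kappa> c q) = triv_point \<theta> \<kappa> z0 c q"
proof -
  define r where "r = (SOME r. total_pt \<theta> \<kappa> (fst r) (snd r) = total_pt \<theta> \<kappa> c q)"
  have "total_pt \<theta> \<kappa> (fst r) (snd r) = total_pt \<theta> \<kappa> c q"
    unfolding r_def by (rule someI[of _ "(c, q)"]) simp
  then have "triv_point \<theta> \<kappa> z0 c q = triv_point \<theta> \<kappa> z0 (fst r) (snd r)"
    using triv_point_eq_iff[OF assms] by metis
  then show ?thesis by (simp add: trivialization_def r_def Let_def)
qed

lemma snd_total_pt: "snd (total_pt \<theta> \<kappa> c q) = q $ 3"
  by (simp add: total_pt_def)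

lemma trivialization_homeomorphism:
  "homeomorphic_map (subtopology (P_space \<theta> \<kappa>) {s \<in> topspace (P_space \<theta> \<kappa>). snd s \<in> ball z0 (1/8)})
     (prod_topology (top_of_set (ball z0 (1/8))) (E_space \<theta> \<kappa> z0)) (trivialization \<theta> \<kappa> z0)"
proof -
  let ?X = "P_space \<theta> \<kappa>" and ?N = "ball z0 (1/8)" and ?E = "E_space \<theta> \<kappa> z0" and ?h = "trivialization \<theta> \<kappa> z0"
  let ?S = "{s \<in> topspace ?X. snd s \<in> ?N}"
  let ?Y = "prod_topology euclidean ?E"
  let ?G = "\<lambda>d q. (q $ 3, chart_pt \<theta> \<kappa> d z0 (proj2 q))"
  have oN: "open {q :: complex^3. q $ 3 \<in> ?N}"
    using open_vimage[of ?N "\<lambda>q :: complex^3. q $ 3"] by (simp add: vimage_def continuous_on_component)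
  have S: "openin ?X ?S"
    unfolding openin_P_space
  proof (intro conjI allI)
    fix c
    have "total_pt \<theta> \<kappa> c -` ?S = {q. q $ 3 \<in> ?N}" by (auto simp: topspace_P_space snd_total_pt)
    then show "open (total_pt \<theta> \<kappa> c -` ?S)" using oN by simp
  qed (auto simp: topspace_P_space)
  have S_elim: "\<exists>c q. s = total_pt \<theta> \<kappa> c q \<and> q $ 3 \<in> ?N" if s: "s \<in> ?S" for s
  proof -
    obtain c q where cq: "s = total_pt \<theta> \<kappa> c q" using s unfolding topspace_P_space by blast
    then have "q $ 3 \<in> ?N" using s by (simp add: snd_total_pt)
    with cq show ?thesis by blast
  qed
  have Y: "prod_topology (top_of_set ?N) ?E = subtopology ?Y (?N \<times> topspace ?E)"
    by (simp add: subtopology_Times)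
  have oY: "openin ?Y (?N \<times> topspace ?E)" by (simp add: openin_prod_Times_iff)
  have hY: "?h s \<in> ?N \<times> topspace ?E" if s: "s \<in> ?S" for s
  proof -
    obtain c q where cq: "s = total_pt \<theta> \<kappa> c q" "q $ 3 \<in> ?N" using S_elim[OF s] by blast
    then show ?thesis by (auto simp: trivialization_total_pt triv_point_def topspace_E_space)
  qed
  have tX: "topspace (subtopology ?X ?S) = ?S" and tY: "topspace (subtopology ?Y (?N \<times> topspace ?E)) = ?N \<times> topspace ?E"
    by auto
  show ?thesis
    unfolding Y
  proof (rule bijective_open_imp_homeomorphic_map)
    show "continuous_map (subtopology ?X ?S) (subtopology ?Y (?N \<times> topspace ?E)) ?h"
      unfolding continuous_map_def
    proof (intro conjI allI impI)
      show "?h \<in> topspace (subtopology ?X ?S) \<rightarrow> topspace (subtopology ?Y (?N \<times> topspace ?E))"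
        unfolding tX tY using hY by blast
      fix W assume "openin (subtopology ?Y (?N \<times> topspace ?E)) W"
      then have W: "openin ?Y W" "W \<subseteq> ?N \<times> topspace ?E" using openin_open_subtopology[OF oY] by auto
      have "openin ?X {s \<in> ?S. ?h s \<in> W}"
        unfolding openin_P_space
      proof (intro conjI allI)
        fix c
        have eq: "total_pt \<theta> \<kappa> c -` {s \<in> ?S. ?h s \<in> W} = {q. q $ 3 \<in> ?N \<and> triv_point \<theta> \<kappa> z0 c q \<in> W}"
        proof (rule set_eqI)
          fix q
          have "total_pt \<theta> \<kappa> c q \<in> topspace ?X" by (auto simp: topspace_P_space)
          then show "q \<in> total_pt \<theta> \<kappa> c -` {s \<in> ?S. ?h s \<in> W} \<longleftrightarrow> q \<in> {q. q $ 3 \<in> ?N \<and> triv_point \<theta> \<kappa> z0 c q \<in> W}"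
            by (simp add: snd_total_pt trivialization_total_pt cong: conj_cong)
        qed
        show "open (total_pt \<theta> \<kappa> c -` {s \<in> ?S. ?h s \<in> W})"
          unfolding eq
        proof (subst open_subopen, intro ballI)
          fix q0 assume q0: "q0 \<in> {q. q $ 3 \<in> ?N \<and> triv_point \<theta> \<kappa> z0 c q \<in> W}"
          then have "q0 $ 3 \<in> ?N" by simp
          from triv_point_local[OF this, of \<theta> \<kappa> c] obtain A d \<psi> where A: "open A" "q0 \<in> A" "A \<subseteq> {q. q $ 3 \<in> ?N}"
            "continuous_on A \<psi>" "\<And>q. q \<in> A \<Longrightarrow> triv_point \<theta> \<kappa> z0 c q = (q $ 3, chart_pt \<theta> \<kappa> d z0 (proj2 (\<psi> q)))"
            "\<And>q. q \<in> A \<Longrightarrow> \<psi> q $ 3 = q $ 3" by metis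
          have "open {q. ?G d q \<in> W}"
            using openin_continuous_map_preimage[OF continuous_triv_target W(1)] by simp
          then have "open (A \<inter> \<psi> -` {q. ?G d q \<in> W})"
            by (rule continuous_open_preimage[OF A(4,1)])
          moreover have "A \<inter> \<psi> -` {q. ?G d q \<in> W} \<subseteq> {q. q $ 3 \<in> ?N \<and> triv_point \<theta> \<kappa> z0 c q \<in> W}"
            using A(3,5,6) by auto
          moreover have "q0 \<in> A \<inter> \<psi> -` {q. ?G d q \<in> W}" using A(2,5,6) q0 by auto
          ultimately show "\<exists>T. open T \<and> q0 \<in> T \<and> T \<subseteq> {q. q $ 3 \<in> ?N \<and> triv_point \<theta> \<kappa> z0 c q \<in> W}" by blast
        qed
      qed (auto simp: topspace_P_space)
      moreover have "{x \<in> topspace (subtopology ?X ?S). ?h x \<in> W} = {s \<in> ?S. ?h s \<in> W}" by auto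
      ultimately show "openin (subtopology ?X ?S) {x \<in> topspace (subtopology ?X ?S). ?h x \<in> W}"
        unfolding openin_open_subtopology[OF S] by auto
    qed
    show "open_map (subtopology ?X ?S) (subtopology ?Y (?N \<times> topspace ?E)) ?h"
      unfolding open_map_def
    proof (intro allI impI)
      fix U assume "openin (subtopology ?X ?S) U"
      then have U: "openin ?X U" "U \<subseteq> ?S" unfolding openin_open_subtopology[OF S] by auto
      have "openin ?Y (?h ` U)"
      proof (subst openin_subopen, intro ballI)
        fix y assume "y \<in> ?h ` U"
        then obtain s where s: "s \<in> U" "y = ?h s" by blast
        then obtain c q0 where q0: "s = total_pt \<theta> \<kappa> c q0" "q0 $ 3 \<in> ?N" using S_elim U(2) by blast
        from triv_point_local[OF q0(2), of \<theta> \<kappa> c] obtain A d \<psi> where A: "open A" "q0 \<in> A" "A \<subseteq> {q. q $ 3 \<in> ?N}"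
          "continuous_on A \<psi>" "inj_on \<psi> A" "\<And>q. q \<in> A \<Longrightarrow> triv_point \<theta> \<kappa> z0 c q = (q $ 3, chart_pt \<theta> \<kappa> d z0 (proj2 (\<psi> q)))"
          "\<And>q. q \<in> A \<Longrightarrow> \<psi> q $ 3 = q $ 3" by metis
        define B where "B = A \<inter> total_pt \<theta> \<kappa> c -` U"
        have "open B" unfolding B_def using A(1) U(1) by (simp add: openin_P_space open_Int)
        then have "open (\<psi> ` B)"
          using A(4,5) by (intro invariance_of_domain) (auto simp: B_def intro: continuous_on_subset inj_on_subset)
        then have "openin ?Y (?G d ` (\<psi> ` B))" by (rule open_triv_target)
        moreover have G: "?G d (\<psi> q) = ?h (total_pt \<theta> \<kappa> c q)" if "q \<in> B" for q
          using that A(3,6,7) trivialization_total_pt[of q z0 \<theta> \<kappa> c] by (auto simp: B_def)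
        moreover have "q0 \<in> B" using A(2) q0(1) s(1) by (simp add: B_def)
        ultimately show "\<exists>T. openin ?Y T \<and> y \<in> T \<and> T \<subseteq> ?h ` U"
        proof (intro exI[of _ "?G d ` (\<psi> ` B)"] conjI)
          show "y \<in> ?G d ` \<psi> ` B" using G[OF \<open>q0 \<in> B\<close>] s(2) q0(1) \<open>q0 \<in> B\<close> by (metis (no_types, lifting) imageI)
          show "?G d ` \<psi> ` B \<subseteq> ?h ` U"
          proof
            fix x assume "x \<in> ?G d ` \<psi> ` B"
            then obtain q where q: "q \<in> B" "x = ?G d (\<psi> q)" by blast
            then have "x = ?h (total_pt \<theta> \<kappa> c q)" "total_pt \<theta> \<kappa> c q \<in> U" using G by (auto simp: B_def)
            then show "x \<in> ?h ` U" by blast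
          qed
        qed
      qed
      moreover have "?h ` U \<subseteq> ?N \<times> topspace ?E" using hY U(2) by blast
      ultimately show "openin (subtopology ?Y (?N \<times> topspace ?E)) (?h ` U)"
        unfolding openin_open_subtopology[OF oY] by (rule conjI)
    qed
    have "?N \<times> topspace ?E \<subseteq> ?h ` ?S"
    proof
      fix y assume "y \<in> ?N \<times> topspace ?E"
      then obtain z d p where y: "y = (z, chart_pt \<theta> \<kappa> d z0 p)" "z \<in> ?N" by (auto simp: topspace_E_space)
      have "norm (z - z0) < 1 / 8" using y(2) by (simp add: dist_norm norm_minus_commute)
      moreover have "norm (2 * (z - z0)) = 2 * norm (z - z0)" unfolding norm_mult by simp
      ultimately have \<tau>: "norm (2 * (z - z0)) \<le> 1 / 4" by simp
      have "\<exists>c q. q $ 3 = z \<and> triv_point \<theta> \<kappa> z0 c q = y"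
      proof (cases "p \<in> chart_dom d")
        case True
        obtain v where v: "shear (2 * (z - z0)) v = to_xy \<theta> \<kappa> d z0 p" using shear_bijective[OF \<tau>] by metis
        have "triv_point \<theta> \<kappa> z0 XY (emb3 z v) = y"
          using True y(1) by (simp add: triv_point_def chart_dom_def v chart_pt_eq_iff del: right_diff_distrib_numeral)
        then show ?thesis by (intro exI[of _ XY] exI[of _ "emb3 z v"]) simp
      next
        case False
        then show ?thesis by (intro exI[of _ d] exI[of _ "emb3 z p"]) (simp add: triv_point_def y)
      qed
      then obtain c q where cq: "q $ 3 = z" "triv_point \<theta> \<kappa> z0 c q = y" by blast
      then have "?h (total_pt \<theta> \<kappa> c q) = y" using trivialization_total_pt y(2) by metis
      moreover have "total_pt \<theta> \<kappa> c q \<in> ?S" using cq(1) y(2) by (auto simp: topspace_P_space snd_total_pt)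
      ultimately show "y \<in> ?h ` ?S" by blast
    qed
    moreover have "?h ` ?S \<subseteq> ?N \<times> topspace ?E" using hY by blast
    ultimately show "?h ` topspace (subtopology ?X ?S) = topspace (subtopology ?Y (?N \<times> topspace ?E))"
      by auto
    show "inj_on ?h (topspace (subtopology ?X ?S))"
    proof (rule inj_onI)
      fix s t assume st: "s \<in> topspace (subtopology ?X ?S)" "t \<in> topspace (subtopology ?X ?S)" "?h s = ?h t"
      obtain c p where p: "s = total_pt \<theta> \<kappa> c p" "p $ 3 \<in> ?N" using S_elim[of s] st(1) by auto
      obtain d q where q: "t = total_pt \<theta> \<kappa> d q" "q $ 3 \<in> ?N" using S_elim[of t] st(2) by auto
      show "s = t" using st(3) triv_point_eq_iff[OF p(2)] unfolding p(1) q(1) trivialization_total_pt[OF p(2)] trivialization_total_pt[OF q(2)] by metis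
    qed
  qed
qed

lemma manifold_bundle_PIV: "manifold_bundle (E_space \<theta> \<kappa>) (E_atlas \<theta> \<kappa>) (P_space \<theta> \<kappa>) (P_atlas \<theta> \<kappa>)"
  unfolding manifold_bundle_def
proof (intro conjI allI)
  interpret P: glued_charts "total_pt \<theta> \<kappa>" "total_dom \<theta> \<kappa>" "total_tr \<theta> \<kappa>" by (rule total_glued_charts)
  fix z
  interpret E: glued_charts "\<lambda>c. chart_pt \<theta> \<kappa> c z" "fiber_dom \<theta> \<kappa> z" "fiber_tr \<theta> \<kappa> z" by (rule fiber_glued_charts)
  show "complex_manifold (E_space \<theta> \<kappa> z) (E_atlas \<theta> \<kappa> z)" by (rule complex_manifold_E)
  show "embedding_map (E_space \<theta> \<kappa> z) (P_space \<theta> \<kappa>) (\<lambda>p. (p, z))" by (rule embedding_fiber)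
  have "holomorphic_map_on (\<lambda>q. inv (total_pt \<theta> \<kappa> d) (inv_into (range (chart_pt \<theta> \<kappa> c z)) (inv (chart_pt \<theta> \<kappa> c z)) q, z))
      (inv (chart_pt \<theta> \<kappa> c z) ` {p \<in> range (chart_pt \<theta> \<kappa> c z). (p, z) \<in> range (total_pt \<theta> \<kappa> d)})" for c d
  proof -
    have "inv (chart_pt \<theta> \<kappa> c z) ` {p \<in> range (chart_pt \<theta> \<kappa> c z). (p, z) \<in> range (total_pt \<theta> \<kappa> d)} = emb3 z -` total_dom \<theta> \<kappa> c d"
    proof -
      have "{p \<in> range (chart_pt \<theta> \<kappa> c z). (p, z) \<in> range (total_pt \<theta> \<kappa> d)} = range (chart_pt \<theta> \<kappa> c z) \<inter> range (chart_pt \<theta> \<kappa> d z)"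
        unfolding range_total_pt by auto
      then show ?thesis using E.inv_chart_image[of c d] by (simp add: fiber_dom_def)
    qed
    moreover have "holomorphic_map_on (\<lambda>p. total_tr \<theta> \<kappa> c d (emb3 z p)) (emb3 z -` total_dom \<theta> \<kappa> c d)"
      using holomorphic_total_tr[of \<theta> \<kappa> c d] unfolding holomorphic_map_on_def by (auto intro: holomorphic_fun_on_emb3)
    moreover have "total_tr \<theta> \<kappa> c d (emb3 z p) =
        inv (total_pt \<theta> \<kappa> d) (inv_into (range (chart_pt \<theta> \<kappa> c z)) (inv (chart_pt \<theta> \<kappa> c z)) p, z)"
      if "p \<in> emb3 z -` total_dom \<theta> \<kappa> c d" for p
      using P.tr_inv[of "emb3 z p" c d] that by (simp add: E.inv_into_inv_chart)
    ultimately show ?thesis using holomorphic_map_on_cong by (metis (no_types, lifting))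
  qed
  then show "\<forall>(U, \<phi>)\<in>E_atlas \<theta> \<kappa> z. \<forall>(V, \<psi>)\<in>P_atlas \<theta> \<kappa>.
        holomorphic_map_on (\<lambda>q. \<psi> (inv_into U \<phi> q, z)) (\<phi> ` {p \<in> U. (p, z) \<in> V})"
    by (simp add: E_atlas_def P_atlas_def)
next
  show "complex_manifold (P_space \<theta> \<kappa>) (P_atlas \<theta> \<kappa>)" by (rule complex_manifold_P)
  show "topspace (P_space \<theta> \<kappa>) = {(p, z). p \<in> topspace (E_space \<theta> \<kappa> z)}"
    unfolding topspace_P_space topspace_E_space range_total_pt by auto
next
  interpret P: glued_charts "total_pt \<theta> \<kappa>" "total_dom \<theta> \<kappa>" "total_tr \<theta> \<kappa>" by (rule total_glued_charts)
  have "holomorphic_fun_on (\<lambda>q. snd (inv_into (range (total_pt \<theta> \<kappa> c)) (inv (total_pt \<theta> \<kappa> c)) q)) S" for c S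
    unfolding P.inv_into_inv_chart snd_total_pt by (rule holomorphic_fun_on_nth)
  then show "\<forall>(V, \<psi>)\<in>P_atlas \<theta> \<kappa>. holomorphic_fun_on (\<lambda>q. snd (inv_into V \<psi> q)) (\<psi> ` V)"
    by (simp add: P_atlas_def)
next
  fix z0
  have "fst (trivialization \<theta> \<kappa> z0 s) = snd s" if s: "s \<in> topspace (P_space \<theta> \<kappa>)" "snd s \<in> ball z0 (1/8)" for s
  proof -
    obtain c q where cq: "s = total_pt \<theta> \<kappa> c q" using s(1) unfolding topspace_P_space by blast
    then have "q $ 3 \<in> ball z0 (1/8)" using s(2) by (simp add: snd_total_pt)
    then show ?thesis by (simp add: cq trivialization_total_pt snd_total_pt triv_point_def)
  qed
  then show "\<exists>N h. open N \<and> z0 \<in> N \<and>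
        homeomorphic_map (subtopology (P_space \<theta> \<kappa>) {s \<in> topspace (P_space \<theta> \<kappa>). snd s \<in> N})
                         (prod_topology (top_of_set N) (E_space \<theta> \<kappa> z0)) h \<and>
        (\<forall>s\<in>topspace (P_space \<theta> \<kappa>). snd s \<in> N \<longrightarrow> fst (h s) = snd s)"
    using trivialization_homeomorphism[of \<theta> \<kappa> z0]
    by (intro exI[of _ "ball z0 (1/8)"] exI[of _ "trivialization \<theta> \<kappa> z0"]) auto
qed

section \<open>The system in the charts\<close>

text \<open>Obtained from the system by the chain rule. The poles at \<open>w = 0\<close> cancel, so
  the field is polynomial in every chart, and solutions can cross the curves at infinity.
  \<open>a\<close>, \<open>d\<close> and \<open>b\<close> are the coefficients of the linear term in
  \<open>w\<close> in (a), (b) and (c).\<close>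

definition chart_field :: "complex \<Rightarrow> complex \<Rightarrow> chart \<Rightarrow> complex \<Rightarrow> complex^2 \<Rightarrow> complex^2" where
  "chart_field \<theta> \<kappa> c z p = (let a = 2*\<kappa>; b = 2*\<theta>; d = 2*(\<theta> + 1 - \<kappa>); u = p $ 1; w = p $ 2 in
     case c of
       XY \<Rightarrow> PIV \<theta> \<kappa> z p
     | UW3 \<Rightarrow> vector [(2*(u*w + a) - a) * (2*(u*w + a) - b) - (u*w + a)^2 + 2*z*u,
                     1 - 2*w^2*(u*w + a) - 2*z*w + b*w^2]
     | UW6 \<Rightarrow> vector [(2*(u*w + d) - d) * (2*(u*w + d) - b) - (u*w + d)^2 - 2*z*u,
                     - 1 - 2*w^2*(u*w + d) + 2*z*w + b*w^2]
     | UW9 \<Rightarrow> vector [(2*(u*w + b) - a) * (2*(u*w + b) - b) - (u*w + b)^2 - 2*z*u,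
                     1 - 2*w^2*(u*w + b) + 2*z*w + a*w^2])"

lemma lipschitz_field_chart_field: "lipschitz_field (chart_field \<theta> \<kappa> c)"
  unfolding lipschitz_field_def
proof
  fix k :: 2
  have [simp]: "lipschitz_coefficient (\<lambda>z p. z)" "lipschitz_coefficient (\<lambda>z p. k)" for k
    by (rule lipschitz_coefficient_time, simp)+
  note intros = lipschitz_coefficient_add lipschitz_coefficient_diff lipschitz_coefficient_minus
    lipschitz_coefficient_mult lipschitz_coefficient_power lipschitz_coefficient_nth
  consider "k = 1" | "k = 2" using exhaust_2[of k] by blast
  then show "lipschitz_coefficient (\<lambda>z p. chart_field \<theta> \<kappa> c z p $ k)"
    by cases (cases c; simp only: chart_field_def PIV_def Let_def chart.case vector_2; (intro intros)?; simp)+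
qed

text \<open>The chain rule confirms the formulas of \<open>chart_field\<close>; in (b) the explicit
  dependence on time contributes the summand \<open>- 2\<close>.\<close>

lemma solution_on_to_xy:
  assumes v: "solution_on (chart_field \<theta> \<kappa> c) D v" and dom: "\<And>t. t \<in> D \<Longrightarrow> v t \<in> chart_dom c"
  shows "solution_on (chart_field \<theta> \<kappa> XY) D (\<lambda>t. to_xy \<theta> \<kappa> c t (v t))"
  unfolding solution_on_def
proof (intro ballI allI)
  fix z k assume z: "z \<in> D"
  define u w where "u = (\<lambda>t. v t $ 1)" and "w = (\<lambda>t. v t $ 2)"
  define u' w' where "u' = chart_field \<theta> \<kappa> c z (v z) $ 1" and "w' = chart_field \<theta> \<kappa> c z (v z) $ 2"
  have du: "(u has_field_derivative u') (at z)" and dw: "(w has_field_derivative w') (at z)"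
    using v z unfolding solution_on_def u_def w_def u'_def w'_def by blast+
  show "((\<lambda>t. to_xy \<theta> \<kappa> c t (v t) $ k) has_field_derivative
      chart_field \<theta> \<kappa> XY z (to_xy \<theta> \<kappa> c z (v z)) $ k) (at z)"
  proof (cases "c = XY")
    case True
    then show ?thesis using v z unfolding solution_on_def True to_xy_XY by blast
  next
    case False
    then have wz: "w z \<noteq> 0" using dom[OF z] by (simp add: chart_dom_def w_def)
    define i where "i = 1 / w z"
    have iw: "i * w z = 1" using wz by (simp add: i_def)
    have dinv: "((\<lambda>t. 1 / w t) has_field_derivative - w' * i^2) (at z)"
      by (rule DERIV_cong[OF DERIV_divide[OF DERIV_const dw wz]])
         (use wz in \<open>simp add: i_def field_simps power2_eq_square\<close>)
    have dpoly: "((\<lambda>t. u t * w t ^ 2 + m * w t) has_field_derivative u' * w z ^ 2 + 2 * u z * w z * w' + m * w') (at z)" for m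
      by (rule DERIV_cong[OF DERIV_add[OF DERIV_mult[OF du DERIV_power[OF dw]] DERIV_cmult[OF dw]]]) simp
    have 6: "((\<lambda>t. 1 / w t + (u t * w t ^ 2 + (- 2*(\<kappa> - \<theta> - 1)) * w t) + (- 2) * t) has_field_derivative
        - w' * i^2 + (u' * w z ^ 2 + 2 * u z * w z * w' + (- 2*(\<kappa> - \<theta> - 1)) * w') + (- 2) * 1) (at z)"
      by (intro DERIV_add dinv dpoly DERIV_cmult DERIV_ident)
    have iz: "1 / (v z $ 2) = i" by (simp add: i_def w_def)
    have iv: "i * v z $ 2 = 1" using iw by (simp add: w_def)
    note defs = u_def w_def u'_def w'_def chart_field_def PIV_def to_xy_def Let_def chart.case vector_2
    consider "k = 1" | "k = 2" using exhaust_2[of k] by blast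
    then show ?thesis
    proof cases
      case 1
      show ?thesis
        unfolding 1
      proof (cases c)
        case UW3
        have "(\<lambda>t. to_xy \<theta> \<kappa> UW3 t (v t) $ 1) = (\<lambda>t. 1 / w t)"
          by (simp add: fun_eq_iff to_xy_def Let_def u_def w_def)
        moreover have "- w' * i^2 = chart_field \<theta> \<kappa> XY z (to_xy \<theta> \<kappa> UW3 z (v z)) $ 1"
          unfolding defs UW3 iz using iv by algebra
        ultimately show "((\<lambda>t. to_xy \<theta> \<kappa> c t (v t) $ 1) has_field_derivative
            chart_field \<theta> \<kappa> XY z (to_xy \<theta> \<kappa> c z (v z)) $ 1) (at z)"
          unfolding UW3 using dinv by metis
      next
        case UW6
        have "(\<lambda>t. to_xy \<theta> \<kappa> UW6 t (v t) $ 1) = (\<lambda>t. 1 / w t)"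
          by (simp add: fun_eq_iff to_xy_def Let_def u_def w_def)
        moreover have "- w' * i^2 = chart_field \<theta> \<kappa> XY z (to_xy \<theta> \<kappa> UW6 z (v z)) $ 1"
          unfolding defs UW6 iz using iv by algebra
        ultimately show "((\<lambda>t. to_xy \<theta> \<kappa> c t (v t) $ 1) has_field_derivative
            chart_field \<theta> \<kappa> XY z (to_xy \<theta> \<kappa> c z (v z)) $ 1) (at z)"
          unfolding UW6 using dinv by metis
      next
        case UW9
        have "(\<lambda>t. to_xy \<theta> \<kappa> UW9 t (v t) $ 1) = (\<lambda>t. u t * w t ^ 2 + (2*\<theta>) * w t)"
          by (simp add: fun_eq_iff to_xy_def Let_def u_def w_def)
        moreover have "u' * w z ^ 2 + 2 * u z * w z * w' + (2*\<theta>) * w' = chart_field \<theta> \<kappa> XY z (to_xy \<theta> \<kappa> UW9 z (v z)) $ 1"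
          unfolding defs UW9 iz using iv by algebra
        ultimately show "((\<lambda>t. to_xy \<theta> \<kappa> c t (v t) $ 1) has_field_derivative
            chart_field \<theta> \<kappa> XY z (to_xy \<theta> \<kappa> c z (v z)) $ 1) (at z)"
          unfolding UW9 using dpoly[of "(2*\<theta>)"] by metis
      qed (use False in simp)
    next
      case 2
      show ?thesis
        unfolding 2
      proof (cases c)
        case UW3
        have "(\<lambda>t. to_xy \<theta> \<kappa> UW3 t (v t) $ 2) = (\<lambda>t. u t * w t ^ 2 + (2*\<kappa>) * w t)"
          by (simp add: fun_eq_iff to_xy_def Let_def u_def w_def)
        moreover have "u' * w z ^ 2 + 2 * u z * w z * w' + (2*\<kappa>) * w' = chart_field \<theta> \<kappa> XY z (to_xy \<theta> \<kappa> UW3 z (v z)) $ 2"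
          unfolding defs UW3 iz using iv by algebra
        ultimately show "((\<lambda>t. to_xy \<theta> \<kappa> c t (v t) $ 2) has_field_derivative
            chart_field \<theta> \<kappa> XY z (to_xy \<theta> \<kappa> c z (v z)) $ 2) (at z)"
          unfolding UW3 using dpoly[of "(2*\<kappa>)"] by metis
      next
        case UW6
        have "(\<lambda>t. to_xy \<theta> \<kappa> UW6 t (v t) $ 2) = (\<lambda>t. 1 / w t + (u t * w t ^ 2 + (- 2*(\<kappa> - \<theta> - 1)) * w t) + (- 2) * t)"
          by (simp add: fun_eq_iff to_xy_def Let_def u_def w_def algebra_simps)
        moreover have "- w' * i^2 + (u' * w z ^ 2 + 2 * u z * w z * w' + (- 2*(\<kappa> - \<theta> - 1)) * w') + (- 2) * 1 = chart_field \<theta> \<kappa> XY z (to_xy \<theta> \<kappa> UW6 z (v z)) $ 2"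
          unfolding defs UW6 iz using iv by algebra
        ultimately show "((\<lambda>t. to_xy \<theta> \<kappa> c t (v t) $ 2) has_field_derivative
            chart_field \<theta> \<kappa> XY z (to_xy \<theta> \<kappa> c z (v z)) $ 2) (at z)"
          unfolding UW6 using 6 by metis
      next
        case UW9
        have "(\<lambda>t. to_xy \<theta> \<kappa> UW9 t (v t) $ 2) = (\<lambda>t. 1 / w t)"
          by (simp add: fun_eq_iff to_xy_def Let_def u_def w_def)
        moreover have "- w' * i^2 = chart_field \<theta> \<kappa> XY z (to_xy \<theta> \<kappa> UW9 z (v z)) $ 2"
          unfolding defs UW9 iz using iv by algebra
        ultimately show "((\<lambda>t. to_xy \<theta> \<kappa> c t (v t) $ 2) has_field_derivative
            chart_field \<theta> \<kappa> XY z (to_xy \<theta> \<kappa> c z (v z)) $ 2) (at z)"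
          unfolding UW9 using dinv by metis
      qed (use False in simp)
    qed
  qed
qed

section \<open>A function controlling the solutions\<close>

text \<open>In the chart \<open>XY\<close> this is \<open>V\<close>. The subtracted term cancels the poles of \<open>H\<close> along the
  curves \<open>w = 0\<close>; the other cases are the resulting expressions in \<open>u\<close> and \<open>w\<close>.\<close>

definition aux_fun :: "complex \<Rightarrow> complex \<Rightarrow> chart \<Rightarrow> complex \<Rightarrow> complex^2 \<Rightarrow> complex" where
  "aux_fun \<theta> \<kappa> c z p = (let u = p $ 1; w = p $ 2; d = 2*(\<theta> + 1 - \<kappa>) in
     case c of
       XY \<Rightarrow> (let f = w - u + 2*z in u*w*f - 2*\<theta>*w + 2*\<kappa>*u - 2*u / (1 + f * cnj f))
     | UW3 \<Rightarrow> (let s = u*w + 2*\<kappa>; y = w * s; g = w*y - 1 + 2*z*w in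
         s*(y + 2*z) - u - 2*\<theta>*y - 2*(cnj w / (w * cnj w + g * cnj g)))
     | UW6 \<Rightarrow> (let g = u*w + d; f = w*g in
         u + g^2*w - 2*z*g + 4*\<theta>*z - 2*\<theta>*f + 2*(cnj w * (g * cnj g) / (1 + f * cnj f)))
     | UW9 \<Rightarrow> (let s = u*w + 2*\<theta>; x = w * s; g = 1 - x*w + 2*z*w in
         u + s*(2*z - x) + 2*\<kappa>*x - 2*(x * (w * cnj w) / (w * cnj w + g * cnj g))))"

lemma one_plus_mult_cnj_nonzero: "1 + f * cnj f \<noteq> 0"
proof -
  have "1 + f * cnj f = of_real (1 + (norm f)^2)" by (simp only: of_real_add of_real_1 complex_norm_square)
  moreover have "1 + (norm f)^2 \<noteq> 0" by (smt (verit) zero_le_power2)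
  ultimately show ?thesis by (metis of_real_eq_0_iff)
qed

lemma mult_cnj_add_nonzero:
  assumes "w = 0 \<Longrightarrow> g \<noteq> 0"
  shows "w * cnj w + g * cnj g \<noteq> 0"
proof -
  have "w * cnj w + g * cnj g = of_real ((norm w)^2 + (norm g)^2)" by (simp only: of_real_add complex_norm_square)
  moreover have "(norm w)^2 + (norm g)^2 \<noteq> 0" using assms by (simp add: sum_power2_eq_zero_iff)
  ultimately show ?thesis by (metis of_real_eq_0_iff)
qed

lemma divide_one_plus_cnj:
  assumes "w \<noteq> 0"
  shows "x / (1 + (g / w) * cnj (g / w)) = x * (w * cnj w) / (w * cnj w + g * cnj g)"
proof -
  have "w * cnj w \<noteq> 0" using assms by simp
  then have "1 + (g / w) * cnj (g / w) = (w * cnj w + g * cnj g) / (w * cnj w)" by (simp add: add_divide_distrib)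
  then show ?thesis by simp
qed

text \<open>Near the curves of (a) and (c), \<open>f = g / w\<close> with \<open>g = - 1\<close> or
  \<open>g = 1\<close> at \<open>w = 0\<close>, so the subtracted term becomes a quotient with
  nonvanishing denominator that is 0 on the curve. Near the curve of (b), \<open>f = w * g\<close>,
  and \<open>2 * x\<close> minus the subtracted term is
  \<open>2 * cnj w * (g * cnj g) / (1 + f * cnj f)\<close>, so exactly the pole \<open>2 / w\<close>
  is removed.\<close>

lemma aux_fun_to_xy:
  assumes "p \<in> chart_dom c"
  shows "aux_fun \<theta> \<kappa> XY z (to_xy \<theta> \<kappa> c z p) = aux_fun \<theta> \<kappa> c z p"
proof (cases c)
  case XY
  then show ?thesis by simp
next
  case UW3
  define u w i where "u = p $ 1" and "w = p $ 2" and "i = 1 / w"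
  have w: "w \<noteq> 0" using assms by (simp add: UW3 chart_dom_def w_def)
  then have iw: "i * w = 1" by (simp add: i_def)
  define s where "s = u*w + 2*\<kappa>"
  define g where "g = w*(w * s) - 1 + 2*z*w"
  have f: "w * s - i + 2*z = g / w" using w by (simp add: i_def g_def field_simps)
  have "2 * i / (1 + (g / w) * cnj (g / w)) = 2 * (cnj w / (w * cnj w + g * cnj g))"
    unfolding divide_one_plus_cnj[OF w] using w by (simp add: i_def)
  moreover have "u * w^2 + 2*\<kappa>*w = w * s" by (simp add: s_def algebra_simps power2_eq_square)
  moreover have "i*(w * s)*(w * s - i + 2*z) - 2*\<theta>*(w * s) + 2*\<kappa>*i = s*(w * s + 2*z) - u - 2*\<theta>*(w * s)"
    using iw unfolding s_def by algebra
  ultimately show ?thesis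
    unfolding UW3 aux_fun_def to_xy_def Let_def chart.case vector_2 u_def[symmetric] w_def[symmetric] i_def[symmetric]
      s_def[symmetric] g_def[symmetric] by (simp only: f)
next
  case UW6
  define u w i where "u = p $ 1" and "w = p $ 2" and "i = 1 / w"
  have w: "w \<noteq> 0" using assms by (simp add: UW6 chart_dom_def w_def)
  then have iw: "i * w = 1" by (simp add: i_def)
  define d where "d = 2*(\<theta> + 1 - \<kappa>)"
  define g where "g = u*w + d"
  define y where "y = i + u * w^2 - 2*z - 2*(\<kappa> - \<theta> - 1)*w"
  have f: "y - i + 2*z = w*g" by (simp add: y_def g_def d_def algebra_simps power2_eq_square)
  have y: "y = i + w*g - 2*z" unfolding f[symmetric] by simp
  have "i - i / (1 + w*g * cnj (w*g)) = cnj w * (g * cnj g) / (1 + w*g * cnj (w*g))"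
  proof -
    have n: "1 + w*g * cnj (w*g) \<noteq> 0" by (rule one_plus_mult_cnj_nonzero)
    have "i - i / (1 + w*g * cnj (w*g)) = (i * (1 + w*g * cnj (w*g)) - i) / (1 + w*g * cnj (w*g))"
      using n by (simp add: diff_divide_distrib)
    also have "i * (1 + w*g * cnj (w*g)) - i = (i * w) * (cnj w * (g * cnj g))" by (simp add: algebra_simps)
    finally show ?thesis using iw by simp
  qed
  moreover have "2 * i / Q = 2 * i - 2 * (i - i / Q)" for Q by (simp add: algebra_simps)
  ultimately have e: "2 * i / (1 + w*g * cnj (w*g)) = 2 * i - 2 * (cnj w * (g * cnj g) / (1 + w*g * cnj (w*g)))"
    by metis
  have "i*y*(w*g) - 2*\<theta>*y + 2*\<kappa>*i - 2*i = u + g^2*w - 2*z*g + 4*\<theta>*z - 2*\<theta>*(w*g)"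
    using iw unfolding y g_def d_def by algebra
  then show ?thesis
    unfolding UW6 aux_fun_def to_xy_def Let_def chart.case vector_2 u_def[symmetric] w_def[symmetric] i_def[symmetric]
      d_def[symmetric] g_def[symmetric] y_def[symmetric] f e by (simp add: algebra_simps)
next
  case UW9
  define u w i where "u = p $ 1" and "w = p $ 2" and "i = 1 / w"
  have w: "w \<noteq> 0" using assms by (simp add: UW9 chart_dom_def w_def)
  then have iw: "i * w = 1" by (simp add: i_def)
  define s where "s = u*w + 2*\<theta>"
  define g where "g = 1 - w * s*w + 2*z*w"
  have f: "i - w * s + 2*z = g / w" using w by (simp add: i_def g_def field_simps)
  have "2 * (w * s) / (1 + (g / w) * cnj (g / w)) = 2 * (w * s * (w * cnj w) / (w * cnj w + g * cnj g))"
    unfolding divide_one_plus_cnj[OF w] by simp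
  moreover have "u * w^2 + 2*\<theta>*w = w * s" by (simp add: s_def algebra_simps power2_eq_square)
  moreover have "w * s*i*(i - w * s + 2*z) - 2*\<theta>*i + 2*\<kappa>*(w * s) = u + s*(2*z - w * s) + 2*\<kappa>*(w * s)"
    using iw unfolding s_def by algebra
  ultimately show ?thesis
    unfolding UW9 aux_fun_def to_xy_def Let_def chart.case vector_2 u_def[symmetric] w_def[symmetric] i_def[symmetric]
      s_def[symmetric] g_def[symmetric] by (simp only: f)
qed

lemma isCont_aux_fun:
  assumes "isCont h x" "isCont v x"
  shows "isCont (\<lambda>t. aux_fun \<theta> \<kappa> c (h t) (v t)) x"
proof -
  have v: "isCont (\<lambda>t. v t $ k) x" for k
    using assms(2) by (simp add: continuous_component)
  show ?thesis
    by (cases c; simp only: aux_fun_def Let_def chart.case;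
        intro isCont_add isCont_diff isCont_minus isCont_mult isCont_power isCont_divide isCont_cnj continuous_const assms(1) v one_plus_mult_cnj_nonzero mult_cnj_add_nonzero; simp)
qed

section \<open>Continuation of solutions\<close>

text \<open>A solution that may run through the curves at infinity: its values are points of the
  glued fibers, and near each time it solves the system in some chart. The discs inside
  \<open>D\<close> force \<open>D\<close> to be open.\<close>

definition solution_section :: "complex \<Rightarrow> complex \<Rightarrow> complex set \<Rightarrow> (complex \<Rightarrow> (chart \<times> (complex^2)) set) \<Rightarrow> bool" where
  "solution_section \<theta> \<kappa> D s \<longleftrightarrow> (\<forall>z\<in>D. \<exists>c v \<epsilon>. \<epsilon> > 0 \<and> ball z \<epsilon> \<subseteq> D \<and>
     solution_on (chart_field \<theta> \<kappa> c) (ball z \<epsilon>) v \<and> (\<forall>t\<in>ball z \<epsilon>. s t = chart_pt \<theta> \<kappa> c t (v t)))"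

text \<open>A normal form: off the curves at infinity the local solution is rewritten in the chart
  \<open>XY\<close>. Thus the point determines the chart, and two sections through it can be
  compared.\<close>

lemma solution_sectionE:
  assumes "solution_section \<theta> \<kappa> D s" "z \<in> D"
  obtains c v \<epsilon> where "\<epsilon> > 0" "ball z \<epsilon> \<subseteq> D" "solution_on (chart_field \<theta> \<kappa> c) (ball z \<epsilon>) v"
    "\<And>t. t \<in> ball z \<epsilon> \<Longrightarrow> s t = chart_pt \<theta> \<kappa> c t (v t)" "c = XY \<or> v z $ 2 = 0"
proof -
  obtain c v \<epsilon> where v: "\<epsilon> > 0" "ball z \<epsilon> \<subseteq> D" "solution_on (chart_field \<theta> \<kappa> c) (ball z \<epsilon>) v"
    "\<And>t. t \<in> ball z \<epsilon> \<Longrightarrow> s t = chart_pt \<theta> \<kappa> c t (v t)"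
    using assms unfolding solution_section_def by metis
  show thesis
  proof (cases "c = XY \<or> v z $ 2 = 0")
    case True
    then show thesis using that[OF v] by blast
  next
    case False
    have "isCont v z" using solution_on_imp_isCont[OF v(3)] v(1) by simp
    then have "isCont (\<lambda>t. v t $ 2) z" by (rule continuous_component)
    then have "\<forall>\<^sub>F t in nhds z. v t $ 2 \<noteq> 0"
      using False by (intro tendsto_imp_eventually_ne[of _ "v z $ 2"]) (simp_all add: isCont_def tendsto_nhds_iff)
    then obtain \<delta> where \<delta>: "\<delta> > 0" "\<And>t. dist t z < \<delta> \<Longrightarrow> v t $ 2 \<noteq> 0"
      unfolding eventually_nhds_metric by blast
    define \<epsilon>' where "\<epsilon>' = min \<epsilon> \<delta>"
    have sub: "ball z \<epsilon>' \<subseteq> ball z \<epsilon>" by (auto simp: \<epsilon>'_def)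
    have dom: "v t \<in> chart_dom c" if "t \<in> ball z \<epsilon>'" for t
      using \<delta>(2)[of t] that by (simp add: \<epsilon>'_def chart_dom_def dist_commute)
    show thesis
    proof (rule that[of \<epsilon>' XY "\<lambda>t. to_xy \<theta> \<kappa> c t (v t)"])
      show "\<epsilon>' > 0" using v(1) \<delta>(1) by (simp add: \<epsilon>'_def)
      show "ball z \<epsilon>' \<subseteq> D" using sub v(2) by blast
      show "solution_on (chart_field \<theta> \<kappa> XY) (ball z \<epsilon>') (\<lambda>t. to_xy \<theta> \<kappa> c t (v t))"
        by (rule solution_on_to_xy[OF solution_on_subset[OF v(3) sub] dom])
      show "s t = chart_pt \<theta> \<kappa> XY t (to_xy \<theta> \<kappa> c t (v t))" if "t \<in> ball z \<epsilon>'" for t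
      proof -
        have "t \<in> ball z \<epsilon>" using that sub by blast
        from v(4)[OF this] show ?thesis
          using dom[OF that] by (simp add: chart_pt_eq_iff chart_dom_def)
      qed
    qed simp
  qed
qed

lemma solution_section_subset:
  assumes s: "solution_section \<theta> \<kappa> D s" and "D' \<subseteq> D" "open D'"
  shows "solution_section \<theta> \<kappa> D' s"
  unfolding solution_section_def
proof
  fix z assume z: "z \<in> D'"
  obtain c v \<epsilon> where v: "\<epsilon> > 0" "ball z \<epsilon> \<subseteq> D" "solution_on (chart_field \<theta> \<kappa> c) (ball z \<epsilon>) v"
    "\<And>t. t \<in> ball z \<epsilon> \<Longrightarrow> s t = chart_pt \<theta> \<kappa> c t (v t)" "c = XY \<or> v z $ 2 = 0"
    using solution_sectionE[OF s] z assms(2) by (metis subsetD)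
  obtain \<delta> where \<delta>: "\<delta> > 0" "ball z \<delta> \<subseteq> D'" using assms(3) z open_contains_ball by blast
  have sub: "ball z (min \<epsilon> \<delta>) \<subseteq> ball z \<epsilon>" "ball z (min \<epsilon> \<delta>) \<subseteq> ball z \<delta>" by auto
  show "\<exists>c v \<epsilon>. \<epsilon> > 0 \<and> ball z \<epsilon> \<subseteq> D' \<and>
     solution_on (chart_field \<theta> \<kappa> c) (ball z \<epsilon>) v \<and> (\<forall>t\<in>ball z \<epsilon>. s t = chart_pt \<theta> \<kappa> c t (v t))"
    using v(1,4) \<delta> sub solution_on_subset[OF v(3) sub(1)]
    by (intro exI[of _ c] exI[of _ v] exI[of _ "min \<epsilon> \<delta>"]) auto
qed

lemma solution_section_of_solution:
  assumes "solution_on (chart_field \<theta> \<kappa> c) D v" "open D"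
  shows "solution_section \<theta> \<kappa> D (\<lambda>t. chart_pt \<theta> \<kappa> c t (v t))"
  unfolding solution_section_def
proof
  fix z assume z: "z \<in> D"
  obtain \<delta> where \<delta>: "\<delta> > 0" "ball z \<delta> \<subseteq> D" using assms(2) z open_contains_ball by blast
  show "\<exists>c' v' \<epsilon>. \<epsilon> > 0 \<and> ball z \<epsilon> \<subseteq> D \<and> solution_on (chart_field \<theta> \<kappa> c') (ball z \<epsilon>) v' \<and>
     (\<forall>t\<in>ball z \<epsilon>. chart_pt \<theta> \<kappa> c t (v t) = chart_pt \<theta> \<kappa> c' t (v' t))"
    using \<delta> solution_on_subset[OF assms(1) \<delta>(2)] by (intro exI[of _ c] exI[of _ v] exI[of _ \<delta>]) simp
qed

text \<open>By the normal form both sections use the same chart at \<open>z\<close> with equal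
  coordinates there, so local uniqueness applies.\<close>

lemma solution_section_agree_open:
  assumes s: "solution_section \<theta> \<kappa> D s" and s': "solution_section \<theta> \<kappa> D s'" and z: "z \<in> D" and eq: "s z = s' z"
  shows "\<exists>\<epsilon>>0. \<forall>t\<in>ball z \<epsilon>. s t = s' t"
proof -
  obtain c v \<epsilon> where v: "\<epsilon> > 0" "ball z \<epsilon> \<subseteq> D" "solution_on (chart_field \<theta> \<kappa> c) (ball z \<epsilon>) v"
    "\<And>t. t \<in> ball z \<epsilon> \<Longrightarrow> s t = chart_pt \<theta> \<kappa> c t (v t)" "c = XY \<or> v z $ 2 = 0"
    by (rule solution_sectionE[OF s z]) (rule that)
  obtain c' v' \<epsilon>' where v': "\<epsilon>' > 0" "ball z \<epsilon>' \<subseteq> D" "solution_on (chart_field \<theta> \<kappa> c') (ball z \<epsilon>') v'"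
    "\<And>t. t \<in> ball z \<epsilon>' \<Longrightarrow> s' t = chart_pt \<theta> \<kappa> c' t (v' t)" "c' = XY \<or> v' z $ 2 = 0"
    by (rule solution_sectionE[OF s' z]) (rule that)
  have "chart_pt \<theta> \<kappa> c z (v z) = chart_pt \<theta> \<kappa> c' z (v' z)" using eq v(1,4) v'(1,4) by simp
  then have cc: "c = c'" "v z = v' z" using v(5) v'(5) by (auto simp: chart_pt_eq_iff chart_dom_def)
  let ?\<epsilon> = "min \<epsilon> \<epsilon>'"
  have sub: "ball z ?\<epsilon> \<subseteq> ball z \<epsilon>" "ball z ?\<epsilon> \<subseteq> ball z \<epsilon>'" by auto
  have sol: "solution_on (chart_field \<theta> \<kappa> c) (ball z ?\<epsilon>) v" "solution_on (chart_field \<theta> \<kappa> c) (ball z ?\<epsilon>) v'"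
    using solution_on_subset[OF v(3) sub(1)] solution_on_subset[OF v'(3) sub(2)] cc(1) by simp_all
  have "z \<in> ball z ?\<epsilon>" using v(1) v'(1) by simp
  from solution_unique_local[OF lipschitz_field_chart_field open_ball this sol cc(2)]
  obtain \<delta> where \<delta>: "\<delta> > 0" "\<And>t. t \<in> ball z \<delta> \<Longrightarrow> v t = v' t" by blast
  have "s t = s' t" if "t \<in> ball z (min \<delta> ?\<epsilon>)" for t
    using that v(4)[of t] v'(4)[of t] \<delta>(2)[of t] cc by simp
  then show ?thesis using \<delta>(1) v(1) v'(1) by (intro exI[of _ "min \<delta> ?\<epsilon>"]) simp
qed

lemma isCont_emb3:
  assumes "isCont v z"
  shows "isCont (\<lambda>t. emb3 t (v t)) z"
proof -
  have "isCont (\<lambda>t. emb3 t (v t) $ k) z" for k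
  proof -
    have v: "isCont (\<lambda>t. v t $ j) z" for j using assms by (rule continuous_component)
    consider "k = 1" | "k = 2" | "k = 3" using exhaust_3[of k] by blast
    then show ?thesis by cases (use v in simp_all)
  qed
  then show ?thesis unfolding isCont_def by (intro vec_tendstoI)
qed

lemma solution_section_disagree_open:
  assumes s: "solution_section \<theta> \<kappa> D s" and s': "solution_section \<theta> \<kappa> D s'" and z: "z \<in> D" and ne: "s z \<noteq> s' z"
  shows "\<exists>\<epsilon>>0. \<forall>t\<in>ball z \<epsilon>. s t \<noteq> s' t"
proof -
  obtain c v \<epsilon> where v: "\<epsilon> > 0" "ball z \<epsilon> \<subseteq> D" "solution_on (chart_field \<theta> \<kappa> c) (ball z \<epsilon>) v"
    "\<And>t. t \<in> ball z \<epsilon> \<Longrightarrow> s t = chart_pt \<theta> \<kappa> c t (v t)" "c = XY \<or> v z $ 2 = 0"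
    by (rule solution_sectionE[OF s z]) (rule that)
  obtain c' v' \<epsilon>' where v': "\<epsilon>' > 0" "ball z \<epsilon>' \<subseteq> D" "solution_on (chart_field \<theta> \<kappa> c') (ball z \<epsilon>') v'"
    "\<And>t. t \<in> ball z \<epsilon>' \<Longrightarrow> s' t = chart_pt \<theta> \<kappa> c' t (v' t)" "c' = XY \<or> v' z $ 2 = 0"
    by (rule solution_sectionE[OF s' z]) (rule that)
  have ne': "total_pt \<theta> \<kappa> c (emb3 z (v z)) \<noteq> total_pt \<theta> \<kappa> c' (emb3 z (v' z))" using ne v(1,4) v'(1,4) by simp
  obtain U V where UV: "open U" "open V" "emb3 z (v z) \<in> U" "emb3 z (v' z) \<in> V"
    "total_pt \<theta> \<kappa> c ` U \<inter> total_pt \<theta> \<kappa> c' ` V = {}"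
    using total_pt_separated[OF ne'] by blast
  have "isCont v z" "isCont v' z" using solution_on_imp_isCont[OF v(3)] solution_on_imp_isCont[OF v'(3)] v(1) v'(1) by auto
  note cont = isCont_emb3[OF this(1)] isCont_emb3[OF this(2)]
  have "\<forall>\<^sub>F t in nhds z. emb3 t (v t) \<in> U" "\<forall>\<^sub>F t in nhds z. emb3 t (v' t) \<in> V"
    unfolding eventually_nhds_conv_at using UV(3,4)
      topological_tendstoD[OF cont(1)[unfolded isCont_def] UV(1,3)] topological_tendstoD[OF cont(2)[unfolded isCont_def] UV(2,4)]
    by auto
  moreover have "\<forall>\<^sub>F t in nhds z. t \<in> ball z (min \<epsilon> \<epsilon>')"
    by (rule eventually_nhds_in_open) (use v(1) v'(1) in auto)
  ultimately have "\<forall>\<^sub>F t in nhds z. s t \<noteq> s' t"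
  proof eventually_elim
    case (elim t)
    have "total_pt \<theta> \<kappa> c (emb3 t (v t)) \<noteq> total_pt \<theta> \<kappa> c' (emb3 t (v' t))" using UV(5) elim(1,2) by blast
    then show ?case using v(4)[of t] v'(4)[of t] elim(3) by simp
  qed
  then show ?thesis unfolding eventually_nhds_metric by (auto simp: dist_commute)
qed

text \<open>The set of agreement is open by local uniqueness, its complement because distinct points
  of the total space are separated.\<close>

lemma solution_section_unique:
  assumes s: "solution_section \<theta> \<kappa> D s" and s': "solution_section \<theta> \<kappa> D s'" and D: "open D" "connected D"
    and z0: "z0 \<in> D" "s z0 = s' z0" and z: "z \<in> D"
  shows "s z = s' z"
proof -
  have "open {t \<in> D. s t = s' t}"
  proof (subst open_contains_ball, intro ballI)
    fix t assume t: "t \<in> {t \<in> D. s t = s' t}"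
    then obtain \<epsilon> where \<epsilon>: "\<epsilon> > 0" "\<forall>r\<in>ball t \<epsilon>. s r = s' r" using solution_section_agree_open[OF s s'] by blast
    obtain \<delta> where \<delta>: "\<delta> > 0" "ball t \<delta> \<subseteq> D" using D(1) t open_contains_ball by blast
    then show "\<exists>e>0. ball t e \<subseteq> {t \<in> D. s t = s' t}" using \<epsilon> by (intro exI[of _ "min \<epsilon> \<delta>"]) auto
  qed
  moreover have "open {t \<in> D. s t \<noteq> s' t}"
  proof (subst open_contains_ball, intro ballI)
    fix t assume t: "t \<in> {t \<in> D. s t \<noteq> s' t}"
    then obtain \<epsilon> where \<epsilon>: "\<epsilon> > 0" "\<forall>r\<in>ball t \<epsilon>. s r \<noteq> s' r" using solution_section_disagree_open[OF s s'] by blast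
    obtain \<delta> where \<delta>: "\<delta> > 0" "ball t \<delta> \<subseteq> D" using D(1) t open_contains_ball by blast
    then show "\<exists>e>0. ball t e \<subseteq> {t \<in> D. s t \<noteq> s' t}" using \<epsilon> by (intro exI[of _ "min \<epsilon> \<delta>"]) auto
  qed
  ultimately have "{t \<in> D. s t = s' t} \<inter> D = {} \<or> {t \<in> D. s t \<noteq> s' t} \<inter> D = {}"
    using D(2) by (intro connectedD) auto
  then show ?thesis using z0 z by blast
qed

section \<open>Estimates for the auxiliary function along solutions\<close>

definition aux_on_section :: "complex \<Rightarrow> complex \<Rightarrow> complex \<Rightarrow> (chart \<times> (complex^2)) set \<Rightarrow> complex" where
  "aux_on_section \<theta> \<kappa> z A = (let r = SOME r. chart_pt \<theta> \<kappa> (fst r) z (snd r) = A in aux_fun \<theta> \<kappa> (fst r) z (snd r))"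

lemma aux_fun_cong:
  assumes "chart_pt \<theta> \<kappa> c z p = chart_pt \<theta> \<kappa> d z q"
  shows "aux_fun \<theta> \<kappa> c z p = aux_fun \<theta> \<kappa> d z q"
  using assms aux_fun_to_xy unfolding chart_pt_eq_iff by metis

lemma aux_on_section_chart_pt: "aux_on_section \<theta> \<kappa> z (chart_pt \<theta> \<kappa> c z p) = aux_fun \<theta> \<kappa> c z p"
proof -
  define r where "r = (SOME r. chart_pt \<theta> \<kappa> (fst r) z (snd r) = chart_pt \<theta> \<kappa> c z p)"
  have "chart_pt \<theta> \<kappa> (fst r) z (snd r) = chart_pt \<theta> \<kappa> c z p"
    unfolding r_def by (rule someI[of _ "(c, p)"]) simp
  then show ?thesis unfolding aux_on_section_def Let_def r_def[symmetric] by (rule aux_fun_cong)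
qed

text \<open>At a point on a curve at infinity \<open>w' = 1\<close> or \<open>w' = - 1\<close>, so a section meets these curves in isolated points.\<close>

lemma solution_section_leaves_divisor:
  assumes s: "solution_section \<theta> \<kappa> D s" and z: "z \<in> D"
  shows "\<exists>\<epsilon>>0. ball z \<epsilon> \<subseteq> D \<and> (\<forall>t\<in>ball z \<epsilon> - {z}. s t \<in> range (chart_pt \<theta> \<kappa> XY t))"
proof -
  obtain c v \<epsilon> where v: "\<epsilon> > 0" "ball z \<epsilon> \<subseteq> D" "solution_on (chart_field \<theta> \<kappa> c) (ball z \<epsilon>) v"
    "\<And>t. t \<in> ball z \<epsilon> \<Longrightarrow> s t = chart_pt \<theta> \<kappa> c t (v t)" "c = XY \<or> v z $ 2 = 0"
    by (rule solution_sectionE[OF s z]) (rule that)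
  show ?thesis
  proof (cases "c = XY")
    case True
    then show ?thesis using v by (intro exI[of _ \<epsilon>]) auto
  next
    case False
    then have w: "v z $ 2 = 0" using v(5) by blast
    have zb: "z \<in> ball z \<epsilon>" using v(1) by simp
    define l where "l = chart_field \<theta> \<kappa> c z (v z) $ 2"
    have d: "((\<lambda>t. v t $ 2) has_field_derivative l) (at z)"
      using v(3) zb unfolding solution_on_def l_def by blast
    have "l \<noteq> 0" using False by (cases c) (simp_all add: l_def chart_field_def Let_def w)
    moreover have "((\<lambda>t. (v t $ 2 - v z $ 2) / (t - z)) \<longlongrightarrow> l) (at z)"
      using d by (simp add: has_field_derivative_iff)
    ultimately have "\<forall>\<^sub>F t in at z. (v t $ 2 - v z $ 2) / (t - z) \<noteq> 0"
      by (intro tendsto_imp_eventually_ne)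
    then obtain \<delta> where \<delta>: "\<delta> > 0" "\<And>t. t \<noteq> z \<Longrightarrow> dist t z < \<delta> \<Longrightarrow> (v t $ 2 - v z $ 2) / (t - z) \<noteq> 0"
      unfolding eventually_at by auto
    have "s t \<in> range (chart_pt \<theta> \<kappa> XY t)" if t: "t \<in> ball z (min \<epsilon> \<delta>) - {z}" for t
    proof -
      have "v t $ 2 \<noteq> 0" using \<delta>(2)[of t] t w by (auto simp: dist_commute)
      moreover have "t \<in> ball z \<epsilon>" using t by auto
      ultimately have "s t = chart_pt \<theta> \<kappa> XY t (to_xy \<theta> \<kappa> c t (v t))"
        using v(4)[of t] by (simp add: chart_pt_eq_iff chart_dom_def)
      then show ?thesis by simp
    qed
    then show ?thesis using v(1,2) \<delta>(1) by (intro exI[of _ "min \<epsilon> \<delta>"]) auto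
  qed
qed

text \<open>Here \<open>a\<close>, \<open>b\<close>, \<open>m\<close> stand for the moduli of \<open>x\<close>, \<open>y\<close> and \<open>f = y - x + 2 * z\<close>, and \<open>V\<close> for that of
  the auxiliary function. If \<open>a * b * m\<close> is not controlled by \<open>V\<close>, then one of the three is small.\<close>

lemma cubic_bounded_or_small_factor:
  fixes a b m K R V :: real
  assumes nn: "a \<ge> 0" "b \<ge> 0" "m \<ge> 0" "K \<ge> 1" "R \<ge> 0" "V \<ge> 0"
    and a: "a \<le> b + m + 2 * R" and b: "b \<le> a + m + 2 * R"
    and V: "a * b * m - K * (a + b) \<le> V"
    and g: "0 \<le> g" "g \<le> 1 / 2" "g \<le> m" "m * g \<le> 1"
    and C: "C = 4 * K * (4 * K + 1 + R) + 2 + R"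
  shows "a * b * m * g \<le> C * (1 + V)" "a * g \<le> C * (1 + V)"
proof -
  have KR: "4 * K * (4 * K + 1 + R) \<ge> 4 * K" "4 * K * (4 * K + 1 + R) \<ge> 4 * K + 1 + R"
    using nn mult_left_mono[of 1 "4 * K + 1 + R" "4 * K"] mult_right_mono[of 1 "4 * K" "4 * K + 1 + R"] by auto
  have C0: "C \<ge> 2" "C \<ge> 4 * K * (4 * K + 1 + R)" "C \<ge> 2 + R" using KR nn by (auto simp: C)
  have CV: "C \<le> C * (1 + V)" "C * V \<ge> 2 * V" "C * (1 + V) = C + C * V"
    using C0 nn mult_right_mono[of 2 C V] by (auto simp: algebra_simps)
  have ag: "a * g \<le> b * g + 1 + R"
  proof -
    have "a * g \<le> (b + m + 2 * R) * g" using a g by (intro mult_right_mono) auto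
    moreover have "2 * R * g \<le> R" using mult_left_mono[OF g(2), of "2 * R"] nn by simp
    ultimately show ?thesis using g by (simp add: algebra_simps)
  qed
  have bg: "b * g \<le> a * g + 1 + R"
  proof -
    have "b * g \<le> (a + m + 2 * R) * g" using b g by (intro mult_right_mono) auto
    moreover have "2 * R * g \<le> R" using mult_left_mono[OF g(2), of "2 * R"] nn by simp
    ultimately show ?thesis using g by (simp add: algebra_simps)
  qed
  have "a * b * m * g \<le> C * (1 + V) \<and> a * g \<le> C * (1 + V)"
  \<comment> \<open>Either the cubic term is at least twice the linear one, and then at most
    \<open>2 * V\<close>; or it is at most \<open>2 * K * (a + b)\<close>, and cancelling the larger
    of \<open>a\<close> and \<open>b\<close> bounds the product of the two other moduli by
    \<open>4 * K\<close>.\<close>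
  proof (cases "a * b * m \<ge> 2 * K * (a + b)")
    case True
    then have P: "a * b * m \<le> 2 * V" using V by simp
    have "a * b * m * g \<le> a * b * m * (1 / 2)" using g nn by (intro mult_left_mono) auto
    then have 1: "a * b * m * g \<le> V" using P by simp
    have 2: "a * g \<le> max (2 * V) (2 + R)"
    proof (cases "b \<ge> 1")
      case True
      have "a * g \<le> a * m" using g nn by (intro mult_left_mono) auto
      also have "\<dots> \<le> a * m * b" using True nn mult_left_mono[of 1 b "a * m"] by simp
      finally show ?thesis using P by (simp add: mult_ac)
    next
      case False
      then have "b * g \<le> 1" using g mult_mono[of b 1 g 1] nn by simp
      then show ?thesis using ag by simp
    qed
    show ?thesis using 1 2 CV C0 nn by auto
  next
    case False
    then have P: "a * b * m \<le> 2 * (K * a) + 2 * (K * b)" by (simp add: algebra_simps)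
    show ?thesis
    proof (cases "b \<ge> a")
      case True
      have am: "a * m \<le> 4 * K"
      proof (cases "b = 0")
        case False
        have "(a * m) * b \<le> (4 * K) * b"
        proof -
          have "K * a \<le> K * b" using True nn by (intro mult_left_mono) auto
          then have "a * b * m \<le> 4 * (K * b)" using P by linarith
          then show ?thesis by (simp add: mult_ac)
        qed
        then show ?thesis using False nn by simp
      qed (use True nn in auto)
      have "a * g \<le> a * m" using g nn by (intro mult_left_mono) auto
      then have ag4: "a * g \<le> 4 * K" using am by linarith
      have "(a * m) * (b * g) \<le> (4 * K) * (4 * K + 1 + R)"
        by (rule mult_mono) (use am bg ag4 nn g in auto)
      then show ?thesis using ag4 CV C0 KR nn by (simp add: mult_ac)
    next
      case ab: False
      have bm: "b * m \<le> 4 * K"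
      proof -
        have "(b * m) * a \<le> (4 * K) * a"
        proof -
          have "K * b \<le> K * a" using ab nn by (intro mult_left_mono) auto
          then have "a * b * m \<le> 4 * (K * a)" using P by linarith
          then show ?thesis by (simp add: mult_ac)
        qed
        then show ?thesis using ab nn by simp
      qed
      have "b * g \<le> b * m" using g nn by (intro mult_left_mono) auto
      then have ag4: "a * g \<le> 4 * K + 1 + R" using bm ag by linarith
      have "(b * m) * (a * g) \<le> (4 * K) * (4 * K + 1 + R)"
        by (rule mult_mono) (use bm ag4 nn g in auto)
      then show ?thesis using ag4 CV C0 KR nn by (simp add: mult_ac)
    qed
  qed
  then show "a * b * m * g \<le> C * (1 + V)" "a * g \<le> C * (1 + V)" by auto
qed

lemma norm_one_plus_mult_cnj: "norm (1 + f * cnj f) = 1 + (norm f)^2"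
proof -
  have "1 + f * cnj f = of_real (1 + (norm f)^2)" by (simp only: of_real_add of_real_1 complex_norm_square)
  then show ?thesis by (metis abs_of_nonneg add_nonneg_nonneg norm_of_real zero_le_one zero_le_power2)
qed

text \<open>The function is \<open>x * y * f\<close> up to terms linear in \<open>x\<close> and
  \<open>y\<close>, because the subtracted quotient has modulus at most
  \<open>2 * norm x\<close>.\<close>

lemma aux_fun_lower_bound:
  fixes x y z \<theta> \<kappa> :: complex
  defines "f \<equiv> y - x + 2 * z"
  shows "norm x * norm y * norm f - (2 * norm \<theta> + 2 * norm \<kappa> + 2) * (norm x + norm y) \<le> norm (aux_fun \<theta> \<kappa> XY z (vector [x, y]))"
proof -
  let ?V = "aux_fun \<theta> \<kappa> XY z (vector [x, y])"
  have V: "x * y * f = ?V + 2 * \<theta> * y - 2 * \<kappa> * x + 2 * x / (1 + f * cnj f)"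
    by (simp add: aux_fun_def f_def Let_def)
  have "norm (2 * x / (1 + f * cnj f)) \<le> 2 * norm x"
    unfolding norm_divide norm_one_plus_mult_cnj norm_mult
    by (simp add: divide_le_eq add_pos_nonneg mult_left_le_one_le algebra_simps)
  then have "norm (x * y * f) \<le> norm ?V + 2 * norm \<theta> * norm y + 2 * norm \<kappa> * norm x + 2 * norm x"
    unfolding V using norm_triangle_ineq[of "?V + 2 * \<theta> * y - 2 * \<kappa> * x" "2 * x / (1 + f * cnj f)"]
      norm_triangle_ineq4[of "?V + 2 * \<theta> * y" "2 * \<kappa> * x"] norm_triangle_ineq[of ?V "2 * \<theta> * y"]
    by (simp add: norm_mult)
  moreover have "2 * norm \<theta> * norm y + 2 * norm \<kappa> * norm x + 2 * norm x \<le>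
      (2 * norm \<theta> + 2 * norm \<kappa> + 2) * (norm x + norm y)"
    by (simp add: algebra_simps)
  ultimately show ?thesis by (simp add: norm_mult)
qed

text \<open>The left-hand side bounds the modulus of the derivative of the auxiliary function along a solution.\<close>

lemma aux_fun_growth:
  fixes \<theta> \<kappa> :: complex and R :: real
  assumes R: "R \<ge> 0"
  obtains C where "C > 0" "\<And>x y z. norm z \<le> R \<Longrightarrow>
     norm (2*x*y - 2 * (PIV \<theta> \<kappa> z (vector [x, y]) $ 1) / (1 + (y - x + 2*z) * cnj (y - x + 2*z)))
       + 4 * norm x * norm (y - x + 2*z) *
         norm (PIV \<theta> \<kappa> z (vector [x, y]) $ 2 - PIV \<theta> \<kappa> z (vector [x, y]) $ 1 + 2) / (1 + (norm (y - x + 2*z))^2)^2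
     \<le> C * (1 + norm (aux_fun \<theta> \<kappa> XY z (vector [x, y])))"
proof -
  define K where "K = 2 * norm \<theta> + 2 * norm \<kappa> + 2"
  define C1 where "C1 = 4 * K * (4 * K + 1 + R) + 2 + R"
  define d where "d = 2 + 2*\<theta> - 2*\<kappa>"
  define C where "C = (10 + 6 + 8 * R + 4 * norm d) * C1 + 4 * norm \<theta>"
  have K: "K \<ge> 1" by (simp add: K_def)
  have C1: "C1 \<ge> 2" using K R by (simp add: C1_def)
  show thesis
  proof (rule that)
    have "(10 + 6 + 8 * R + 4 * norm d) * C1 > 0" using C1 R by (intro mult_pos_pos) (auto simp: add_pos_nonneg)
    then show "C > 0" by (simp add: C_def add_pos_nonneg)
    fix x y z :: complex assume z: "norm z \<le> R"
    define f where "f = y - x + 2*z"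
    let ?x' = "PIV \<theta> \<kappa> z (vector [x, y]) $ 1" and ?y' = "PIV \<theta> \<kappa> z (vector [x, y]) $ 2"
    let ?V = "norm (aux_fun \<theta> \<kappa> XY z (vector [x, y]))"
    define a b m where "a = norm x" and "b = norm y" and "m = norm f"
    define q where "q = 1 + m^2"
    \<comment> \<open>\<open>g\<close> is the modulus of \<open>f / (1 + f * cnj f)\<close>. All
      terms of the derivative are reduced to \<open>a * b * m * g\<close>, \<open>a * g\<close> and
      a constant.\<close>
    define g where "g = m / q"
    have q: "q \<ge> 1" by (simp add: q_def)
    have mq: "2 * m \<le> q" using sum_squares_bound[of m 1] by (simp add: q_def power2_eq_square)
    have nn: "a \<ge> 0" "b \<ge> 0" "m \<ge> 0" by (simp_all add: a_def b_def m_def)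
    have g: "0 \<le> g" "g \<le> 1 / 2" "g \<le> m" "m * g \<le> 1"
      using q mq nn by (simp_all add: g_def divide_le_eq mult_left_le power2_eq_square q_def mult_left_mono algebra_simps)
    have z2: "norm (2 * z) \<le> 2 * R" using z by (simp add: norm_mult)
    have a: "a \<le> b + m + 2 * R"
      using norm_triangle_ineq[of "y - f" "2 * z"] norm_triangle_ineq4[of y f] z2 by (simp add: a_def b_def m_def f_def)
    have b: "b \<le> a + m + 2 * R"
      using norm_triangle_ineq4[of "x + f" "2 * z"] norm_triangle_ineq[of x f] z2 by (simp add: a_def b_def m_def f_def)
    have V: "a * b * m - K * (a + b) \<le> ?V"
      using aux_fun_lower_bound[of x y z \<theta> \<kappa>] by (simp add: a_def b_def m_def f_def K_def)
    note bounds = cubic_bounded_or_small_factor[OF nn K R norm_ge_zero a b V g C1_def]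
    have x': "?x' = x * (f + y) - 2*\<theta>" by (simp add: PIV_def Let_def f_def algebra_simps power2_eq_square)
    have f': "?y' - ?x' + 2 = - f * (x + y) + d" by (simp add: PIV_def Let_def f_def d_def algebra_simps power2_eq_square)
    have nz: "1 + f * cnj f \<noteq> 0" by (rule one_plus_mult_cnj_nonzero)
    have nq: "norm (1 + f * cnj f) = q" by (simp add: norm_one_plus_mult_cnj q_def m_def)
    \<comment> \<open>Since \<open>x'\<close> contains \<open>x * y\<close>, the term
      \<open>2 * x * y\<close> from the derivative of \<open>H\<close> survives only with the factor
      \<open>f * cnj f / (1 + f * cnj f)\<close>, which vanishes on the curve of (b), where
      \<open>x * y\<close> has its double pole.\<close>
    have "2*x*y - 2 * ?x' / (1 + f * cnj f) =
        (2*x*y * (f * cnj f) - 2*x*f + 4*\<theta>) / (1 + f * cnj f)"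
      using nz unfolding x' by (simp add: field_simps)
    then have "norm (2*x*y - 2 * ?x' / (1 + f * cnj f)) = norm (2*x*y * (f * cnj f) - 2*x*f + 4*\<theta>) / q"
      by (simp add: norm_divide nq)
    also have "norm (2*x*y * (f * cnj f) - 2*x*f + 4*\<theta>) \<le> 2*a*b*m^2 + 2*a*m + 4 * norm \<theta>"
      using norm_triangle_ineq[of "2*x*y * (f * cnj f) - 2*x*f" "4*\<theta>"] norm_triangle_ineq4[of "2*x*y * (f * cnj f)" "2*x*f"]
      by (simp add: norm_mult a_def b_def m_def power2_eq_square)
    also have "(2*a*b*m^2 + 2*a*m + 4 * norm \<theta>) / q \<le> 2 * (a*b*m*g) + 2 * (a*g) + 4 * norm \<theta>"
    proof -
      have "4 * norm \<theta> / q \<le> 4 * norm \<theta>" using q by (simp add: divide_le_eq mult_le_cancel_left1)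
      moreover have "(2*a*b*m^2 + 2*a*m + 4 * norm \<theta>) / q = 2 * (a*b*m*g) + 2 * (a*g) + 4 * norm \<theta> / q"
        by (simp add: g_def add_divide_distrib power2_eq_square)
      ultimately show ?thesis by simp
    qed
    finally have 1: "norm (2*x*y - 2 * ?x' / (1 + f * cnj f)) \<le> 2 * (a*b*m*g) + 2 * (a*g) + 4 * norm \<theta>"
      using q by (simp add: divide_right_mono)
    have "norm (?y' - ?x' + 2) \<le> m * (a + b) + norm d"
      unfolding f' using norm_triangle_ineq[of "- f * (x + y)" d] norm_triangle_ineq[of x y] mult_left_mono[of "norm (x + y)" "a + b" m]
      by (simp add: norm_mult a_def b_def m_def)
    then have "4 * a * m * norm (?y' - ?x' + 2) / q^2 \<le> 4 * a * m * (m * (a + b) + norm d) / q^2"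
      using nn by (intro divide_right_mono mult_left_mono) auto
    also have "\<dots> = 4 * (a*(a+b)*g^2) + 4 * norm d * (a * g) / q"
      using q by (simp add: g_def field_simps power2_eq_square)
    \<comment> \<open>A square of \<open>a\<close> is not controlled directly; one factor is
      replaced by \<open>b + m + 2 * R\<close>.\<close>
    also have "a*(a+b)*g^2 \<le> 2*(a*b*m*g) + (1 + 2*R) * (a*g)"
    proof -
      have "a*(a+b)*g^2 \<le> a*((b + m + 2*R)+b)*g^2" using a nn by (intro mult_right_mono mult_left_mono) auto
      also have "\<dots> = 2*(a*b*g)*g + (a*g)*(m*g) + 2*R*(a*g)*g" by (simp add: algebra_simps power2_eq_square)
      also have "\<dots> \<le> 2*(a*b*g)*m + (a*g)*1 + 2*R*(a*g)*1"
        using g nn R by (intro add_mono mult_left_mono) auto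
      finally show ?thesis by (simp add: algebra_simps)
    qed
    also have "4 * norm d * (a * g) / q \<le> 4 * norm d * (a * g)"
    proof -
      have "4 * norm d * (a * g) * 1 \<le> 4 * norm d * (a * g) * q" using q nn g by (intro mult_left_mono) auto
      then show ?thesis using q by (simp add: divide_le_eq)
    qed
    finally have 2: "4 * a * m * norm (?y' - ?x' + 2) / q^2 \<le> 8 * (a*b*m*g) + (4 + 8 * R + 4 * norm d) * (a*g)"
      by (simp add: algebra_simps)
    have "norm (2*x*y - 2 * ?x' / (1 + f * cnj f)) + 4 * a * m * norm (?y' - ?x' + 2) / q^2 \<le>
        10 * (a*b*m*g) + (6 + 8 * R + 4 * norm d) * (a*g) + 4 * norm \<theta>"
      using 1 2 by (simp add: algebra_simps)
    also have "\<dots> \<le> 10 * (C1 * (1 + ?V)) + (6 + 8 * R + 4 * norm d) * (C1 * (1 + ?V)) + 4 * norm \<theta> * (1 + ?V)"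
      using bounds R by (intro add_mono mult_left_mono) (auto simp: mult_le_cancel_left1)
    also have "\<dots> = C * (1 + ?V)" by (simp add: C_def algebra_simps)
    finally show "norm (2*x*y - 2 * ?x' / (1 + (y - x + 2*z) * cnj (y - x + 2*z)))
       + 4 * norm x * norm (y - x + 2*z) * norm (?y' - ?x' + 2) / (1 + (norm (y - x + 2*z))^2)^2 \<le> C * (1 + ?V)"
      by (simp only: a_def m_def q_def f_def)
  qed
qed

text \<open>If \<open>x\<close> or \<open>y\<close> is large, bounding the function bounds the
  product of the other one with \<open>f\<close>, hence the smaller of these two. According to
  whether that is \<open>f\<close>, \<open>y\<close> or \<open>x\<close>, the point belongs to the
  chart (b), (a) or (c), and solving the formula of the function for \<open>u\<close> bounds
  \<open>u\<close>.\<close>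

lemma aux_fun_sublevel_bounded_xy:
  fixes \<theta> \<kappa> :: complex and R V0 :: real
  assumes R: "R \<ge> 0" and V0: "V0 \<ge> 0"
  obtains M where "\<And>x y z. norm z \<le> R \<Longrightarrow> norm (aux_fun \<theta> \<kappa> XY z (vector [x, y])) \<le> V0 \<Longrightarrow>
     \<exists>c. vector [x, y] \<in> xy_image c \<and> norm (from_xy \<theta> \<kappa> c z (vector [x, y])) \<le> M"
proof -
  define K where "K = 2 * norm \<theta> + 2 * norm \<kappa> + 2"
  \<comment> \<open>Dividing \<open>a * b * m \<le> V0 + K * a + K * b\<close> by the larger of
    \<open>a\<close> and \<open>b\<close>, if it is at least 1, bounds the product of the other two
    moduli by \<open>L\<close>. \<open>S\<close> bounds the further products that occur, and
    \<open>M\<close> collects the bounds of all summands of \<open>u\<close>.\<close>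
  define L where "L = V0 + 2 * K"
  define S where "S = 3 * (L + 1) + 2 * R * (L + 1)"
  define P1 P2 P3 P4 P5 where "P1 = S * S" and "P2 = 2 * R * S" and "P3 = 4 * norm \<theta> * R"
    and "P4 = 2 * norm \<theta> * S" and "P5 = 2 * norm \<kappa> * S"
  note P_defs = P1_def P2_def P3_def P4_def P5_def
  define M where "M = V0 + 4 * P1 + P2 + P3 + P4 + P5 + 6 * S + 8 * R + 10"
  have K: "K \<ge> 2" by (simp add: K_def)
  then have L: "L \<ge> 4" "L \<ge> V0" using V0 by (auto simp: L_def)
  have RL: "R * (L + 1) \<ge> 0" using R L by simp
  then have S: "S \<ge> L + 1" "S \<ge> 3 * (L + 1)" using L by (auto simp: S_def)
  have pos: "P1 \<ge> 0" "P2 \<ge> 0" "P3 \<ge> 0" "P4 \<ge> 0" "P5 \<ge> 0"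
    using S L R by (auto simp: P_defs)
  show thesis
  proof (rule that[of M])
    fix x y z :: complex
    assume z: "norm z \<le> R" and V: "norm (aux_fun \<theta> \<kappa> XY z (vector [x, y])) \<le> V0"
    define f where "f = y - x + 2*z"
    let ?V = "aux_fun \<theta> \<kappa> XY z (vector [x, y])"
    let ?Q = "1 + f * cnj f"
    define a b m where "a = norm x" and "b = norm y" and "m = norm f"
    have nn: "a \<ge> 0" "b \<ge> 0" "m \<ge> 0" by (simp_all add: a_def b_def m_def)
    have nQ: "norm ?Q = 1 + m^2" by (simp add: norm_one_plus_mult_cnj m_def)
    have Q: "?Q \<noteq> 0" by (rule one_plus_mult_cnj_nonzero)
    have z2: "norm (2 * z) \<le> 2 * R" using z by (simp add: norm_mult)
    have a: "a \<le> b + m + 2 * R"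
      using norm_triangle_ineq[of "y - f" "2 * z"] norm_triangle_ineq4[of y f] z2 by (simp add: a_def b_def m_def f_def)
    have b: "b \<le> a + m + 2 * R"
      using norm_triangle_ineq4[of "x + f" "2 * z"] norm_triangle_ineq[of x f] z2 by (simp add: a_def b_def m_def f_def)
    have P: "a * b * m \<le> V0 + K * a + K * b"
      using aux_fun_lower_bound[of x y z \<theta> \<kappa>] V by (simp add: a_def b_def m_def f_def K_def algebra_simps)
    have Veq: "?V = x*y*f - 2*\<theta>*y + 2*\<kappa>*x - 2*x / ?Q" by (simp add: aux_fun_def f_def Let_def)
    have xQ: "norm (x / ?Q) \<le> norm x" "norm (x / ?Q) \<le> b + 1 + 2 * R"
    proof -
      have 1: "a / (1 + m^2) \<le> t" if "a \<le> t * (1 + m^2)" for t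
        using that by (simp add: divide_le_eq add_pos_nonneg)
      have "a * 1 \<le> a * (1 + m^2)" using nn by (intro mult_left_mono) auto
      from 1[of a] this show "norm (x / ?Q) \<le> norm x" by (simp add: norm_divide nQ a_def)
      have "m \<le> 1 + m^2" using sum_squares_bound[of m 1] nn by (simp add: power2_eq_square)
      moreover have "b * 1 \<le> b * (1 + m^2)" "2 * R * 1 \<le> 2 * R * (1 + m^2)" using nn R by (intro mult_left_mono; simp)+
      ultimately have "a \<le> (b + 1 + 2 * R) * (1 + m^2)" using a by (simp add: algebra_simps)
      from 1[OF this] show "norm (x / ?Q) \<le> b + 1 + 2 * R" by (simp add: norm_divide nQ a_def)
    qed
    have sq: "t \<le> L + 1" if "t * t \<le> L" "t \<ge> 0" for t :: real
    proof (rule ccontr)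
      assume "\<not> t \<le> L + 1"
      then have "t * t \<ge> t * 1" "t > L" using L by (auto intro!: mult_left_mono)
      then show False using that by simp
    qed
    have M_uw: "norm (vector [u, w] :: complex^2) \<le> M" if "norm u \<le> M - 1" "norm w \<le> 1" for u w
      using norm_vec2_le[of "vector [u, w]"] that by simp
    have n2: "norm (2 * t) = 2 * norm t" for t :: complex by (simp add: norm_mult)
    have inv: "norm (1 / t) \<le> 1" if "norm t \<ge> 1" for t :: complex
      using that by (auto simp: norm_divide divide_le_eq_1)
    have fin: "\<exists>c. vector [x, y] \<in> xy_image c \<and> norm (from_xy \<theta> \<kappa> c z (vector [x, y])) \<le> M" if "a \<le> 2 + 2*R" "b \<le> 2 + 2*R"
    proof -
      have "norm (vector [x, y] :: complex^2) \<le> M"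
      proof -
        have "norm (vector [x, y] :: complex^2) \<le> a + b" using norm_vec2_le[of "vector [x, y]"] by (simp add: a_def b_def)
        then show ?thesis unfolding P_defs[symmetric] M_def using that pos V0 S L R by linarith
      qed
      then show ?thesis by (intro exI[of _ XY]) (simp add: xy_image_def from_xy_def)
    qed
    have UW6: "\<exists>c. vector [x, y] \<in> xy_image c \<and> norm (from_xy \<theta> \<kappa> c z (vector [x, y])) \<le> M"
      if am: "a * m \<le> S" and m: "m \<le> S" and a1: "a \<ge> 1"
    proof -
      have x: "x \<noteq> 0" using a1 by (auto simp: a_def)
      let ?u = "x^2 * (y - x + 2*z) + 2*(\<kappa> - \<theta> - 1)*x"
      have xf: "norm (x * f) \<le> S" using am by (simp add: norm_mult a_def m_def)
      \<comment> \<open>As in the transition to chart (b), \<open>2 * x\<close> is split off the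
        quotient so that it cancels the pole of \<open>H\<close>.\<close>
      have "x - x / ?Q = x * f * cnj f / ?Q" using Q by (simp add: field_simps)
      moreover have "2*x / q = 2*x - 2 * (x - x / q)" for q by (simp add: algebra_simps)
      ultimately have e: "2*x / ?Q = 2*x - 2 * (x * f * cnj f / ?Q)" by metis
      obtain B where B: "x * f * cnj f / ?Q = B" by blast
      have "?u = ?V - (x*f)*f + 2*z*(x*f) - 4*\<theta>*z + 2*\<theta>*f - 2 * B"
        using f_def unfolding Veq e B by algebra
      then have "?u = ?V - (x*f)*f + 2*z*(x*f) - 4*\<theta>*z + 2*\<theta>*f - 2 * (x * f * cnj f / ?Q)"
        unfolding B .
      also have "norm \<dots> \<le> V0 + S * S + 2 * R * S + 4 * norm \<theta> * R + 2 * norm \<theta> * S + 2 * (S * S)"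
      proof -
        have 1: "norm ((x*f)*f) \<le> S * S" unfolding norm_mult[of "x*f"] using xf m by (intro mult_mono) (auto simp: m_def intro: order_trans[OF norm_ge_zero])
        have 2: "norm (2*z*(x*f)) \<le> 2 * R * S" unfolding norm_mult[of "2*z"] using xf z2 R by (intro mult_mono) auto
        have 3: "norm (4*\<theta>*z) \<le> 4 * norm \<theta> * R" using z by (simp add: norm_mult mult_left_mono)
        have 4: "norm (2*\<theta>*f) \<le> 2 * norm \<theta> * S" using m by (simp add: norm_mult m_def mult_left_mono)
        have "norm (x * f * cnj f / ?Q) \<le> norm (x * f * cnj f) / 1"
          unfolding norm_divide nQ by (intro divide_left_mono) (auto simp: add_pos_nonneg)
        also have "\<dots> \<le> S * S" using 1 by (simp add: norm_mult)
        finally have 5: "norm (2 * (x * f * cnj f / ?Q)) \<le> 2 * (S * S)" unfolding n2 by (rule mult_left_mono) simp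
        have tri: "norm (v - p + q - r + s - t) \<le> norm v + norm p + norm q + norm r + norm s + norm t" for v p q r s t :: complex
          using norm_triangle_ineq4[of "v - p + q - r + s" t] norm_triangle_ineq[of "v - p + q - r" s]
            norm_triangle_ineq4[of "v - p + q" r] norm_triangle_ineq[of "v - p" q] norm_triangle_ineq4[of v p] by linarith
        show ?thesis using tri[of ?V "(x*f)*f" "2*z*(x*f)" "4*\<theta>*z" "2*\<theta>*f" "2 * (x * f * cnj f / ?Q)"] V 1 2 3 4 5 by linarith
      qed
      also have "\<dots> \<le> M - 1" unfolding P_defs[symmetric] M_def using pos V0 S L R by linarith
      finally have "norm (vector [?u, 1 / x] :: complex^2) \<le> M"
        using inv[of x] a1 by (intro M_uw) (simp_all add: a_def)
      then show ?thesis using x by (intro exI[of _ UW6]) (simp add: xy_image_def from_xy_def)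
    qed
    have UW3: "\<exists>c. vector [x, y] \<in> xy_image c \<and> norm (from_xy \<theta> \<kappa> c z (vector [x, y])) \<le> M"
      if ab: "a * b \<le> S" and bS: "b \<le> S" and a1: "a \<ge> 1"
    proof -
      have x: "x \<noteq> 0" using a1 by (auto simp: a_def)
      let ?u = "x^2 * y - 2*\<kappa>*x"
      have xy: "norm (x * y) \<le> S" using ab by (simp add: norm_mult a_def b_def)
      have "?u = - ?V + (x*y)*y + 2*z*(x*y) - 2*\<theta>*y - 2*(x / ?Q)"
        unfolding Veq unfolding f_def by (simp add: algebra_simps power2_eq_square)
      also have "norm \<dots> \<le> V0 + S * S + 2 * R * S + 2 * norm \<theta> * S + (2 * S + 4 * R + 2)"
      proof -
        have 1: "norm ((x*y)*y) \<le> S * S" unfolding norm_mult[of "x*y"] using xy bS by (intro mult_mono) (auto simp: b_def intro: order_trans[OF norm_ge_zero])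
        have 2: "norm (2*z*(x*y)) \<le> 2 * R * S" unfolding norm_mult[of "2*z"] using xy z2 R by (intro mult_mono) auto
        have 4: "norm (2*\<theta>*y) \<le> 2 * norm \<theta> * S" using bS by (simp add: norm_mult b_def mult_left_mono)
        have 5: "norm (2 * (x / ?Q)) \<le> 2 * S + 4 * R + 2" unfolding n2 using xQ(2) bS by linarith
        have tri: "norm (- v + p + q - r - s) \<le> norm v + norm p + norm q + norm r + norm s" for v p q r s :: complex
          using norm_triangle_ineq4[of "- v + p + q - r" s] norm_triangle_ineq4[of "- v + p + q" r]
            norm_triangle_ineq[of "- v + p" q] norm_triangle_ineq[of "- v" p] by simp
        show ?thesis using tri[of ?V "(x*y)*y" "2*z*(x*y)" "2*\<theta>*y" "2 * (x / ?Q)"] V 1 2 4 5 by linarith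
      qed
      also have "\<dots> \<le> M - 1" unfolding P_defs[symmetric] M_def using pos V0 S L R by linarith
      finally have "norm (vector [?u, 1 / x] :: complex^2) \<le> M"
        using inv[of x] a1 by (intro M_uw) (simp_all add: a_def)
      then show ?thesis using x by (intro exI[of _ UW3]) (simp add: xy_image_def from_xy_def)
    qed
    have UW9: "\<exists>c. vector [x, y] \<in> xy_image c \<and> norm (from_xy \<theta> \<kappa> c z (vector [x, y])) \<le> M"
      if ab: "a * b \<le> S" and aS: "a \<le> S" and b1: "b \<ge> 1"
    proof -
      have y: "y \<noteq> 0" using b1 by (auto simp: b_def)
      let ?u = "y^2 * x - 2*\<theta>*y"
      have xy: "norm (x * y) \<le> S" using ab by (simp add: norm_mult a_def b_def)
      have "?u = ?V + (x*y)*x - 2*z*(x*y) - 2*\<kappa>*x + 2*(x / ?Q)"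
        unfolding Veq unfolding f_def by (simp add: algebra_simps power2_eq_square)
      also have "norm \<dots> \<le> V0 + S * S + 2 * R * S + 2 * norm \<kappa> * S + 2 * S"
      proof -
        have 1: "norm ((x*y)*x) \<le> S * S" unfolding norm_mult[of "x*y"] using xy aS by (intro mult_mono) (auto simp: a_def intro: order_trans[OF norm_ge_zero])
        have 2: "norm (2*z*(x*y)) \<le> 2 * R * S" unfolding norm_mult[of "2*z"] using xy z2 R by (intro mult_mono) auto
        have 4: "norm (2*\<kappa>*x) \<le> 2 * norm \<kappa> * S" using aS by (simp add: norm_mult a_def mult_left_mono)
        have 5: "norm (2 * (x / ?Q)) \<le> 2 * S" unfolding n2 by (rule mult_left_mono[OF order_trans[OF xQ(1)]]) (use aS a_def in auto)
        have tri: "norm (v + p - q - r + s) \<le> norm v + norm p + norm q + norm r + norm s" for v p q r s :: complex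
          using norm_triangle_ineq[of "v + p - q - r" s] norm_triangle_ineq4[of "v + p - q" r]
            norm_triangle_ineq4[of "v + p" q] norm_triangle_ineq[of v p] by linarith
        show ?thesis using tri[of ?V "(x*y)*x" "2*z*(x*y)" "2*\<kappa>*x" "2 * (x / ?Q)"] V 1 2 4 5 by linarith
      qed
      also have "\<dots> \<le> M - 1" unfolding P_defs[symmetric] M_def using pos V0 S L R by linarith
      finally have "norm (vector [?u, 1 / y] :: complex^2) \<le> M"
        using inv[of y] b1 by (intro M_uw) (simp_all add: b_def)
      then show ?thesis using y by (intro exI[of _ UW9]) (simp add: xy_image_def from_xy_def)
    qed
    show "\<exists>c. vector [x, y] \<in> xy_image c \<and> norm (from_xy \<theta> \<kappa> c z (vector [x, y])) \<le> M"
    proof (cases "a \<le> b")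
      case ab: True
      show ?thesis
      proof (cases "b \<ge> 1")
        case b1: True
        have Kab: "K * a \<le> K * b" "V0 * 1 \<le> V0 * b" using ab K V0 b1 by (intro mult_left_mono; simp)+
        have "(a * m) * b \<le> L * b" using P Kab by (simp add: L_def algebra_simps)
        then have am: "a * m \<le> L" using b1 by simp
        show ?thesis
        \<comment> \<open>The product of these two moduli is at most \<open>L\<close>, so by
          \<open>sq\<close> the smaller one is at most \<open>L + 1\<close>; it decides the
          chart.\<close>
        proof (cases "m \<le> a")
          case True
          then have "m * m \<le> L" using am nn mult_right_mono[of m a m] by linarith
          then have mL: "m \<le> L + 1" using sq nn by blast
          show ?thesis
          proof (cases "a \<ge> 1")
            case True
            then show ?thesis using am mL S L by (intro UW6) auto
          next
            case False
            then show ?thesis using \<open>m \<le> a\<close> b by (intro fin) (use R in auto)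
          qed
        next
          case False
          then have "a * a \<le> L" using am nn mult_left_mono[of a m a] by linarith
          then have aL: "a \<le> L + 1" using sq nn by blast
          have "a * b \<le> a * (a + m + 2 * R)" using b nn by (intro mult_left_mono)
          also have "\<dots> = a * a + a * m + 2 * R * a" by (simp add: algebra_simps)
          also have "\<dots> \<le> L + L + 2 * R * (L + 1)" using \<open>a * a \<le> L\<close> am aL R by (intro add_mono mult_left_mono) auto
          also have "\<dots> \<le> S" using L by (simp add: S_def)
          finally show ?thesis using aL S b1 by (intro UW9) auto
        qed
      next
        case False
        then show ?thesis using ab R by (intro fin) auto
      qed
    next
      case ab: False
      show ?thesis
      proof (cases "a \<ge> 1")
        case a1: True
        have Kab: "K * b \<le> K * a" "V0 * 1 \<le> V0 * a" using ab K V0 a1 by (intro mult_left_mono; simp)+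
        have "(b * m) * a \<le> L * a" using P Kab by (simp add: L_def algebra_simps)
        then have bm: "b * m \<le> L" using a1 by simp
        show ?thesis
        proof (cases "m \<le> b")
          case True
          then have mm: "m * m \<le> L" using bm nn mult_right_mono[of m b m] by linarith
          then have mL: "m \<le> L + 1" using sq nn by blast
          have "a * m \<le> (b + m + 2 * R) * m" using a nn by (intro mult_right_mono)
          also have "\<dots> = b * m + m * m + 2 * R * m" by (simp add: algebra_simps)
          also have "\<dots> \<le> L + L + 2 * R * (L + 1)" using mm bm mL R by (intro add_mono mult_left_mono) auto
          also have "\<dots> \<le> S" using L by (simp add: S_def)
          finally show ?thesis using mL S a1 by (intro UW6) auto
        next
          case False
          then have bb: "b * b \<le> L" using bm nn mult_left_mono[of b m b] by linarith
          then have bL: "b \<le> L + 1" using sq nn by blast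
          have "a * b \<le> (b + m + 2 * R) * b" using a nn by (intro mult_right_mono)
          also have "\<dots> = b * b + b * m + 2 * R * b" by (simp add: algebra_simps)
          also have "\<dots> \<le> L + L + 2 * R * (L + 1)" using bb bm bL R by (intro add_mono mult_left_mono) auto
          also have "\<dots> \<le> S" using L by (simp add: S_def)
          finally show ?thesis using bL S a1 by (intro UW3) auto
        qed
      next
        case False
        then show ?thesis using ab R by (intro fin) auto
      qed
    qed
  qed
qed

text \<open>At a point with \<open>w = 0\<close> the function is \<open>u\<close> or
  \<open>- u\<close> plus a multiple of \<open>z\<close>, which bounds \<open>u\<close> directly;
  all other points reduce to \<open>(x, y)\<close>.\<close>

lemma aux_fun_sublevel_bounded:
  fixes \<theta> \<kappa> :: complex and R V0 :: real
  assumes R: "R \<ge> 0" and V0: "V0 \<ge> 0"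
  obtains M where "\<And>c p z. norm z \<le> R \<Longrightarrow> norm (aux_fun \<theta> \<kappa> c z p) \<le> V0 \<Longrightarrow>
     \<exists>d q. chart_pt \<theta> \<kappa> d z q = chart_pt \<theta> \<kappa> c z p \<and> norm q \<le> M"
proof -
  obtain M1 where M1: "\<And>x y z. norm z \<le> R \<Longrightarrow> norm (aux_fun \<theta> \<kappa> XY z (vector [x, y])) \<le> V0 \<Longrightarrow>
     \<exists>c. vector [x, y] \<in> xy_image c \<and> norm (from_xy \<theta> \<kappa> c z (vector [x, y])) \<le> M1"
    by (rule aux_fun_sublevel_bounded_xy[OF R V0]) (rule that)
  define M where "M = max M1 (V0 + 4 * R * (norm \<theta> + norm \<kappa> + norm (\<theta> + 1 - \<kappa>) + norm \<theta>))"
  show thesis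
  proof (rule that[of M])
    fix c p z assume z: "norm z \<le> R" and V: "norm (aux_fun \<theta> \<kappa> c z p) \<le> V0"
    show "\<exists>d q. chart_pt \<theta> \<kappa> d z q = chart_pt \<theta> \<kappa> c z p \<and> norm q \<le> M"
    proof (cases "p \<in> chart_dom c")
      case True
      define v where "v = to_xy \<theta> \<kappa> c z p"
      have "norm (aux_fun \<theta> \<kappa> XY z v) \<le> V0" using V aux_fun_to_xy[OF True] by (simp add: v_def)
      then obtain d where d: "v \<in> xy_image d" "norm (from_xy \<theta> \<kappa> d z v) \<le> M1"
        using M1[OF z, of "v $ 1" "v $ 2"] by (auto simp: vec2_eta)
      then have "chart_pt \<theta> \<kappa> d z (from_xy \<theta> \<kappa> d z v) = chart_pt \<theta> \<kappa> c z p"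
        using True to_xy_from_xy[OF d(1)] by (simp add: chart_pt_eq_iff v_def)
      then show ?thesis using d(2) by (intro exI[of _ d] exI[of _ "from_xy \<theta> \<kappa> d z v"]) (simp add: M_def)
    next
      case False
      then have c: "c \<noteq> XY" and w: "p $ 2 = 0" by (auto simp: chart_dom_def)
      define u where "u = p $ 1"
      have zt: "norm (4 * t * z) \<le> 4 * R * norm t" for t :: complex
        using z mult_right_mono[of "norm z" R "norm t"] by (simp add: norm_mult mult_ac)
      have "norm u \<le> M"
      proof (cases c)
        case UW3
        have "u = 4 * \<kappa> * z - aux_fun \<theta> \<kappa> c z p" by (simp add: UW3 aux_fun_def Let_def w u_def)
        then have "norm u \<le> 4 * R * norm \<kappa> + V0" using norm_triangle_ineq4 zt[of \<kappa>] V by (metis add_mono order_trans)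
        also have "\<dots> \<le> M" using R by (simp add: M_def algebra_simps le_max_iff_disj)
        finally show ?thesis .
      next
        case UW6
        have "u = aux_fun \<theta> \<kappa> c z p + (4 * (\<theta> + 1 - \<kappa>) * z - 4 * \<theta> * z)"
          by (simp add: UW6 aux_fun_def Let_def w u_def algebra_simps)
        also have "norm \<dots> \<le> V0 + (4 * R * norm (\<theta> + 1 - \<kappa>) + 4 * R * norm \<theta>)"
          using V norm_triangle_ineq[of "aux_fun \<theta> \<kappa> c z p" "4 * (\<theta> + 1 - \<kappa>) * z - 4 * \<theta> * z"]
            norm_triangle_ineq4[of "4 * (\<theta> + 1 - \<kappa>) * z" "4 * \<theta> * z"] zt[of "\<theta> + 1 - \<kappa>"] zt[of \<theta>] by linarith
        also have "\<dots> \<le> M" using R by (simp add: M_def algebra_simps le_max_iff_disj)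
        finally show ?thesis .
      next
        case UW9
        have "u = aux_fun \<theta> \<kappa> c z p - 4 * \<theta> * z" by (simp add: UW9 aux_fun_def Let_def w u_def)
        then have "norm u \<le> V0 + 4 * R * norm \<theta>" using norm_triangle_ineq4 zt[of \<theta>] V by (metis add_mono order_trans)
        also have "\<dots> \<le> M" using R by (simp add: M_def algebra_simps le_max_iff_disj)
        finally show ?thesis .
      qed (use c in simp)
      moreover have "norm p \<le> norm u" using norm_vec2_le[of p] w by (simp add: u_def)
      ultimately show ?thesis by (intro exI[of _ c] exI[of _ p]) auto
    qed
  qed
qed

text \<open>Because of the conjugate the function is differentiated along a real curve.
  \<open>H\<close> contributes \<open>2 * x * y\<close>, the numerator of the subtracted quotient
  contributes \<open>x'\<close>, and its denominator the second summand of the growth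
  estimate.\<close>

lemma aux_fun_along_solution:
  fixes \<gamma> :: "real \<Rightarrow> complex"
  assumes v: "solution_on (chart_field \<theta> \<kappa> XY) D v" and \<gamma>: "(\<gamma> has_vector_derivative e) (at t)" "\<gamma> t \<in> D"
    and R: "norm (\<gamma> t) \<le> R"
    and C: "\<And>x y z. norm z \<le> R \<Longrightarrow>
     norm (2*x*y - 2 * (PIV \<theta> \<kappa> z (vector [x, y]) $ 1) / (1 + (y - x + 2*z) * cnj (y - x + 2*z)))
       + 4 * norm x * norm (y - x + 2*z) *
         norm (PIV \<theta> \<kappa> z (vector [x, y]) $ 2 - PIV \<theta> \<kappa> z (vector [x, y]) $ 1 + 2) / (1 + (norm (y - x + 2*z))^2)^2
     \<le> C * (1 + norm (aux_fun \<theta> \<kappa> XY z (vector [x, y])))"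
  shows "\<exists>W. ((\<lambda>t. aux_fun \<theta> \<kappa> XY (\<gamma> t) (v (\<gamma> t))) has_vector_derivative W) (at t) \<and>
     norm W \<le> norm e * (C * (1 + norm (aux_fun \<theta> \<kappa> XY (\<gamma> t) (v (\<gamma> t)))))"
proof -
  let ?z = "\<gamma> t"
  define x y where "x = v ?z $ 1" and "y = v ?z $ 2"
  define X Y where "X t = v (\<gamma> t) $ 1" and "Y t = v (\<gamma> t) $ 2" for t
  define F where "F t = Y t - X t + 2 * \<gamma> t" for t
  define x' y' where "x' = PIV \<theta> \<kappa> ?z (vector [x, y]) $ 1" and "y' = PIV \<theta> \<kappa> ?z (vector [x, y]) $ 2"
  define f f' where "f = y - x + 2 * ?z" and "f' = y' - x' + 2"
  define q where "q = 1 + f * cnj f"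
  have q0: "q \<noteq> 0" unfolding q_def by (rule one_plus_mult_cnj_nonzero)
  have vz: "v ?z = vector [x, y]" by (simp add: x_def y_def vec2_eta)
  have "((\<lambda>t. v t $ k) has_field_derivative PIV \<theta> \<kappa> ?z (v ?z) $ k) (at ?z)" for k
    using v \<gamma>(2) unfolding solution_on_def by (auto simp: chart_field_def)
  note d = field_vector_diff_chain_at[OF \<gamma>(1) this, unfolded o_def]
  have dX: "(X has_vector_derivative e * x') (at t)" and dY: "(Y has_vector_derivative e * y') (at t)"
    using d[of 1] d[of 2] unfolding X_def Y_def x'_def y'_def vz by auto
  have d2: "((\<lambda>t. 2 * \<gamma> t) has_vector_derivative 2 * e) (at t)"
    by (rule has_vector_derivative_mult_right[OF \<gamma>(1)])
  have dF: "(F has_vector_derivative e * f') (at t)"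
    using has_vector_derivative_add[OF has_vector_derivative_diff[OF dY dX] d2]
    unfolding F_def f'_def by (simp add: algebra_simps)
  define Q where "Q t = 1 + F t * cnj (F t)" for t
  have Ft: "F t = f" "X t = x" "Y t = y" by (simp_all add: F_def f_def X_def Y_def x_def y_def)
  have Qt: "Q t = q" by (simp add: Q_def q_def Ft)
  have dQ: "(Q has_vector_derivative f * cnj (e * f') + e * f' * cnj f) (at t)"
    using has_vector_derivative_add[OF has_vector_derivative_const has_vector_derivative_mult[OF dF has_vector_derivative_cnj[OF dF]], of 1]
    unfolding Q_def by (simp add: Ft)
  have "(inverse has_field_derivative - (inverse q ^ Suc (Suc 0))) (at (Q t))"
    unfolding Qt by (rule DERIV_inverse[OF q0])
  from field_vector_diff_chain_at[OF dQ this]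
  have dI: "((\<lambda>t. inverse (Q t)) has_vector_derivative (f * cnj (e * f') + e * f' * cnj f) * - (inverse q ^ 2)) (at t)"
    by (simp add: o_def numeral_2_eq_2)
  have Veq: "aux_fun \<theta> \<kappa> XY (\<gamma> t) (v (\<gamma> t)) = X t * Y t * F t - 2*\<theta> * Y t + 2*\<kappa> * X t - 2 * (X t * inverse (Q t))" for t
    by (simp add: aux_fun_def Let_def X_def Y_def F_def Q_def divide_inverse)
  define W where "W = (x * y * (e * f') + (x * (e * y') + e * x' * y) * f) - 2*\<theta> * (e * y') + 2*\<kappa> * (e * x')
      - 2 * (x * ((f * cnj (e * f') + e * f' * cnj f) * - (inverse q ^ 2)) + e * x' * inverse q)"
  have dV: "((\<lambda>t. aux_fun \<theta> \<kappa> XY (\<gamma> t) (v (\<gamma> t))) has_vector_derivative W) (at t)"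
    unfolding Veq W_def
    using has_vector_derivative_diff[OF has_vector_derivative_add[OF has_vector_derivative_diff[OF
            has_vector_derivative_mult[OF has_vector_derivative_mult[OF dX dY] dF]
            has_vector_derivative_mult_right[OF dY, of "2*\<theta>"]] has_vector_derivative_mult_right[OF dX, of "2*\<kappa>"]]
            has_vector_derivative_mult_right[OF has_vector_derivative_mult[OF dX dI], of 2]]
    by (simp only: Ft Qt)
  \<comment> \<open>By the Hamiltonian form of the system, the derivative of \<open>H\<close> along
    a solution is the partial derivative in \<open>z\<close>.\<close>
  have H: "(x * y * f' + (x * y' + x' * y) * f) - 2*\<theta> * y' + 2*\<kappa> * x' = 2 * x * y"
    unfolding f'_def x'_def y'_def f_def PIV_def Let_def vector_2 by algebra
  have W: "W = e * (2 * x * y - 2 * x' / q) + 2 * x * ((f * cnj (e * f') + e * f' * cnj f) / q^2)"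
  proof -
    have "W = e * ((x * y * f' + (x * y' + x' * y) * f) - 2*\<theta> * y' + 2*\<kappa> * x') - 2 * (e * x' * inverse q)
        + 2 * x * ((f * cnj (e * f') + e * f' * cnj f) * inverse q ^ 2)"
      unfolding W_def by algebra
    then show ?thesis unfolding H by (simp add: divide_inverse power_inverse algebra_simps)
  qed
  have "norm ((f * cnj (e * f') + e * f' * cnj f) / q^2) \<le> 2 * (norm f * (norm e * norm f')) / (norm q)^2"
    unfolding norm_divide norm_power
    using norm_triangle_ineq[of "f * cnj (e * f')" "e * f' * cnj f"]
    by (intro divide_right_mono) (simp_all add: norm_mult algebra_simps)
  moreover have "norm (2 * x * T) \<le> 2 * norm x * B" if "norm T \<le> B" for T B
    using mult_left_mono[OF that, of "2 * norm x"] by (simp add: norm_mult)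
  ultimately have "norm (2 * x * ((f * cnj (e * f') + e * f' * cnj f) / q^2)) \<le> 2 * norm x * (2 * (norm f * (norm e * norm f')) / (norm q)^2)"
    by blast
  then have "norm W \<le> norm e * norm (2 * x * y - 2 * x' / q) + 2 * norm x * (2 * (norm f * (norm e * norm f')) / (norm q)^2)"
    unfolding W using norm_triangle_ineq[of "e * (2 * x * y - 2 * x' / q)" "2 * x * ((f * cnj (e * f') + e * f' * cnj f) / q^2)"]
    unfolding norm_mult[of e] by linarith
  also have "\<dots> = norm e * (norm (2 * x * y - 2 * x' / q) + 4 * norm x * norm f * norm f' / (norm q)^2)"
    by (simp add: algebra_simps)
  also have "\<dots> \<le> norm e * (C * (1 + norm (aux_fun \<theta> \<kappa> XY ?z (v ?z))))"
    using C[OF R, of x y] unfolding vz q_def norm_one_plus_mult_cnj f_def f'_def x'_def y'_def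
    by (intro mult_left_mono) auto
  finally show ?thesis using dV by blast
qed

text \<open>Gronwall's argument in logarithmic form. \<open>ln (1 + (norm \<Phi>)^2)\<close> is
  differentiable also where \<open>\<Phi>\<close> vanishes, and
  \<open>2 * n * (1 + n) \<le> 4 * (1 + n^2)\<close> gives the constant 4.\<close>

lemma log_derivative_bound:
  fixes \<Phi> :: "real \<Rightarrow> complex"
  assumes "(\<Phi> has_vector_derivative W) (at t)" "norm W \<le> L * (1 + norm (\<Phi> t))" "L \<ge> 0"
  shows "\<exists>D. ((\<lambda>t. ln (1 + (norm (\<Phi> t))^2)) has_real_derivative D) (at t) \<and> \<bar>D\<bar> \<le> 4 * L"
proof -
  let ?n = "norm (\<Phi> t)"
  have pos: "1 + \<Phi> t \<bullet> \<Phi> t > 0" by (simp add: add_pos_nonneg)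
  have "((\<lambda>t. \<Phi> t \<bullet> \<Phi> t) has_vector_derivative (\<Phi> t \<bullet> W + W \<bullet> \<Phi> t)) (at t)"
    by (rule bounded_bilinear.has_vector_derivative[OF bounded_bilinear_inner assms(1) assms(1)])
  then have "((\<lambda>t. 1 + \<Phi> t \<bullet> \<Phi> t) has_real_derivative (0 + (\<Phi> t \<bullet> W + W \<bullet> \<Phi> t))) (at t)"
    unfolding has_real_derivative_iff_has_vector_derivative by (intro has_vector_derivative_add has_vector_derivative_const)
  from DERIV_chain2[OF DERIV_ln[OF pos] this]
  have d: "((\<lambda>t. ln (1 + (norm (\<Phi> t))^2)) has_real_derivative (2 * (\<Phi> t \<bullet> W) / (1 + ?n^2))) (at t)"
    by (simp add: power2_norm_eq_inner inner_commute divide_inverse mult_ac)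
  have "\<bar>2 * (\<Phi> t \<bullet> W)\<bar> \<le> 2 * (?n * (L * (1 + ?n)))"
  proof -
    have "\<bar>\<Phi> t \<bullet> W\<bar> \<le> ?n * norm W" by (rule Cauchy_Schwarz_ineq2)
    also have "\<dots> \<le> ?n * (L * (1 + ?n))" using assms(2) by (intro mult_left_mono) auto
    finally show ?thesis by simp
  qed
  also have "2 * (?n * (L * (1 + ?n))) = L * (2 * ?n + 2 * ?n^2)" by (simp add: algebra_simps power2_eq_square)
  also have "\<dots> \<le> L * (4 * (1 + ?n^2))"
  proof (rule mult_left_mono[OF _ assms(3)])
    have "2 * ?n \<le> ?n^2 + 1" using sum_squares_bound[of ?n 1] by simp
    moreover have "?n^2 \<ge> 0" by simp
    ultimately show "2 * ?n + 2 * ?n^2 \<le> 4 * (1 + ?n^2)" by argo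
  qed
  finally have "\<bar>2 * (\<Phi> t \<bullet> W)\<bar> \<le> 4 * L * (1 + ?n^2)" by (simp add: algebra_simps)
  then have "\<bar>2 * (\<Phi> t \<bullet> W) / (1 + ?n^2)\<bar> \<le> 4 * L"
    by (simp add: abs_divide divide_le_eq add_pos_nonneg abs_of_pos)
  with d show ?thesis by blast
qed

text \<open>For given parameters \<open>L\<close> depends only on \<open>R\<close>, not on the
  section or the disc. On the segment from \<open>z0\<close> to \<open>z\<close> the logarithm is
  continuous, and away from the isolated meetings with the curves at infinity its derivative is
  bounded by \<open>L\<close>.\<close>

lemma aux_on_section_bound:
  assumes R: "R \<ge> 0"
  obtains L where "L \<ge> 0" "\<And>z0 \<rho> s z. solution_section \<theta> \<kappa> (ball z0 \<rho>) s \<Longrightarrow> norm z0 + \<rho> \<le> R \<Longrightarrow> z \<in> ball z0 \<rho> \<Longrightarrow>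
    ln (1 + (norm (aux_on_section \<theta> \<kappa> z (s z)))^2) \<le> ln (1 + (norm (aux_on_section \<theta> \<kappa> z0 (s z0)))^2) + L"
proof -
  obtain C where C: "C > 0" "\<And>x y z. norm z \<le> R \<Longrightarrow>
     norm (2*x*y - 2 * (PIV \<theta> \<kappa> z (vector [x, y]) $ 1) / (1 + (y - x + 2*z) * cnj (y - x + 2*z)))
       + 4 * norm x * norm (y - x + 2*z) *
         norm (PIV \<theta> \<kappa> z (vector [x, y]) $ 2 - PIV \<theta> \<kappa> z (vector [x, y]) $ 1 + 2) / (1 + (norm (y - x + 2*z))^2)^2
     \<le> C * (1 + norm (aux_fun \<theta> \<kappa> XY z (vector [x, y])))"
    by (rule aux_fun_growth[OF R, of \<theta> \<kappa>]) (rule that)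
  \<comment> \<open>The 4 comes from \<open>log_derivative_bound\<close>; \<open>2 * R\<close>
    bounds the length of the segment.\<close>
  define L where "L = 4 * (2 * R * C)"
  show thesis
  proof (rule that[of L])
    show "L \<ge> 0" using R C(1) by (simp add: L_def)
    fix z0 \<rho> s z1 assume s: "solution_section \<theta> \<kappa> (ball z0 \<rho>) s" and \<rho>: "norm z0 + \<rho> \<le> R" and z1: "z1 \<in> ball z0 \<rho>"
    let ?D = "ball z0 \<rho>"
    define e where "e = z1 - z0"
    define \<gamma> where "\<gamma> t = z0 + of_real t * e" for t :: real
    define \<psi> where "\<psi> t = ln (1 + (norm (aux_on_section \<theta> \<kappa> (\<gamma> t) (s (\<gamma> t))))^2)" for t
    have DR: "norm z \<le> R" if "z \<in> ?D" for z
      using that \<rho> norm_triangle_sub[of z z0] by (simp add: dist_norm norm_minus_commute)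
    have "\<rho> > 0" using z1 by (metis ball_empty empty_iff not_le)
    then have z0D: "z0 \<in> ?D" by simp
    have eR: "norm e \<le> 2 * R"
      using norm_triangle_ineq4[of z1 z0] DR[OF z1] DR[OF z0D] by (simp add: e_def)
    have \<gamma>D: "\<gamma> t \<in> ?D" if "0 \<le> t" "t \<le> 1" for t
    proof -
      have "\<gamma> t = (1 - t) *\<^sub>R z0 + t *\<^sub>R z1" by (simp add: \<gamma>_def e_def scaleR_conv_of_real algebra_simps)
      then show ?thesis using convexD_alt[OF convex_ball z0D z1 that] by simp
    qed
    have d\<gamma>: "(\<gamma> has_vector_derivative e) (at t)" for t
      unfolding \<gamma>_def by (auto intro!: derivative_eq_intros)
    have cont\<gamma>: "isCont \<gamma> t" for t
      using d\<gamma> has_vector_derivative_continuous by blast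
    have cont: "isCont \<psi> t" if t: "\<gamma> t \<in> ?D" for t
    proof -
      obtain c v \<epsilon> where v: "\<epsilon> > 0" "ball (\<gamma> t) \<epsilon> \<subseteq> ?D" "solution_on (chart_field \<theta> \<kappa> c) (ball (\<gamma> t) \<epsilon>) v"
        "\<And>r. r \<in> ball (\<gamma> t) \<epsilon> \<Longrightarrow> s r = chart_pt \<theta> \<kappa> c r (v r)" "c = XY \<or> v (\<gamma> t) $ 2 = 0"
        by (rule solution_sectionE[OF s t]) (rule that)
      have "isCont v (\<gamma> t)" using solution_on_imp_isCont[OF v(3)] v(1) by simp
      then have "isCont (\<lambda>r. aux_fun \<theta> \<kappa> c (\<gamma> r) (v (\<gamma> r))) t"
        by (intro isCont_aux_fun cont\<gamma> isCont_o2[OF cont\<gamma>])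
      then have "isCont (\<lambda>r. ln (1 + (norm (aux_fun \<theta> \<kappa> c (\<gamma> r) (v (\<gamma> r))))^2)) t"
        by (intro continuous_intros) (auto simp: add_pos_nonneg less_imp_neq[THEN not_sym])
      moreover have "\<forall>\<^sub>F r in nhds t. ln (1 + (norm (aux_fun \<theta> \<kappa> c (\<gamma> r) (v (\<gamma> r))))^2) = \<psi> r"
      proof -
        have "\<forall>\<^sub>F r in nhds t. \<gamma> r \<in> ball (\<gamma> t) \<epsilon>"
          unfolding eventually_nhds_conv_at
          using topological_tendstoD[OF cont\<gamma>[unfolded isCont_def] open_ball, of t "\<gamma> t" \<epsilon>] v(1) by simp
        then show ?thesis
        proof eventually_elim
          case (elim r)
          show ?case unfolding \<psi>_def v(4)[OF elim] aux_on_section_chart_pt ..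
        qed
      qed
      ultimately show ?thesis by (rule iffD1[OF isCont_cong, rotated])
    qed
    have deriv: "\<exists>d. (\<psi> has_real_derivative d) (at t) \<and> \<bar>d\<bar> \<le> L"
      if t: "\<gamma> t \<in> ?D" and XY: "s (\<gamma> t) \<in> range (chart_pt \<theta> \<kappa> XY (\<gamma> t))" for t
    proof -
      obtain c v \<epsilon> where v: "\<epsilon> > 0" "ball (\<gamma> t) \<epsilon> \<subseteq> ?D" "solution_on (chart_field \<theta> \<kappa> c) (ball (\<gamma> t) \<epsilon>) v"
        "\<And>r. r \<in> ball (\<gamma> t) \<epsilon> \<Longrightarrow> s r = chart_pt \<theta> \<kappa> c r (v r)" "c = XY \<or> v (\<gamma> t) $ 2 = 0"
        by (rule solution_sectionE[OF s t]) (rule that)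
      have mem: "\<gamma> t \<in> ball (\<gamma> t) \<epsilon>" using v(1) by simp
      have c: "c = XY" using XY v(4)[OF mem] v(5) by (auto simp: chart_pt_eq_iff chart_dom_def)
      obtain W where W: "((\<lambda>t. aux_fun \<theta> \<kappa> XY (\<gamma> t) (v (\<gamma> t))) has_vector_derivative W) (at t)"
        "norm W \<le> norm e * (C * (1 + norm (aux_fun \<theta> \<kappa> XY (\<gamma> t) (v (\<gamma> t)))))"
        using aux_fun_along_solution[OF v(3)[unfolded c] d\<gamma> mem DR[OF t] C(2)] by blast
      note W(2)
      also have "norm e * (C * (1 + norm (aux_fun \<theta> \<kappa> XY (\<gamma> t) (v (\<gamma> t))))) \<le>
          (2 * R * C) * (1 + norm (aux_fun \<theta> \<kappa> XY (\<gamma> t) (v (\<gamma> t))))"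
        unfolding mult.assoc[symmetric] using eR C(1) by (intro mult_right_mono) auto
      finally obtain d where d: "((\<lambda>t. ln (1 + (norm (aux_fun \<theta> \<kappa> XY (\<gamma> t) (v (\<gamma> t))))^2)) has_real_derivative d) (at t)"
        "\<bar>d\<bar> \<le> L"
        using log_derivative_bound[OF W(1), of "2 * R * C"] R C(1) unfolding L_def by auto
      have "open (\<gamma> -` ball (\<gamma> t) \<epsilon>)"
        by (intro open_vimage open_ball continuous_at_imp_continuous_on ballI cont\<gamma>)
      then have "(\<psi> has_real_derivative d) (at t)"
      proof (rule has_field_derivative_transform_within_open[OF d(1)])
        show "t \<in> \<gamma> -` ball (\<gamma> t) \<epsilon>" using mem by simp
        fix r assume "r \<in> \<gamma> -` ball (\<gamma> t) \<epsilon>"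
        then have "\<gamma> r \<in> ball (\<gamma> t) \<epsilon>" by simp
        from v(4)[OF this] show "ln (1 + (norm (aux_fun \<theta> \<kappa> XY (\<gamma> r) (v (\<gamma> r))))^2) = \<psi> r"
          unfolding \<psi>_def c by (simp add: aux_on_section_chart_pt)
      qed
      then show ?thesis using d(2) by blast
    qed
    have "\<psi> 1 - \<psi> 0 \<le> L * (1 - 0)"
    proof (rule Bolzano[where P = "\<lambda>a b. \<psi> b - \<psi> a \<le> L * (b - a)"])
      show "\<psi> c - \<psi> a \<le> L * (c - a)" if "\<psi> b - \<psi> a \<le> L * (b - a)" "\<psi> c - \<psi> b \<le> L * (c - b)" for a b c
        using that by (simp add: algebra_simps)
      fix t :: real assume t: "0 \<le> t" "t \<le> 1"
      show "\<exists>d>0. \<forall>a b. a \<le> t \<and> t \<le> b \<and> b - a < d \<longrightarrow> \<psi> b - \<psi> a \<le> L * (b - a)"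
      proof (cases "e = 0")
        case True
        then show ?thesis using R C(1) by (intro exI[of _ 1]) (auto simp: \<psi>_def \<gamma>_def L_def)
      next
        case False
        obtain \<epsilon> where \<epsilon>: "\<epsilon> > 0" "ball (\<gamma> t) \<epsilon> \<subseteq> ?D" "\<And>z. z \<in> ball (\<gamma> t) \<epsilon> - {\<gamma> t} \<Longrightarrow> s z \<in> range (chart_pt \<theta> \<kappa> XY z)"
          using solution_section_leaves_divisor[OF s \<gamma>D[OF t]] by blast
        define d where "d = \<epsilon> / norm e"
        have d: "d > 0" using \<epsilon>(1) False by (simp add: d_def)
        have near: "\<gamma> r \<in> ball (\<gamma> t) \<epsilon>" if "\<bar>r - t\<bar> < d" for r
        proof -
          have "\<gamma> t - \<gamma> r = of_real (t - r) * e" by (simp add: \<gamma>_def algebra_simps)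
          then have "dist (\<gamma> t) (\<gamma> r) = \<bar>t - r\<bar> * norm e" by (simp only: dist_norm norm_mult norm_of_real)
          also have "\<dots> < d * norm e" using that False by (intro mult_strict_right_mono) auto
          finally show ?thesis using False by (simp add: d_def)
        qed
        have inj\<gamma>: "\<gamma> r \<noteq> \<gamma> t" if "r \<noteq> t" for r using that False by (simp add: \<gamma>_def)
        have mvt: "\<psi> b - \<psi> a \<le> L * (b - a)"
          if ab: "a \<le> b" and near_ab: "\<And>r. a \<le> r \<Longrightarrow> r \<le> b \<Longrightarrow> \<bar>r - t\<bar> < d" and off: "\<And>r. a < r \<Longrightarrow> r < b \<Longrightarrow> r \<noteq> t" for a b
        proof (cases "a = b")
          case False
          then have "a < b" using ab by simp
          have der: "\<exists>d. (\<psi> has_real_derivative d) (at r) \<and> \<bar>d\<bar> \<le> L" if "a < r" "r < b" for r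
            using near[OF near_ab, of r] \<epsilon>(2,3) inj\<gamma>[OF off[OF that]] that by (intro deriv) auto
          have "\<exists>l r. a < r \<and> r < b \<and> DERIV \<psi> r :> l \<and> \<psi> b - \<psi> a = (b - a) * l"
          proof (rule MVT[OF \<open>a < b\<close>])
            show "continuous_on {a..b} \<psi>"
            proof (intro continuous_at_imp_continuous_on ballI cont)
              fix r assume "r \<in> {a..b}"
              then have "\<bar>r - t\<bar> < d" using near_ab by simp
              then show "\<gamma> r \<in> ?D" using near \<epsilon>(2) by blast
            qed
            show "\<psi> differentiable (at r)" if "a < r" "r < b" for r
              using der[OF that] real_differentiable_def by blast
          qed
          then obtain l r where l: "a < r" "r < b" "DERIV \<psi> r :> l" "\<psi> b - \<psi> a = (b - a) * l" by blast
          obtain l' where "(\<psi> has_real_derivative l') (at r)" "\<bar>l'\<bar> \<le> L" using der[OF l(1,2)] by blast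
          then have "l \<le> L" using DERIV_unique[OF l(3)] by fastforce
          then show ?thesis unfolding l(4) using \<open>a < b\<close> by (simp add: mult.commute mult_right_mono)
        qed simp
        have "\<psi> b - \<psi> a \<le> L * (b - a)" if "a \<le> t" "t \<le> b" "b - a < d" for a b
        proof -
          have "\<psi> t - \<psi> a \<le> L * (t - a)" using that by (intro mvt) auto
          moreover have "\<psi> b - \<psi> t \<le> L * (b - t)" using that by (intro mvt) auto
          ultimately show ?thesis by (simp add: algebra_simps)
        qed
        then show ?thesis using d by blast
      qed
    qed simp
    then show "ln (1 + (norm (aux_on_section \<theta> \<kappa> z1 (s z1)))^2) \<le> ln (1 + (norm (aux_on_section \<theta> \<kappa> z0 (s z0)))^2) + L"
      by (simp add: \<psi>_def \<gamma>_def e_def)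
  qed
qed

section \<open>Extension of sections to the whole plane\<close>

lemma solution_section_glue:
  assumes s: "\<And>i. i \<in> I \<Longrightarrow> solution_section \<theta> \<kappa> (D i) (\<sigma> i)"
    and eq: "\<And>i j t. i \<in> I \<Longrightarrow> j \<in> I \<Longrightarrow> t \<in> D i \<Longrightarrow> t \<in> D j \<Longrightarrow> \<sigma> i t = \<sigma> j t"
  obtains s where "solution_section \<theta> \<kappa> (\<Union>i\<in>I. D i) s" "\<And>i t. i \<in> I \<Longrightarrow> t \<in> D i \<Longrightarrow> s t = \<sigma> i t"
proof -
  define s where "s t = \<sigma> (SOME i. i \<in> I \<and> t \<in> D i) t" for t
  have s_eq: "s t = \<sigma> i t" if "i \<in> I" "t \<in> D i" for i t
  proof -
    have "(SOME i. i \<in> I \<and> t \<in> D i) \<in> I \<and> t \<in> D (SOME i. i \<in> I \<and> t \<in> D i)"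
      by (rule someI[of "\<lambda>i. i \<in> I \<and> t \<in> D i"]) (use that in simp)
    then show ?thesis unfolding s_def using eq that by blast
  qed
  show thesis
  proof (rule that[of s])
    show "solution_section \<theta> \<kappa> (\<Union>i\<in>I. D i) s"
      unfolding solution_section_def
    proof
      fix z assume "z \<in> (\<Union>i\<in>I. D i)"
      then obtain i where i: "i \<in> I" "z \<in> D i" by blast
      obtain c v \<epsilon> where v: "\<epsilon> > 0" "ball z \<epsilon> \<subseteq> D i" "solution_on (chart_field \<theta> \<kappa> c) (ball z \<epsilon>) v"
        "\<And>t. t \<in> ball z \<epsilon> \<Longrightarrow> \<sigma> i t = chart_pt \<theta> \<kappa> c t (v t)" "c = XY \<or> v z $ 2 = 0"
        by (rule solution_sectionE[OF s[OF i(1)] i(2)]) (rule that)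
      have sub: "ball z \<epsilon> \<subseteq> (\<Union>i\<in>I. D i)" using v(2) i(1) by blast
      have "\<forall>t\<in>ball z \<epsilon>. s t = chart_pt \<theta> \<kappa> c t (v t)"
      proof
        fix t assume t: "t \<in> ball z \<epsilon>"
        then have "t \<in> D i" using v(2) by (rule subsetD[rotated])
        from s_eq[OF i(1) this] v(4)[OF t] show "s t = chart_pt \<theta> \<kappa> c t (v t)" by (rule trans)
      qed
      then show "\<exists>c v \<epsilon>. \<epsilon> > 0 \<and> ball z \<epsilon> \<subseteq> (\<Union>i\<in>I. D i) \<and>
          solution_on (chart_field \<theta> \<kappa> c) (ball z \<epsilon>) v \<and> (\<forall>t\<in>ball z \<epsilon>. s t = chart_pt \<theta> \<kappa> c t (v t))"
        by (intro exI[of _ c] exI[of _ v] exI[of _ \<epsilon>] conjI v(1,3) sub)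
    qed
  qed (rule s_eq)
qed

text \<open>Every point of a sublevel set has bounded coordinates in some chart, where
  \<open>solution_exists\<close> gives a uniform radius; \<open>\<delta>\<close> is the least of
  these over the four charts.\<close>

lemma solution_section_through_sublevel:
  assumes R: "R \<ge> 0" and V0: "V0 \<ge> 0"
  obtains \<delta> where "\<delta> > 0" "\<And>c z p. norm z \<le> R \<Longrightarrow> norm (aux_fun \<theta> \<kappa> c z p) \<le> V0 \<Longrightarrow>
    \<exists>\<sigma>. solution_section \<theta> \<kappa> (ball z \<delta>) \<sigma> \<and> \<sigma> z = chart_pt \<theta> \<kappa> c z p"
proof -
  obtain M where M: "\<And>c p z. norm z \<le> R \<Longrightarrow> norm (aux_fun \<theta> \<kappa> c z p) \<le> V0 \<Longrightarrow>
     \<exists>d q. chart_pt \<theta> \<kappa> d z q = chart_pt \<theta> \<kappa> c z p \<and> norm q \<le> M"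
    by (rule aux_fun_sublevel_bounded[OF R V0]) (rule that)
  have "\<exists>\<delta>>0. \<forall>z p. norm z \<le> max R M \<longrightarrow> norm p \<le> max R M \<longrightarrow>
      (\<exists>v. solution_on (chart_field \<theta> \<kappa> c) (ball z \<delta>) v \<and> v z = p)" for c
    by (rule solution_exists[OF lipschitz_field_chart_field])
  then obtain \<delta> where \<delta>: "\<And>c. \<delta> c > 0" "\<And>c z p. norm z \<le> max R M \<Longrightarrow> norm p \<le> max R M \<Longrightarrow>
      \<exists>v. solution_on (chart_field \<theta> \<kappa> c) (ball z (\<delta> c)) v \<and> v z = p"
    by metis
  show thesis
  proof (rule that[of "Min (range \<delta>)"])
    show "Min (range \<delta>) > 0" using \<delta>(1) by simp
    fix c z p assume z: "norm z \<le> R" and "norm (aux_fun \<theta> \<kappa> c z p) \<le> V0"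
    then obtain d q where q: "chart_pt \<theta> \<kappa> d z q = chart_pt \<theta> \<kappa> c z p" "norm q \<le> M" using M by blast
    then obtain v where v: "solution_on (chart_field \<theta> \<kappa> d) (ball z (\<delta> d)) v" "v z = q"
      using \<delta>(2)[of z q d] z by (auto simp: le_max_iff_disj)
    have "ball z (Min (range \<delta>)) \<subseteq> ball z (\<delta> d)" by (intro subset_ball) simp
    from solution_section_of_solution[OF solution_on_subset[OF v(1) this] open_ball]
    show "\<exists>\<sigma>. solution_section \<theta> \<kappa> (ball z (Min (range \<delta>))) \<sigma> \<and> \<sigma> z = chart_pt \<theta> \<kappa> c z p"
      using v(2) q(1) by (intro exI[of _ "\<lambda>t. chart_pt \<theta> \<kappa> d t (v t)"]) simp
  qed
qed

text \<open>The gain \<open>\<delta>\<close> is the same for all radii with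
  \<open>norm z0 + \<rho> \<le> R\<close>, since the growth bound sees the section only through its
  value \<open>S0\<close> at \<open>z0\<close>. From every point of the disc the section continues
  to a disc of radius \<open>\<delta>\<close>, and these continuations fit together.\<close>

lemma solution_section_extend:
  assumes R: "R \<ge> 0"
  obtains \<delta> where "\<delta> > 0" "\<And>\<rho> s. \<rho> > 0 \<Longrightarrow> norm z0 + \<rho> \<le> R \<Longrightarrow> solution_section \<theta> \<kappa> (ball z0 \<rho>) s \<Longrightarrow> s z0 = S0 \<Longrightarrow>
    \<exists>s'. solution_section \<theta> \<kappa> (ball z0 (\<rho> + \<delta>)) s' \<and> s' z0 = S0"
proof -
  obtain L where L: "L \<ge> 0" "\<And>z0 \<rho> s z. solution_section \<theta> \<kappa> (ball z0 \<rho>) s \<Longrightarrow> norm z0 + \<rho> \<le> R \<Longrightarrow> z \<in> ball z0 \<rho> \<Longrightarrow>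
    ln (1 + (norm (aux_on_section \<theta> \<kappa> z (s z)))^2) \<le> ln (1 + (norm (aux_on_section \<theta> \<kappa> z0 (s z0)))^2) + L"
    by (rule aux_on_section_bound[OF R]) (rule that)
  define V0 where "V0 = exp (ln (1 + (norm (aux_on_section \<theta> \<kappa> z0 S0))^2) + L)"
  have "V0 \<ge> 0" by (simp add: V0_def)
  then obtain \<delta> where \<delta>: "\<delta> > 0" "\<And>c z p. norm z \<le> R \<Longrightarrow> norm (aux_fun \<theta> \<kappa> c z p) \<le> V0 \<Longrightarrow>
    \<exists>\<sigma>. solution_section \<theta> \<kappa> (ball z \<delta>) \<sigma> \<and> \<sigma> z = chart_pt \<theta> \<kappa> c z p"
    by (rule solution_section_through_sublevel[OF R]) (rule that)
  show thesis
  proof (rule that[OF \<delta>(1)])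
    fix \<rho> s assume \<rho>: "\<rho> > 0" "norm z0 + \<rho> \<le> R" and s: "solution_section \<theta> \<kappa> (ball z0 \<rho>) s" "s z0 = S0"
    let ?B = "ball z0 \<rho>"
    have "\<exists>\<sigma>. solution_section \<theta> \<kappa> (ball a \<delta>) \<sigma> \<and> \<sigma> a = s a" if a: "a \<in> ?B" for a
    proof -
      obtain c v \<epsilon> where v: "\<epsilon> > 0" "ball a \<epsilon> \<subseteq> ?B" "solution_on (chart_field \<theta> \<kappa> c) (ball a \<epsilon>) v"
        "\<And>t. t \<in> ball a \<epsilon> \<Longrightarrow> s t = chart_pt \<theta> \<kappa> c t (v t)" "c = XY \<or> v a $ 2 = 0"
        by (rule solution_sectionE[OF s(1) a]) (rule that)
      have sa: "s a = chart_pt \<theta> \<kappa> c a (v a)" using v(1,4) by simp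
      let ?n = "norm (aux_fun \<theta> \<kappa> c a (v a))"
      have "ln (1 + ?n^2) \<le> ln (1 + (norm (aux_on_section \<theta> \<kappa> z0 S0))^2) + L"
        using L(2)[OF s(1) \<rho>(2) a] unfolding sa aux_on_section_chart_pt s(2) .
      then have "exp (ln (1 + ?n^2)) \<le> V0" unfolding V0_def by (rule iffD2[OF exp_le_cancel_iff])
      then have "1 + ?n^2 \<le> V0" by (simp add: add_pos_nonneg)
      moreover have "?n \<le> 1 + ?n^2" 
        using sum_squares_bound[of ?n 1] norm_ge_zero[of "aux_fun \<theta> \<kappa> c a (v a)"] by (simp only: power_one mult_1_right)
      moreover have "norm a \<le> R"
        using a \<rho>(2) norm_triangle_sub[of a z0] by (simp add: dist_norm norm_minus_commute)
      ultimately show ?thesis unfolding sa by (intro \<delta>(2)) linarith+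
    qed
    then obtain \<sigma> where \<sigma>: "\<And>a. a \<in> ?B \<Longrightarrow> solution_section \<theta> \<kappa> (ball a \<delta>) (\<sigma> a)" "\<And>a. a \<in> ?B \<Longrightarrow> \<sigma> a a = s a"
      by metis
    have \<sigma>s: "\<sigma> a t = s t" if a: "a \<in> ?B" and t: "t \<in> ball a \<delta>" "t \<in> ?B" for a t
    proof (rule solution_section_unique)
      show "solution_section \<theta> \<kappa> (ball a \<delta> \<inter> ?B) (\<sigma> a)" by (rule solution_section_subset[OF \<sigma>(1)[OF a]]) auto
      show "solution_section \<theta> \<kappa> (ball a \<delta> \<inter> ?B) s" by (rule solution_section_subset[OF s(1)]) auto
      show "connected (ball a \<delta> \<inter> ?B)" by (intro convex_connected convex_Int convex_ball)
      show "a \<in> ball a \<delta> \<inter> ?B" using a \<delta>(1) by simp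
    qed (use \<sigma>(2)[OF a] t in auto)
    have agree: "\<sigma> a t = \<sigma> b t" if ab: "a \<in> ?B" "b \<in> ?B" and t: "t \<in> ball a \<delta>" "t \<in> ball b \<delta>" for a b t
    proof -
      \<comment> \<open>If the small discs around \<open>a\<close> and \<open>b\<close> meet, the
        midpoint lies in both and, by convexity, in the ball, where both continuations equal
        \<open>s\<close>.\<close>
      define m where "m = midpoint a b"
      have "dist a b < 2 * \<delta>" using t dist_triangle[of a b t] by (simp add: dist_commute)
      then have m\<delta>: "m \<in> ball a \<delta>" "m \<in> ball b \<delta>" unfolding m_def by (simp_all add: dist_midpoint)
      have mB: "m \<in> ?B"
        using convexD_alt[OF convex_ball ab, of "1/2"] unfolding m_def midpoint_def by (simp add: scaleR_add_right)
      show ?thesis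
      proof (rule solution_section_unique)
        show "solution_section \<theta> \<kappa> (ball a \<delta> \<inter> ball b \<delta>) (\<sigma> a)" by (rule solution_section_subset[OF \<sigma>(1)[OF ab(1)]]) auto
        show "solution_section \<theta> \<kappa> (ball a \<delta> \<inter> ball b \<delta>) (\<sigma> b)" by (rule solution_section_subset[OF \<sigma>(1)[OF ab(2)]]) auto
        show "connected (ball a \<delta> \<inter> ball b \<delta>)" by (intro convex_connected convex_Int convex_ball)
        show "m \<in> ball a \<delta> \<inter> ball b \<delta>" using m\<delta> by simp
        show "\<sigma> a m = \<sigma> b m" using \<sigma>s[OF ab(1) m\<delta>(1) mB] \<sigma>s[OF ab(2) m\<delta>(2) mB] by simp
      qed (use t in auto)
    qed
    obtain s' where s': "solution_section \<theta> \<kappa> (\<Union>a\<in>?B. ball a \<delta>) s'" "\<And>a t. a \<in> ?B \<Longrightarrow> t \<in> ball a \<delta> \<Longrightarrow> s' t = \<sigma> a t"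
      by (rule solution_section_glue[of ?B \<theta> \<kappa> "\<lambda>a. ball a \<delta>" \<sigma>]) (use \<sigma>(1) agree in blast)+
    have "ball z0 (\<rho> + \<delta>) \<subseteq> (\<Union>a\<in>?B. ball a \<delta>)"
    proof
      fix t assume t: "t \<in> ball z0 (\<rho> + \<delta>)"
      define e where "e = t - z0"
      have e: "norm e < \<rho> + \<delta>" using t by (simp add: e_def dist_norm norm_minus_commute)
      \<comment> \<open>\<open>a\<close> divides the segment from \<open>z0\<close> to
        \<open>t\<close> in the ratio of \<open>\<rho>\<close> to \<open>\<delta>\<close>.\<close>
      define a where "a = z0 + (\<rho> / (\<rho> + \<delta>)) *\<^sub>R e"
      have "t - a = (1 - \<rho> / (\<rho> + \<delta>)) *\<^sub>R e" by (simp add: a_def e_def algebra_simps)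
      moreover have "1 - \<rho> / (\<rho> + \<delta>) = \<delta> / (\<rho> + \<delta>)" using \<rho> \<delta>(1) by (simp add: field_simps)
      ultimately have "t - a = (\<delta> / (\<rho> + \<delta>)) *\<^sub>R e" by simp
      moreover define q where "q = norm e / (\<rho> + \<delta>)"
      ultimately have "dist t a = \<delta> * q" "dist z0 a = \<rho> * q" unfolding dist_norm using \<rho> \<delta>(1) by (simp_all add: a_def)
      moreover have "q < 1" using e \<rho> \<delta>(1) by (simp add: q_def divide_less_eq)
      ultimately have "a \<in> ?B" "t \<in> ball a \<delta>"
        using \<rho>(1) \<delta>(1) by (simp_all add: dist_commute[of a t])
      then show "t \<in> (\<Union>a\<in>?B. ball a \<delta>)" by blast
    qed
    then have "solution_section \<theta> \<kappa> (ball z0 (\<rho> + \<delta>)) s'" by (rule solution_section_subset[OF s'(1)]) simp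
    moreover have "s' z0 = S0" using s'(2)[of z0 z0] \<sigma>(2)[of z0] s(2) \<rho>(1) \<delta>(1) by simp
    ultimately show "\<exists>s'. solution_section \<theta> \<kappa> (ball z0 (\<rho> + \<delta>)) s' \<and> s' z0 = S0" by blast
  qed
qed

text \<open>For a fixed target radius finitely many extensions by one \<open>\<delta>\<close>
  suffice. By uniqueness the sections on discs of growing radius agree, and these discs exhaust the
  plane.\<close>

lemma global_solution_section_exists:
  assumes "r > 0" and s: "solution_section \<theta> \<kappa> (ball z0 r) s"
  obtains S where "solution_section \<theta> \<kappa> UNIV S" "S z0 = s z0"
proof -
  have "\<exists>s'. solution_section \<theta> \<kappa> (ball z0 \<rho>) s' \<and> s' z0 = s z0" for \<rho>
  proof -
    obtain \<delta> where \<delta>: "\<delta> > 0" "\<And>\<rho>' s'. \<rho>' > 0 \<Longrightarrow> norm z0 + \<rho>' \<le> norm z0 + \<bar>\<rho>\<bar> \<Longrightarrow> solution_section \<theta> \<kappa> (ball z0 \<rho>') s' \<Longrightarrow>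
        s' z0 = s z0 \<Longrightarrow> \<exists>s''. solution_section \<theta> \<kappa> (ball z0 (\<rho>' + \<delta>)) s'' \<and> s'' z0 = s z0"
      by (rule solution_section_extend[of "norm z0 + \<bar>\<rho>\<bar>" z0 \<theta> \<kappa> "s z0"]) (simp, rule that)
    have step: "\<exists>s'. solution_section \<theta> \<kappa> (ball z0 \<rho>') s' \<and> s' z0 = s z0" if "\<rho>' \<le> \<rho>" "\<rho>' \<le> r + real k * \<delta>" for \<rho>' k
      using that
    proof (induction k arbitrary: \<rho>')
      case 0
      then have "ball z0 \<rho>' \<subseteq> ball z0 r" by (intro subset_ball) simp
      from solution_section_subset[OF s this] show ?case by auto
    next
      case (Suc k)
      show ?case
      proof (cases "\<rho>' \<le> r + real k * \<delta>")
        case True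
        then show ?thesis using Suc by blast
      next
        case False
        define \<rho>'' where "\<rho>'' = r + real k * \<delta>"
        have "\<rho>'' > 0" using assms(1) \<delta>(1) by (simp add: \<rho>''_def add_pos_nonneg)
        moreover have "\<rho>'' \<le> \<rho>" using False Suc.prems(1) by (simp add: \<rho>''_def)
        moreover from this Suc.IH[of \<rho>''] obtain s' where "solution_section \<theta> \<kappa> (ball z0 \<rho>'') s'" "s' z0 = s z0"
          unfolding \<rho>''_def by blast
        ultimately obtain s'' where s'': "solution_section \<theta> \<kappa> (ball z0 (\<rho>'' + \<delta>)) s''" "s'' z0 = s z0"
          using \<delta>(2)[of \<rho>'' s'] by auto
        have "ball z0 \<rho>' \<subseteq> ball z0 (\<rho>'' + \<delta>)" using Suc.prems(2) by (intro subset_ball) (simp add: \<rho>''_def algebra_simps)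
        from solution_section_subset[OF s''(1) this] s''(2) show ?thesis by auto
      qed
    qed
    obtain k :: nat where "\<rho> < real k * \<delta>" using reals_Archimedean3[OF \<delta>(1)] by blast
    then show ?thesis using step[of \<rho> k] assms(1) by simp
  qed
  then have "\<forall>n. \<exists>s'. solution_section \<theta> \<kappa> (ball z0 (real (Suc n))) s' \<and> s' z0 = s z0" by blast
  from choice[OF this] obtain \<sigma> where
    \<sigma>: "\<And>n. solution_section \<theta> \<kappa> (ball z0 (real (Suc n))) (\<sigma> n)" "\<And>n. \<sigma> n z0 = s z0" by blast
  have agree: "\<sigma> m t = \<sigma> n t" if t: "t \<in> ball z0 (real (Suc m))" "t \<in> ball z0 (real (Suc n))" for m n t
  proof (rule solution_section_unique)
    let ?D = "ball z0 (real (Suc m)) \<inter> ball z0 (real (Suc n))"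
    show "solution_section \<theta> \<kappa> ?D (\<sigma> m)" by (rule solution_section_subset[OF \<sigma>(1)[of m]]) auto
    show "solution_section \<theta> \<kappa> ?D (\<sigma> n)" by (rule solution_section_subset[OF \<sigma>(1)[of n]]) auto
    show "connected ?D" by (intro convex_connected convex_Int convex_ball)
    show "z0 \<in> ?D" by simp
  qed (use t \<sigma>(2) in auto)
  obtain S where S: "solution_section \<theta> \<kappa> (\<Union>n. ball z0 (real (Suc n))) S"
    "\<And>n t. n \<in> UNIV \<Longrightarrow> t \<in> ball z0 (real (Suc n)) \<Longrightarrow> S t = \<sigma> n t"
    by (rule solution_section_glue[of UNIV \<theta> \<kappa> "\<lambda>n. ball z0 (real (Suc n))" \<sigma>, OF \<sigma>(1) agree]) (assumption+, rule that)
  have U: "(\<Union>n. ball z0 (real (Suc n))) = UNIV"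
  proof (intro set_eqI iffI)
    fix t :: complex
    obtain n where "dist z0 t < real n" using reals_Archimedean2 by blast
    then have "t \<in> ball z0 (real (Suc n))" by simp
    then show "t \<in> (\<Union>n. ball z0 (real (Suc n)))" by blast
  qed simp
  show thesis
  proof (rule that)
    show "solution_section \<theta> \<kappa> UNIV S" using S(1) unfolding U .
    show "S z0 = s z0" using S(2)[of 0 z0] \<sigma>(2)[of 0] by simp
  qed
qed

section \<open>From solution sections to holomorphic sections of the bundle\<close>

lemma holomorphic_fun_on_compose_curve:
  assumes g: "holomorphic_fun_on g S" and S: "open S" "h z \<in> S"
    and h: "\<And>k. (\<lambda>t. h t $ k) field_differentiable at z"
  shows "(\<lambda>t. g (h t)) field_differentiable at z"
proof -
  obtain d where d: "\<And>k. ((\<lambda>t. h t $ k) has_field_derivative d k) (at z)"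
    using h unfolding field_differentiable_def by metis
  obtain a where "(g has_derivative (\<lambda>v. \<Sum>k\<in>UNIV. a $ k * v $ k)) (at (h z))"
    using g S(2) unfolding holomorphic_fun_on_def at_within_open[OF S(2,1), symmetric] by blast
  moreover have "(h has_derivative (\<lambda>x. \<chi> k. d k * x)) (at z)"
  proof -
    have "(h has_derivative (\<lambda>x. \<chi> k. d k * x)) (at z) \<longleftrightarrow>
        (\<forall>i\<in>Basis. ((\<lambda>t. h t \<bullet> i) has_derivative (\<lambda>x. (\<chi> k. d k * x) \<bullet> i)) (at z))"
      by (rule has_derivative_componentwise_within)
    moreover have "((\<lambda>t. h t \<bullet> i) has_derivative (\<lambda>x. (\<chi> k. d k * x) \<bullet> i)) (at z)" if i: "i \<in> Basis" for i
    proof -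
      obtain k b where i: "i = axis k b" using i unfolding Basis_vec_def by blast
      have "((\<lambda>t. h t $ k) has_derivative (\<lambda>x. d k * x)) (at z)" using d[of k] by (simp add: has_field_derivative_def)
      from has_derivative_inner_left[OF this] show ?thesis by (simp add: i inner_axis)
    qed
    ultimately show ?thesis by blast
  qed
  ultimately have "((\<lambda>t. g (h t)) has_derivative (\<lambda>x. \<Sum>k\<in>UNIV. a $ k * (\<chi> k. d k * x) $ k)) (at z)"
    by (rule has_derivative_compose[rotated])
  moreover have "(\<Sum>k\<in>UNIV. a $ k * (\<chi> k. d k * x) $ k) = (\<Sum>k\<in>UNIV. a $ k * d k) * x" for x
    by (simp add: sum_distrib_right mult.assoc)
  ultimately show ?thesis unfolding field_differentiable_def has_field_derivative_def by auto
qed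

context glued_charts
begin

text \<open>Holomorphic coordinates in one chart near each time suffice, because any other chart is
  reached through a holomorphic transition map.\<close>

lemma curve_in_charts:
  assumes s: "\<And>z. \<exists>c h. (\<forall>k. (\<lambda>t. h t $ k) field_differentiable at z) \<and> (\<forall>\<^sub>F t in nhds z. s t = f c (h t))"
  shows "continuous_map euclidean glued_space s"
    and "(\<lambda>z. inv (f d) (s z) $ k) holomorphic_on {z. s z \<in> range (f d)}"
proof -
  have cont: "\<forall>\<^sub>F t in nhds z. h t \<in> W"
    if h: "\<forall>k. (\<lambda>t. h t $ k) field_differentiable at z" and W: "open W" "h z \<in> W" for h z and W :: "(complex^'n) set"
  proof -
    have "isCont (\<lambda>t. h t $ k) z" for k using h by (simp add: field_differentiable_imp_continuous_at)
    then have "isCont h z" unfolding isCont_def by (intro vec_tendstoI)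
    from topological_tendstoD[OF this[unfolded isCont_def] W] show ?thesis
      using W(2) by (simp add: eventually_nhds_conv_at)
  qed
  show "continuous_map euclidean glued_space s"
    unfolding continuous_map
  proof (intro conjI allI impI)
    show "s ` topspace euclidean \<subseteq> topspace glued_space"
    proof
      fix y assume "y \<in> s ` topspace euclidean"
      then obtain z where y: "y = s z" by auto
      obtain c h where "\<forall>\<^sub>F t in nhds z. s t = f c (h t)" using s by blast
      from eventually_nhds_x_imp_x[OF this] show "y \<in> topspace glued_space" by (auto simp: y topspace_glued_space)
    qed
    fix U assume U: "openin glued_space U"
    have "\<forall>\<^sub>F t in nhds z. s t \<in> U" if z: "s z \<in> U" for z
    proof -
      obtain c h where h: "\<forall>k. (\<lambda>t. h t $ k) field_differentiable at z" "\<forall>\<^sub>F t in nhds z. s t = f c (h t)"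
        using s by blast
      have "h z \<in> f c -` U" using z eventually_nhds_x_imp_x[OF h(2)] by simp
      moreover have "open (f c -` U)" using U openin_glued_space by blast
      ultimately have "\<forall>\<^sub>F t in nhds z. h t \<in> f c -` U" by (intro cont h(1))
      with h(2) show ?thesis by eventually_elim simp
    qed
    then have "open {z. s z \<in> U}"
      unfolding open_subopen[of "{z. s z \<in> U}"] eventually_nhds by (metis mem_Collect_eq subsetI)
    then show "openin euclidean {z \<in> topspace euclidean. s z \<in> U}" by simp
  qed
  show "(\<lambda>z. inv (f d) (s z) $ k) holomorphic_on {z. s z \<in> range (f d)}"
    unfolding holomorphic_on_def
  proof
    fix z assume z: "z \<in> {z. s z \<in> range (f d)}"
    obtain c h where h: "\<forall>k. (\<lambda>t. h t $ k) field_differentiable at z" "\<forall>\<^sub>F t in nhds z. s t = f c (h t)"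
      using s by blast
    have "f c (h z) \<in> range (f d)" using z eventually_nhds_x_imp_x[OF h(2)] by simp
    then have hz: "h z \<in> dmn c d" unfolding range_iff .
    have tr: "holomorphic_fun_on (\<lambda>q. tr c d q $ k) (dmn c d)" using hol_tr unfolding holomorphic_map_on_def by blast
    have "(\<lambda>t. tr c d (h t) $ k) field_differentiable at z"
      by (rule holomorphic_fun_on_compose_curve[where h = h, OF tr open_dmn hz]) (use h(1) in blast)
    then obtain D where D: "((\<lambda>t. tr c d (h t) $ k) has_field_derivative D) (at z)"
      unfolding field_differentiable_def by blast
    have "\<forall>\<^sub>F t in nhds z. h t \<in> dmn c d" by (intro cont h(1) open_dmn hz)
    with h(2) have "\<forall>\<^sub>F t in nhds z. tr c d (h t) $ k = inv (f d) (s t) $ k"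
      by eventually_elim (simp add: tr_inv)
    from D[unfolded DERIV_cong_ev[OF refl this refl]]
    show "(\<lambda>z. inv (f d) (s z) $ k) field_differentiable at z within {z. s z \<in> range (f d)}"
      using field_differentiable_at_within field_differentiable_def by blast
  qed
qed

end

lemma global_holomorphic_section_of_solution_section:
  assumes S: "solution_section \<theta> \<kappa> UNIV S"
  shows "global_holomorphic_section (P_space \<theta> \<kappa>) (P_atlas \<theta> \<kappa>) (\<lambda>z. (S z, z))"
proof -
  interpret glued_charts "total_pt \<theta> \<kappa>" "total_dom \<theta> \<kappa>" "total_tr \<theta> \<kappa>" by (rule total_glued_charts)
  have loc: "\<exists>c h. (\<forall>k. (\<lambda>t. h t $ k) field_differentiable at z) \<and> (\<forall>\<^sub>F t in nhds z. (S t, t) = total_pt \<theta> \<kappa> c (h t))" for z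
  proof -
    obtain c v \<epsilon> where v: "\<epsilon> > 0" "ball z \<epsilon> \<subseteq> UNIV" "solution_on (chart_field \<theta> \<kappa> c) (ball z \<epsilon>) v"
      "\<And>t. t \<in> ball z \<epsilon> \<Longrightarrow> S t = chart_pt \<theta> \<kappa> c t (v t)" "c = XY \<or> v z $ 2 = 0"
      by (rule solution_sectionE[OF S UNIV_I[of z]]) (rule that)
    have vd: "(\<lambda>t. v t $ k) field_differentiable at z" for k
      using v(1,3) unfolding solution_on_def field_differentiable_def by (meson centre_in_ball)
    have "(\<lambda>t. emb3 t (v t) $ k) field_differentiable at z" for k
    proof -
      consider "k = 1" | "k = 2" | "k = 3" using exhaust_3[of k] by blast
      then show ?thesis by cases (simp_all add: vd field_differentiable_ident)
    qed
    moreover have "\<forall>\<^sub>F t in nhds z. t \<in> ball z \<epsilon>" by (rule eventually_nhds_in_open) (use v(1) in auto)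
    then have "\<forall>\<^sub>F t in nhds z. (S t, t) = total_pt \<theta> \<kappa> c (emb3 t (v t))"
      by eventually_elim (simp add: v(4))
    ultimately show ?thesis by (intro exI[of _ c] exI[of _ "\<lambda>t. emb3 t (v t)"]) blast
  qed
  show ?thesis
    unfolding global_holomorphic_section_def P_atlas_def P_space_eq
    using curve_in_charts[OF loc] by simp
qed

text \<open>A solution is continued globally from a small disc in its domain; as \<open>D\<close> is
  connected, uniqueness makes the global section agree with it on all of \<open>D\<close>.\<close>

lemma space_of_initial_conditions_PIV:
  "space_of_initial_conditions (PIV \<theta> \<kappa>) (chart_pt \<theta> \<kappa> XY)
     (E_space \<theta> \<kappa>) (E_atlas \<theta> \<kappa>) (P_space \<theta> \<kappa>) (P_atlas \<theta> \<kappa>)"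
  unfolding space_of_initial_conditions_def
proof (intro conjI allI impI)
  show "manifold_bundle (E_space \<theta> \<kappa>) (E_atlas \<theta> \<kappa>) (P_space \<theta> \<kappa>) (P_atlas \<theta> \<kappa>)" by (rule manifold_bundle_PIV)
  show "inj (chart_pt \<theta> \<kappa> XY z)" for z by (rule glued_charts.inj_chart[OF fiber_glued_charts])
  show "(range (chart_pt \<theta> \<kappa> XY z), inv (chart_pt \<theta> \<kappa> XY z)) \<in> E_atlas \<theta> \<kappa> z" for z
    by (simp add: E_atlas_def)
  fix D v assume *: "open D \<and> connected D \<and> D \<noteq> {} \<and> solution_on (PIV \<theta> \<kappa>) D v"
  then obtain z0 where z0: "z0 \<in> D" by blast
  have "chart_field \<theta> \<kappa> XY = PIV \<theta> \<kappa>" by (simp add: fun_eq_iff chart_field_def)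
  then have v: "solution_section \<theta> \<kappa> D (\<lambda>t. chart_pt \<theta> \<kappa> XY t (v t))"
    using * by (intro solution_section_of_solution) auto
  obtain r where r: "r > 0" "ball z0 r \<subseteq> D" using * z0 open_contains_ball by metis
  obtain S where S: "solution_section \<theta> \<kappa> UNIV S" "S z0 = chart_pt \<theta> \<kappa> XY z0 (v z0)"
    by (rule global_solution_section_exists[OF r(1) solution_section_subset[OF v r(2) open_ball]]) (rule that)
  have "S z = chart_pt \<theta> \<kappa> XY z (v z)" if "z \<in> D" for z
  proof (rule solution_section_unique)
    show "solution_section \<theta> \<kappa> D S" by (rule solution_section_subset[OF S(1)]) (use * in auto)
    show "solution_section \<theta> \<kappa> D (\<lambda>t. chart_pt \<theta> \<kappa> XY t (v t))" by (rule v)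
  qed (use * z0 S(2) that in auto)
  then show "\<exists>s. global_holomorphic_section (P_space \<theta> \<kappa>) (P_atlas \<theta> \<kappa>) s \<and> (\<forall>z\<in>D. s z = (chart_pt \<theta> \<kappa> XY z (v z), z))"
    using global_holomorphic_section_of_solution_section[OF S(1)] by (intro exI[of _ "\<lambda>z. (S z, z)"]) simp
qed

theorem theorem4p4:
  fixes \<theta> \<kappa> :: complex
  shows
    "space_of_initial_conditions (PIV \<theta> \<kappa>) (chart_pt \<theta> \<kappa> XY)
       (E_space \<theta> \<kappa>) (E_atlas \<theta> \<kappa>) (P_space \<theta> \<kappa>) (P_atlas \<theta> \<kappa>)
     \<and> (\<forall>c\<in>{UW3, UW6, UW9}. \<forall>z. symplectic_up_to_sign chart_overlap (to_xy \<theta> \<kappa> c z))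
     \<and> (\<forall>Z G. open Z \<and>
          (\<forall>z\<in>Z. polynomial_field (G z) \<and> hamiltonian_field (G z)) \<and>
          (\<forall>c\<in>{UW3, UW6, UW9}. \<exists>F.
             (\<forall>z\<in>Z. polynomial_field (F z) \<and> hamiltonian_field (F z)) \<and>
             expressed_in_coordinates Z chart_overlap (to_xy \<theta> \<kappa> c) G F)
          \<longrightarrow> (\<forall>z\<in>Z. \<forall>p. G z p = PIV \<theta> \<kappa> z p))"
proof (intro conjI allI impI ballI)
  show "space_of_initial_conditions (PIV \<theta> \<kappa>) (chart_pt \<theta> \<kappa> XY)
       (E_space \<theta> \<kappa>) (E_atlas \<theta> \<kappa>) (P_space \<theta> \<kappa>) (P_atlas \<theta> \<kappa>)"
    by (rule space_of_initial_conditions_PIV)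
  show "symplectic_up_to_sign chart_overlap (to_xy \<theta> \<kappa> c z)" if "c \<in> {UW3, UW6, UW9}" for c z
    using that by (intro symplectic_to_xy) auto
  fix Z G z p
  assume *: "open Z \<and> (\<forall>z\<in>Z. polynomial_field (G z) \<and> hamiltonian_field (G z)) \<and>
          (\<forall>c\<in>{UW3, UW6, UW9}. \<exists>F. (\<forall>z\<in>Z. polynomial_field (F z) \<and> hamiltonian_field (F z)) \<and>
             expressed_in_coordinates Z chart_overlap (to_xy \<theta> \<kappa> c) G F)" and z: "z \<in> Z"
  show "G z p = PIV \<theta> \<kappa> z p"
  proof (rule hamiltonian_system_unique)
    fix c assume "c \<noteq> XY"
    then have "c \<in> {UW3, UW6, UW9}" by (cases c) simp_all
    with * z show "\<exists>F. polynomial_field (F z) \<and> hamiltonian_field (F z) \<and>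
       expressed_in_coordinates Z chart_overlap (to_xy \<theta> \<kappa> c) G F" by meson
  qed (use * z in auto)
qed

end
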